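(* Let $G$ be a (topologically) finitely generated profinite group that is Fitting-free and let $c$ be a non-negative integer. If $G$ is hereditarily JNN$_c$F, then it is the inverse limit of a family $G_n$, for $n\geq 0$, of profinite groups with respect to surjective continuous homomorphisms $\rho_n\colon G_{n+1}\to G_n$ with the following properties: for every $n\geq 0$, $G_n$ has an open normal subgroup $P_n$ such that, upon setting $Q_n=P_{n+1}\rho_n$ (the image of $P_{n+1}$ under $\rho_n$), for every $n\geq 0$, (i) $G_n$ is virtually class-$c$ nilpotent; (ii) $P_n>Q_n$; (iii) $\gamma_{c+1}(P_n)>\mathrm{M}_{G_n}(\gamma_{c+1}(P_n))\geq\ker\rho_{n-1}\geq\gamma_{c+1}(Q_n)>1$ (where for $n=0$ the undefined term $\ker\rho_{n-1}$ is omitted from the chain); (iv) if $N$ is an open normal subgroup of $G_n$, then either $\gamma_{c+1}(N)\leq P_n$ or $\gamma_{c+1}(Q_n)\leq\gamma_{c+1}(N)$; (v) there is no non-normal closed subgroup $V$ of $G_n$ with at most $n$ conjugates in $G_n$ such that any pair of distinct conjugates of $V$ centralize each other and such that the normal closure $W=V^{G_n}$ satisfies $\gamma_{c+1}(P_n)\leq\gamma_{c+1}(\gamma_{c+1}(W))$. Conversely, if, for some integer $d\geq 1$, $G=\varprojlim G_n$ is an inverse limit of a countable family $G_n$ ($n\geq 0$) of $d$-generator profinite groups with respect to surjective continuous homomorphisms $\rho_n\colon G_{n+1}\to G_n$ such that $G$ is Fitting-free and there are open normal subgroups $P_n$ of $G_n$ for which, with $Q_n=P_{n+1}\rho_n$,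 conditions (i)–(v) hold for every $n\geq 0$, then $G$ is hereditarily JNN$_c$F.
   Context: For closed subgroups $K,L$ of a profinite group, $[K,L]$ denotes the closed subgroup generated by all commutators $[x,y]$ with $x\in K$, $y\in L$. The lower central series is $\gamma_1(K)=K$, $\gamma_{i+1}(K)=[\gamma_i(K),K]$. A profinite group is virtually class-$c$ nilpotent if it has a subgroup $H$ of finite index (equivalently, an open subgroup $H$) with $\gamma_{c+1}(H)=1$. A profinite group $G$ is JNN$_c$F if $G$ is not virtually class-$c$ nilpotent but $G/N$ is virtually class-$c$ nilpotent for every non-trivial closed normal subgroup $N$ of $G$; it is hereditarily JNN$_c$F if every open subgroup of $G$ is JNN$_c$F. A profinite group is Fitting-free if it has no non-trivial abelian closed normal subgroup. "$d$-generator" means topologically generated by $d$ elements. For a non-trivial closed normal subgroup $A$ of a profinite group $G$, $\mathrm{M}_G(A)$ denotes the intersection of all maximal $G$-invariant open subgroups of $A$ (i.e. of all maximal members of the set of proper open subgroups of $A$ that are normal in $G$). Maps are written on the right. *)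

theory Defs
  imports "HOL-Analysis.Analysis" "HOL-Algebra.Product_Groups"
begin

text \<open>
  A topological group is a HOL-Algebra group \<open>G\<close> together with a topology \<open>T\<close> on its carrier.
  A closed (or open) subgroup \<open>H\<close> of \<open>(G, T)\<close>, regarded as a topological group, is
  \<open>(G\<lparr>carrier := H\<rparr>, subtopology T H)\<close>.
\<close>

definition topological_group :: "('a, 'm) monoid_scheme \<Rightarrow> 'a topology \<Rightarrow> bool" where
  "topological_group G T \<longleftrightarrow>
     Group.group G \<and> topspace T = carrier G \<and>
     continuous_map (prod_topology T T) T (\<lambda>(x, y). x \<otimes>\<^bsub>G\<^esub> y) \<and>
     continuous_map T T (\<lambda>x. inv\<^bsub>G\<^esub> x)"

definition totally_disconnected_space :: "'a topology \<Rightarrow> bool" where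
  "totally_disconnected_space T \<longleftrightarrow> (\<forall>S. connectedin T S \<longrightarrow> (\<exists>x. S \<subseteq> {x}))"

definition profinite_group :: "('a, 'm) monoid_scheme \<Rightarrow> 'a topology \<Rightarrow> bool" where
  "profinite_group G T \<longleftrightarrow>
     topological_group G T \<and> compact_space T \<and> Hausdorff_space T \<and>
     totally_disconnected_space T"

definition closed_subgroup :: "('a, 'm) monoid_scheme \<Rightarrow> 'a topology \<Rightarrow> 'a set \<Rightarrow> bool" where
  "closed_subgroup G T H \<longleftrightarrow> subgroup H G \<and> closedin T H"

definition open_subgroup :: "('a, 'm) monoid_scheme \<Rightarrow> 'a topology \<Rightarrow> 'a set \<Rightarrow> bool" where
  "open_subgroup G T H \<longleftrightarrow> subgroup H G \<and> openin T H"

definition closed_normal :: "('a, 'm) monoid_scheme \<Rightarrow> 'a topology \<Rightarrow> 'a set \<Rightarrow> bool" where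
  "closed_normal G T N \<longleftrightarrow> N \<lhd> G \<and> closedin T N"

definition open_normal :: "('a, 'm) monoid_scheme \<Rightarrow> 'a topology \<Rightarrow> 'a set \<Rightarrow> bool" where
  "open_normal G T N \<longleftrightarrow> N \<lhd> G \<and> openin T N"

text \<open>The hulls below are intended for subsets of the carrier; otherwise they degenerate to
  \<^term>\<open>UNIV\<close>.\<close>

definition closed_generate :: "('a, 'm) monoid_scheme \<Rightarrow> 'a topology \<Rightarrow> 'a set \<Rightarrow> 'a set" where
  "closed_generate G T S = closed_subgroup G T hull S"

definition closed_normal_closure :: "('a, 'm) monoid_scheme \<Rightarrow> 'a topology \<Rightarrow> 'a set \<Rightarrow> 'a set" where
  "closed_normal_closure G T S = closed_normal G T hull S"

text \<open>At most \<open>d\<close> distinct elements is the same as \<open>d\<close> elements with repetitions allowed.\<close>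

definition generator_group :: "nat \<Rightarrow> ('a, 'm) monoid_scheme \<Rightarrow> 'a topology \<Rightarrow> bool" where
  "generator_group d G T \<longleftrightarrow>
     (\<exists>S \<subseteq> carrier G. finite S \<and> card S \<le> d \<and> closed_generate G T S = carrier G)"

definition finitely_generated :: "('a, 'm) monoid_scheme \<Rightarrow> 'a topology \<Rightarrow> bool" where
  "finitely_generated G T \<longleftrightarrow> (\<exists>d. generator_group d G T)"

definition commutator :: "('a, 'm) monoid_scheme \<Rightarrow> 'a \<Rightarrow> 'a \<Rightarrow> 'a" where
  "commutator G x y = inv\<^bsub>G\<^esub> x \<otimes>\<^bsub>G\<^esub> inv\<^bsub>G\<^esub> y \<otimes>\<^bsub>G\<^esub> x \<otimes>\<^bsub>G\<^esub> y"

definition commutator_subgroup ::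
  "('a, 'm) monoid_scheme \<Rightarrow> 'a topology \<Rightarrow> 'a set \<Rightarrow> 'a set \<Rightarrow> 'a set" where
  "commutator_subgroup G T K L = closed_generate G T {commutator G x y | x y. x \<in> K \<and> y \<in> L}"

text \<open>\<open>lower_central G T i K\<close> is \<open>\<gamma>\<^sub>i(K)\<close>, numbered from \<open>\<gamma>\<^sub>1(K) = K\<close>; the value at \<open>i = 0\<close> is
  never used.\<close>

primrec lower_central ::
  "('a, 'm) monoid_scheme \<Rightarrow> 'a topology \<Rightarrow> nat \<Rightarrow> 'a set \<Rightarrow> 'a set" where
  "lower_central G T 0 K = K"
| "lower_central G T (Suc i) K =
     (if i = 0 then K else commutator_subgroup G T (lower_central G T i K) K)"

definition virtually_nilpotent ::
  "nat \<Rightarrow> ('a, 'm) monoid_scheme \<Rightarrow> 'a topology \<Rightarrow> bool" where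
  "virtually_nilpotent c G T \<longleftrightarrow>
     (\<exists>H. open_subgroup G T H \<and> lower_central G T (c + 1) H = {\<one>\<^bsub>G\<^esub>})"

definition quotient_topology ::
  "('a, 'm) monoid_scheme \<Rightarrow> 'a topology \<Rightarrow> 'a set \<Rightarrow> 'a set topology" where
  "quotient_topology G T N =
     topology (\<lambda>U. U \<subseteq> carrier (G Mod N) \<and> openin T {x \<in> topspace T. N #>\<^bsub>G\<^esub> x \<in> U})"

lemma openin_quotient_topology:
  "openin (quotient_topology G T N) U \<longleftrightarrow>
     U \<subseteq> carrier (G Mod N) \<and> openin T {x \<in> topspace T. N #>\<^bsub>G\<^esub> x \<in> U}"
proof -
  let ?P = "\<lambda>U. U \<subseteq> carrier (G Mod N) \<and> openin T {x \<in> topspace T. N #>\<^bsub>G\<^esub> x \<in> U}"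
  have "?P (A \<inter> B)" if "?P A" "?P B" for A B
  proof -
    have "{x \<in> topspace T. N #>\<^bsub>G\<^esub> x \<in> A \<inter> B} =
          {x \<in> topspace T. N #>\<^bsub>G\<^esub> x \<in> A} \<inter> {x \<in> topspace T. N #>\<^bsub>G\<^esub> x \<in> B}" by blast
    with that show ?thesis by auto
  qed
  moreover have "?P (\<Union>\<K>)" if "\<forall>K\<in>\<K>. ?P K" for \<K>
  proof -
    have "{x \<in> topspace T. N #>\<^bsub>G\<^esub> x \<in> \<Union>\<K>} =
          (\<Union>K\<in>\<K>. {x \<in> topspace T. N #>\<^bsub>G\<^esub> x \<in> K})" by blast
    with that show ?thesis by auto
  qed
  ultimately have "istopology ?P"
    unfolding istopology_def by blast
  then show ?thesis
    by (simp add: quotient_topology_def)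
qed

definition JNNF :: "nat \<Rightarrow> ('a, 'm) monoid_scheme \<Rightarrow> 'a topology \<Rightarrow> bool" where
  "JNNF c G T \<longleftrightarrow>
     \<not> virtually_nilpotent c G T \<and>
     (\<forall>N. closed_normal G T N \<and> N \<noteq> {\<one>\<^bsub>G\<^esub>} \<longrightarrow>
          virtually_nilpotent c (G Mod N) (quotient_topology G T N))"

definition hereditarily_JNNF :: "nat \<Rightarrow> ('a, 'm) monoid_scheme \<Rightarrow> 'a topology \<Rightarrow> bool" where
  "hereditarily_JNNF c G T \<longleftrightarrow>
     (\<forall>H. open_subgroup G T H \<longrightarrow> JNNF c (G\<lparr>carrier := H\<rparr>) (subtopology T H))"

definition Fitting_free :: "('a, 'm) monoid_scheme \<Rightarrow> 'a topology \<Rightarrow> bool" where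
  "Fitting_free G T \<longleftrightarrow>
     (\<forall>A. closed_normal G T A \<and> comm_group (G\<lparr>carrier := A\<rparr>) \<longrightarrow> A = {\<one>\<^bsub>G\<^esub>})"

definition proper_open_invariant ::
  "('a, 'm) monoid_scheme \<Rightarrow> 'a topology \<Rightarrow> 'a set \<Rightarrow> 'a set \<Rightarrow> bool" where
  "proper_open_invariant G T A B \<longleftrightarrow> B \<lhd> G \<and> B \<subset> A \<and> openin (subtopology T A) B"

text \<open>\<open>M\<^sub>G(A)\<close>. The intersection is taken inside \<open>A\<close>; this only matters for trivial \<open>A\<close>, where the
  family is empty.\<close>

definition M_sub :: "('a, 'm) monoid_scheme \<Rightarrow> 'a topology \<Rightarrow> 'a set \<Rightarrow> 'a set" where
  "M_sub G T A =
     A \<inter> \<Inter>{B. proper_open_invariant G T A B \<and>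
               (\<forall>C. proper_open_invariant G T A C \<and> B \<subseteq> C \<longrightarrow> C = B)}"

definition conjugates :: "('a, 'm) monoid_scheme \<Rightarrow> 'a set \<Rightarrow> 'a set set" where
  "conjugates G V = {inv\<^bsub>G\<^esub> g <#\<^bsub>G\<^esub> (V #>\<^bsub>G\<^esub> g) | g. g \<in> carrier G}"

definition centralize_each_other :: "('a, 'm) monoid_scheme \<Rightarrow> 'a set \<Rightarrow> 'a set \<Rightarrow> bool" where
  "centralize_each_other G X Y \<longleftrightarrow> (\<forall>x\<in>X. \<forall>y\<in>Y. x \<otimes>\<^bsub>G\<^esub> y = y \<otimes>\<^bsub>G\<^esub> x)"

definition inverse_system ::
  "(nat \<Rightarrow> ('a, 'm) monoid_scheme) \<Rightarrow> (nat \<Rightarrow> 'a topology) \<Rightarrow> (nat \<Rightarrow> 'a \<Rightarrow> 'a) \<Rightarrow> bool" where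
  "inverse_system Gs Ts \<rho> \<longleftrightarrow>
     (\<forall>n. profinite_group (Gs n) (Ts n)) \<and>
     (\<forall>n. \<rho> n \<in> epi (Gs (Suc n)) (Gs n) \<and> continuous_map (Ts (Suc n)) (Ts n) (\<rho> n))"

definition limit_carrier ::
  "(nat \<Rightarrow> ('a, 'm) monoid_scheme) \<Rightarrow> (nat \<Rightarrow> 'a \<Rightarrow> 'a) \<Rightarrow> (nat \<Rightarrow> 'a) set" where
  "limit_carrier Gs \<rho> = {x \<in> carrier (product_group UNIV Gs). \<forall>n. \<rho> n (x (Suc n)) = x n}"

definition limit_group ::
  "(nat \<Rightarrow> ('a, 'm) monoid_scheme) \<Rightarrow> (nat \<Rightarrow> 'a \<Rightarrow> 'a) \<Rightarrow> (nat \<Rightarrow> 'a) monoid" where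
  "limit_group Gs \<rho> = (product_group UNIV Gs)\<lparr>carrier := limit_carrier Gs \<rho>\<rparr>"

definition limit_topology ::
  "(nat \<Rightarrow> ('a, 'm) monoid_scheme) \<Rightarrow> (nat \<Rightarrow> 'a topology) \<Rightarrow> (nat \<Rightarrow> 'a \<Rightarrow> 'a) \<Rightarrow>
     (nat \<Rightarrow> 'a) topology" where
  "limit_topology Gs Ts \<rho> = subtopology (product_topology Ts UNIV) (limit_carrier Gs \<rho>)"

definition is_inverse_limit ::
  "('b, 'k) monoid_scheme \<Rightarrow> 'b topology \<Rightarrow>
     (nat \<Rightarrow> ('a, 'm) monoid_scheme) \<Rightarrow> (nat \<Rightarrow> 'a topology) \<Rightarrow> (nat \<Rightarrow> 'a \<Rightarrow> 'a) \<Rightarrow> bool" where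
  "is_inverse_limit G T Gs Ts \<rho> \<longleftrightarrow>
     (\<exists>\<phi>. \<phi> \<in> iso G (limit_group Gs \<rho>) \<and> homeomorphic_map T (limit_topology Gs Ts \<rho>) \<phi>)"

text \<open>The kernel of \<open>\<rho>\<^sub>n\<^sub>-\<^sub>1 : G\<^sub>n \<rightarrow> G\<^sub>n\<^sub>-\<^sub>1\<close> is undefined for \<open>n = 0\<close>, hence the case distinction.
  Normal closures are taken among closed subgroups, as \<open>\<gamma>\<^sub>i\<close> is only meant for those.\<close>

definition tower_conditions ::
  "nat \<Rightarrow> (nat \<Rightarrow> ('a, 'm) monoid_scheme) \<Rightarrow> (nat \<Rightarrow> 'a topology) \<Rightarrow> (nat \<Rightarrow> 'a \<Rightarrow> 'a) \<Rightarrow>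
     (nat \<Rightarrow> 'a set) \<Rightarrow> bool" where
  "tower_conditions c Gs Ts \<rho> P \<longleftrightarrow>
     (\<forall>n. let G = Gs n; T = Ts n; Q = \<rho> n ` P (Suc n);
              \<gamma> = lower_central G T (c + 1); M = M_sub G T (\<gamma> (P n))
          in virtually_nilpotent c G T \<and>
             Q \<subset> P n \<and>
             (M \<subset> \<gamma> (P n) \<and>
              (case n of
                 0 \<Rightarrow> \<gamma> Q \<subseteq> M
               | Suc m \<Rightarrow> kernel G (Gs m) (\<rho> m) \<subseteq> M \<and> \<gamma> Q \<subseteq> kernel G (Gs m) (\<rho> m)) \<and>
              {\<one>\<^bsub>G\<^esub>} \<subset> \<gamma> Q) \<and>
             (\<forall>N. open_normal G T N \<longrightarrow> \<gamma> N \<subseteq> P n \<or> \<gamma> Q \<subseteq> \<gamma> N) \<and>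
             \<not> (\<exists>V. closed_subgroup G T V \<and> \<not> V \<lhd> G \<and>
                    finite (conjugates G V) \<and> card (conjugates G V) \<le> n \<and>
                    pairwise (centralize_each_other G) (conjugates G V) \<and>
                    \<gamma> (P n) \<subseteq> \<gamma> (\<gamma> (closed_normal_closure G T V))))"

end

theory Submission
  imports Defs "HOL-Algebra.SndIsomorphismGrp"
begin

text \<open>
  Write \<open>\<gamma>(K)\<close> for \<open>\<gamma>\<^sub>c\<^sub>+\<^sub>1(K)\<close>. In a Fitting-free group a non-trivial closed normal subgroup
  \<open>N\<close> has \<open>\<gamma>(N) \<noteq> 1\<close>, and \<open>G\<close> is JNN\<open>\<^sub>c\<close>F iff no open \<open>R\<close> has \<open>\<gamma>(R) = 1\<close> while every
  non-trivial closed normal subgroup contains some \<open>\<gamma>(R)\<close> with \<open>R\<close> open.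

  Given a hereditarily JNN\<open>\<^sub>c\<close>F group, \<open>M(A) \<noteq> 1\<close> for every non-trivial closed normal \<open>A\<close>, because
  otherwise the non-abelian group \<open>A\<close> would contain a non-trivial finite normal subgroup of \<open>G\<close>. One chooses open normal subgroups
  \<open>P\<^sub>0 > P\<^sub>1 > \<dots>\<close>, each sufficiently small in terms of its predecessor, and puts
  \<open>G\<^sub>n = G / \<gamma>(P\<^sub>n\<^sub>+\<^sub>2)\<close>. Smallness means \<open>\<gamma>(P\<^sub>n\<^sub>+\<^sub>1) \<le> M(\<gamma>(P\<^sub>n))\<close>, which gives (iii); generalized obliquity,
  which gives (iv); and generalized obliquity in each of the finitely many subgroups of index at most
  \<open>n\<close>, which makes distinct commuting conjugates share a large non-abelian subgroup and so gives (v).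

  Conversely, the inequalities in (iii) propagate (iv) from \<open>G\<^sub>n\<close> to \<open>G\<close> by a Frattini argument, so that
  every non-trivial closed normal \<open>N\<close> satisfies \<open>\<gamma>(N) \<ge> \<gamma>(P\<^sub>n)\<close> for large \<open>n\<close>. If some open subgroup were
  not JNN\<open>\<^sub>c\<close>F, a minimal non-trivial intersection of conjugates of a witness would be a non-normal subgroup
  with finitely many, commuting conjugates, and its images in \<open>G\<^sub>n\<close> would contradict (v).
\<close>

section \<open>Open and closed subgroups of profinite groups\<close>

text \<open>Two choices are dictated by the kernels. In (v) conjugates commute only in
  \<open>G_n\<close>, that is, modulo a kernel that depends on \<open>P_{n+2}\<close> and is not yet
  known when \<open>P_{n+1}\<close> is chosen. The confinement property
  \<open>commuting_conjugates_within\<close> is therefore uniform in all closed \<open>K\<close>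
  that do not contain a given \<open>Z\<close>, and \<open>\<gamma>(P_{n+1})\<close>, which the
  kernel never contains, takes the role of \<open>Z\<close>. The shift by two in
  \<open>G / \<gamma>(P_{n+2})\<close> comes from (iii): \<open>\<gamma>(P_{n+1})\<close> has to
  survive in \<open>G_n\<close> and to vanish in \<open>G_{n-1}\<close>. Finite generation enters
  through the finiteness of the set of open subgroups of bounded index; it supplies a countable base
  of open normal subgroups and one threshold for all normalizers that (v) can involve. In the
  converse, (iv) compares with open normal subgroups only, and only modulo a kernel; closed
  \<open>N\<close> are reached through the products \<open>N U\<close>, and the kernel is pushed
  down step by step until compactness removes it.\<close>

lemma (in Group.group) inv_mult_cancel [simp]:
  assumes "x \<in> carrier G" "y \<in> carrier G"
  shows "inv x \<otimes> (x \<otimes> y) = y" "x \<otimes> (inv x \<otimes> y) = y"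
  using assms by (simp_all flip: m_assoc)

locale profinite = Group.group G for G (structure) +
  fixes T
  assumes profinite_group: "profinite_group G T"

lemma profinite_iff: "profinite G T \<longleftrightarrow> profinite_group G T"
  unfolding profinite_def profinite_axioms_def
  by (auto simp: profinite_group_def topological_group_def)

context profinite
begin

lemma topspace [simp]: "topspace T = carrier G"
  and compact: "compact_space T"
  and Hausdorff: "Hausdorff_space T"
  and totally_disconnected: "totally_disconnected_space T"
  using profinite_group by (auto simp: profinite_group_def topological_group_def)

lemma continuous_mult [continuous_intros]:
  assumes "continuous_map X T f" "continuous_map X T g"
  shows "continuous_map X T (\<lambda>x. f x \<otimes> g x)"
proof -
  have "continuous_map X T ((\<lambda>(x, y). x \<otimes> y) \<circ> (\<lambda>x. (f x, g x)))"
    using profinite_group assms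
    by (intro continuous_map_compose[where X' = "prod_topology T T"])
      (auto simp: profinite_group_def topological_group_def continuous_map_pairwise o_def)
  then show ?thesis
    by (simp add: o_def)
qed

lemma continuous_inv [continuous_intros]:
  assumes "continuous_map X T f"
  shows "continuous_map X T (\<lambda>x. inv (f x))"
proof -
  have "continuous_map X T ((\<lambda>x. inv x) \<circ> f)"
    using profinite_group assms
    by (intro continuous_map_compose[where X' = T])
      (auto simp: profinite_group_def topological_group_def)
  then show ?thesis
    by (simp add: o_def)
qed

text \<open>Compact Hausdorff. Closedness thereby passes to images under continuous maps, hence to
  products \<open>A <#> B\<close> and to images of subgroups.\<close>

lemma closedin_compactin: "closedin T C \<longleftrightarrow> compactin T C"
  using compact Hausdorff closedin_compact_space compactin_imp_closedin by blast

lemma closedin_one: "closedin T {\<one>}"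
  by (simp add: Hausdorff closedin_Hausdorff_singleton)

lemma openin_preimage_carrier:
  "continuous_map T T f \<Longrightarrow> openin T U \<Longrightarrow> openin T {x \<in> carrier G. f x \<in> U}"
  using openin_continuous_map_preimage[of T T f U] by simp

lemma closedin_preimage_carrier:
  "continuous_map T T f \<Longrightarrow> closedin T U \<Longrightarrow> closedin T {x \<in> carrier G. f x \<in> U}"
  using closedin_continuous_map_preimage[of T T f U] by simp

text \<open>Writing a translate as a preimage under a continuous map gives its openness and
  closedness at once.\<close>

lemma r_coset_eq_preimage:
  assumes "C \<subseteq> carrier G" "a \<in> carrier G"
  shows "C #> a = {x \<in> carrier G. x \<otimes> inv a \<in> C}"
proof -
  have "x \<in> C #> a" if "x \<in> carrier G" "x \<otimes> inv a \<in> C" for x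
    using that assms by (auto simp: r_coset_def intro!: bexI[of _ "x \<otimes> inv a"] simp: m_assoc)
  then show ?thesis
    using assms by (auto simp: r_coset_def m_assoc subset_iff)
qed

lemma openin_r_coset: "openin T U \<Longrightarrow> a \<in> carrier G \<Longrightarrow> openin T (U #> a)"
  using openin_subset[of T U]
  by (auto simp: r_coset_eq_preimage intro!: openin_preimage_carrier continuous_intros)

lemma closedin_r_coset: "closedin T U \<Longrightarrow> a \<in> carrier G \<Longrightarrow> closedin T (U #> a)"
  using closedin_subset[of T U]
  by (auto simp: r_coset_eq_preimage intro!: closedin_preimage_carrier continuous_intros)

lemma closedin_set_mult:
  assumes "closedin T A" "closedin T B"
  shows "closedin T (A <#> B)"
proof -
  have "continuous_map (prod_topology T T) T (\<lambda>p. fst p \<otimes> snd p)"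
    by (intro continuous_intros continuous_map_fst continuous_map_snd)
  moreover have "compactin (prod_topology T T) (A \<times> B)"
    using assms by (simp add: compactin_Times closedin_compactin)
  ultimately have "compactin T ((\<lambda>p. fst p \<otimes> snd p) ` (A \<times> B))"
    by (rule image_compactin[rotated])
  moreover have "(\<lambda>p. fst p \<otimes> snd p) ` (A \<times> B) = A <#> B"
    by (force simp: set_mult_def)
  ultimately show ?thesis
    by (simp add: closedin_compactin)
qed

text \<open>The cosets are pairwise disjoint, non-empty and open, so a finite subcover has to
  contain all of them.\<close>

lemma finite_rcosets:
  assumes "open_subgroup G T H"
  shows "finite (rcosets H)"
proof -
  have H: "subgroup H G" "openin T H"
    using assms by (auto simp: open_subgroup_def)
  have "\<forall>C\<in>rcosets H. openin T C"
    using H by (auto simp: RCOSETS_def openin_r_coset)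
  moreover have "carrier G \<subseteq> \<Union>(rcosets H)"
    using rcosets_part_G[OF H(1)] by simp
  ultimately obtain \<F> where \<F>: "finite \<F>" "\<F> \<subseteq> rcosets H" "carrier G \<subseteq> \<Union>\<F>"
    using compact[unfolded compact_space_alt, rule_format, of "rcosets H"] by auto
  have "rcosets H \<subseteq> \<F>"
  proof
    fix C assume "C \<in> rcosets H"
    obtain x where "x \<in> carrier G" "C = H #> x"
      using \<open>C \<in> rcosets H\<close> by (auto simp: RCOSETS_def)
    then have "x \<in> C"
      using rcos_self H(1) by simp
    then obtain D where D: "D \<in> \<F>" "x \<in> C \<inter> D"
      using \<F>(3) \<open>x \<in> carrier G\<close> by blast
    then have "C = D"
      using rcos_disjoint[OF H(1)] \<open>C \<in> rcosets H\<close> \<F>(2) unfolding pairwise_def disjnt_def by blast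
    with D show "C \<in> \<F>" by simp
  qed
  then show ?thesis
    using \<F>(1) finite_subset by blast
qed

text \<open>The complement of \<open>H\<close> is the union of the other cosets, which is closed
  because there are finitely many of them.\<close>

lemma open_subgroup_if_finite_rcosets:
  assumes "closed_subgroup G T H" "finite (rcosets H)"
  shows "open_subgroup G T H"
proof -
  have H: "subgroup H G" "closedin T H"
    using assms by (auto simp: closed_subgroup_def)
  have "H \<in> rcosets H"
    using subgroup.subgroup_in_rcosets[OF H(1)] is_group by blast
  moreover have "\<Union>(rcosets H) = carrier G"
    using rcosets_part_G[OF H(1)] .
  ultimately have "carrier G - \<Union>(rcosets H - {H}) = H"
    using rcos_disjoint[OF H(1)] by (fastforce simp: pairwise_def disjnt_def)
  moreover have "closedin T (\<Union>(rcosets H - {H}))"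
    using assms H by (intro closedin_Union) (auto simp: RCOSETS_def closedin_r_coset)
  ultimately show ?thesis
    using H(1) openin_diff[of T "carrier G" "\<Union>(rcosets H - {H})"]
    by (metis open_subgroup_def openin_topspace topspace)
qed

lemma open_imp_closed_subgroup:
  assumes "open_subgroup G T H"
  shows "closed_subgroup G T H"
proof -
  have H: "subgroup H G" "openin T H"
    using assms by (auto simp: open_subgroup_def)
  have "H \<in> rcosets H"
    using subgroup.subgroup_in_rcosets[OF H(1)] is_group by blast
  moreover have "\<Union>(rcosets H) = carrier G"
    using rcosets_part_G[OF H(1)] .
  ultimately have "carrier G - \<Union>(rcosets H - {H}) = H"
    using rcos_disjoint[OF H(1)] by (fastforce simp: pairwise_def disjnt_def)
  moreover have "openin T (\<Union>(rcosets H - {H}))"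
    using H by (intro openin_Union) (auto simp: RCOSETS_def openin_r_coset)
  ultimately show ?thesis
    using H(1) closedin_diff[of T "carrier G" "\<Union>(rcosets H - {H})"]
    by (metis closed_subgroup_def closedin_topspace topspace)
qed

lemma open_subgroup_mono:
  assumes "open_subgroup G T H" "subgroup K G" "H \<subseteq> K"
  shows "open_subgroup G T K"
proof -
  have H: "subgroup H G" "openin T H"
    using assms by (auto simp: open_subgroup_def)
  have sub: "K \<subseteq> carrier G"
    using assms(2) subgroup.subset by blast
  have "K = (\<Union>k\<in>K. H #> k)"
  proof (intro equalityI subsetI)
    fix k assume k: "k \<in> K"
    then have "k \<in> H #> k"
      using sub H(1) by (auto simp: rcos_self)
    with k show "k \<in> (\<Union>k\<in>K. H #> k)" by blast
  next
    fix x assume "x \<in> (\<Union>k\<in>K. H #> k)"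
    then show "x \<in> K"
      using assms(2,3) by (auto simp: r_coset_def intro: subgroup.m_closed)
  qed
  moreover have "openin T (\<Union>k\<in>K. H #> k)"
    using H sub by (intro openin_Union) (auto simp: openin_r_coset)
  ultimately show ?thesis
    using assms(2) by (simp add: open_subgroup_def)
qed

text \<open>In a compact Hausdorff space quasi-components and connected components agree, so total
  disconnectedness makes the clopen sets around \<open>x\<close> intersect in \<open>{x}\<close>.
  Together with the complement of \<open>U\<close> they have empty intersection, and compactness
  leaves finitely many.\<close>

lemma clopen_base:
  assumes "openin T U" "x \<in> U"
  obtains C where "openin T C" "closedin T C" "x \<in> C" "C \<subseteq> U"
proof -
  have xG: "x \<in> carrier G"
    using assms openin_subset by fastforce
  have "\<exists>z. connected_component_of_set T x \<subseteq> {z}"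
    using totally_disconnected connectedin_connected_component_of[of T x]
    unfolding totally_disconnected_space_def by blast
  moreover have "x \<in> connected_component_of_set T x"
    using xG by (simp add: connected_component_of_refl)
  ultimately have "connected_component_of_set T x \<subseteq> {x}"
    by auto
  then have qc: "quasi_component_of T x y \<Longrightarrow> y = x" for y
    using quasi_eq_connected_component_of[of T x] compact Hausdorff by auto
  let ?\<C> = "{C. openin T C \<and> closedin T C \<and> x \<in> C}"
  have "\<exists>\<F>. finite \<F> \<and> \<F> \<subseteq> insert (carrier G - U) ?\<C> \<and> \<Inter>\<F> = {}"
  proof (rule ccontr)
    assume "\<not> ?thesis"
    then have "\<forall>\<F>. finite \<F> \<and> \<F> \<subseteq> insert (carrier G - U) ?\<C> \<longrightarrow> \<Inter>\<F> \<noteq> {}"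
      by simp
    moreover have "\<forall>C\<in>insert (carrier G - U) ?\<C>. closedin T C"
      using closedin_diff[OF closedin_topspace assms(1)] by simp
    ultimately have "\<Inter>(insert (carrier G - U) ?\<C>) \<noteq> {}"
      using compact[unfolded compact_space_fip, THEN spec, of "insert (carrier G - U) ?\<C>"]
      by (meson conjI)
    then obtain y where y: "y \<in> carrier G" "y \<notin> U" "\<And>C. C \<in> ?\<C> \<Longrightarrow> y \<in> C"
      by auto
    have "quasi_component_of T x y"
      unfolding quasi_component_of_def
    proof (intro conjI allI impI)
      fix C assume C: "closedin T C \<and> openin T C"
      show "(x \<in> C) = (y \<in> C)"
      proof (cases "x \<in> C")
        case False
        have "carrier G - C \<in> ?\<C>"
          using C xG False openin_diff[OF openin_topspace, of T C] closedin_diff[OF closedin_topspace, of T C]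
          by simp
        then show ?thesis using y(3) False by blast
      qed (use C y(3) in auto)
    qed (use xG y in auto)
    then show False
      using qc y assms by blast
  qed
  then obtain \<F> where \<F>: "finite \<F>" "\<F> \<subseteq> insert (carrier G - U) ?\<C>" "\<Inter>\<F> = {}"
    by blast
  \<comment> \<open>The factor \<open>carrier G\<close> keeps the set meaningful when no clopen set
    remains in the finite family.\<close>
  let ?C = "carrier G \<inter> \<Inter>(\<F> - {carrier G - U})"
  have "\<F> - {carrier G - U} \<subseteq> ?\<C>" "finite (\<F> - {carrier G - U})"
    using \<F> by auto
  then have "openin T ?C \<and> closedin T ?C \<and> x \<in> ?C"
  proof (induction "\<F> - {carrier G - U}" arbitrary: \<F> rule: infinite_finite_induct)
    case infinite then show ?case by simp
  next
    case empty then show ?case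
      using xG openin_topspace[of T] closedin_topspace[of T] unfolding empty(1)[symmetric] by simp
  next
    case (insert A \<G>)
    have "A \<noteq> carrier G - U" "carrier G - U \<notin> \<G>"
      using insert(4) by auto
    then have *: "\<G> = \<G> - {carrier G - U}" by blast
    have "\<G> \<subseteq> ?\<C>" "finite \<G>"
      using insert(1,5) unfolding insert(4)[symmetric] by auto
    then have "openin T (carrier G \<inter> \<Inter>\<G>) \<and> closedin T (carrier G \<inter> \<Inter>\<G>) \<and> x \<in> carrier G \<inter> \<Inter>\<G>"
      using insert(3)[OF *] * by simp
    moreover have "carrier G \<inter> \<Inter>(insert A \<G>) = A \<inter> (carrier G \<inter> \<Inter>\<G>)"
      by auto
    moreover have "openin T A \<and> closedin T A \<and> x \<in> A"
      using insert(5) unfolding insert(4)[symmetric] by auto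
    ultimately show ?case
      unfolding insert(4)[symmetric] by (metis IntI closedin_Int openin_Int)
  qed
  moreover have "?C \<subseteq> U"
    using \<F>(3) by auto
  ultimately show ?thesis
    using that by blast
qed

text \<open>For a clopen neighbourhood \<open>C\<close> of \<open>\<one>\<close>, the set of all \<open>x\<close> all of whose conjugates (and inverses
  of conjugates) map \<open>C\<close> into itself by right multiplication is a normal subgroup inside \<open>C\<close>. It is
  open because projections along compact spaces are closed maps.\<close>

lemma open_normal_base:
  assumes "openin T U" "\<one> \<in> U"
  obtains N where "open_normal G T N" "N \<subseteq> U"
proof -
  obtain C where C: "openin T C" "closedin T C" "\<one> \<in> C" "C \<subseteq> U"
    using assms clopen_base by blast
  have CG: "C \<subseteq> carrier G"
    using C(1) openin_subset by fastforce
  define N where "N = {x \<in> carrier G. \<forall>g\<in>carrier G. \<forall>c\<in>C.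
      c \<otimes> (g \<otimes> x \<otimes> inv g) \<in> C \<and> c \<otimes> (g \<otimes> inv x \<otimes> inv g) \<in> C}"
  let ?Y = "prod_topology T (subtopology T C)"
  have cpt: "compact_space ?Y"
    using compact C(2) by (simp add: compact_space_prod_topology closedin_compact_space compact_space_subtopology)
  have op: "openin T {x \<in> carrier G. \<forall>g\<in>carrier G. \<forall>c\<in>C. f x g c \<in> C}"
    if "continuous_map (prod_topology T ?Y) T (\<lambda>p. f (fst p) (fst (snd p)) (snd (snd p)))" for f
  proof -
    let ?F = "\<lambda>p. f (fst p) (fst (snd p)) (snd (snd p))"
    have "closedin (prod_topology T ?Y) {p \<in> topspace (prod_topology T ?Y). ?F p \<in> topspace T - C}"
      using that C(1) closedin_diff[OF closedin_topspace C(1)]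
      by (intro closedin_continuous_map_preimage)
    then have "closedin T (fst ` {p \<in> topspace (prod_topology T ?Y). ?F p \<in> topspace T - C})"
      using closed_map_fst[OF cpt, of T] unfolding closed_map_def by blast
    moreover have "fst ` {p \<in> topspace (prod_topology T ?Y). ?F p \<in> topspace T - C} =
      {x \<in> carrier G. \<exists>g\<in>carrier G. \<exists>c\<in>C. f x g c \<notin> C}"
    proof -
      have "f x g c \<in> carrier G" if "x \<in> carrier G" "g \<in> carrier G" "c \<in> C" for x g c
        using continuous_map_image_subset_topspace[OF \<open>continuous_map _ _ ?F\<close>] that CG
        by (auto simp: image_subset_iff)
      then have "x \<in> fst ` {p \<in> topspace (prod_topology T ?Y). ?F p \<in> topspace T - C}"
        if "x \<in> carrier G" "g \<in> carrier G" "c \<in> C" "f x g c \<notin> C" for x g c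
        using that CG by (intro image_eqI[of _ _ "(x, g, c)"]) auto
      moreover have "\<exists>g\<in>carrier G. \<exists>c\<in>C. f x g c \<notin> C"
        if "x \<in> fst ` {p \<in> topspace (prod_topology T ?Y). ?F p \<in> topspace T - C}" for x
        using that by (elim imageE) (clarsimp, blast)
      moreover have "x \<in> carrier G"
        if "x \<in> fst ` {p \<in> topspace (prod_topology T ?Y). ?F p \<in> topspace T - C}" for x
        using that by (elim imageE) clarsimp
      ultimately show ?thesis
        by (intro equalityI subsetI CollectI conjI) blast+
    qed
    ultimately have "closedin T {x \<in> carrier G. \<exists>g\<in>carrier G. \<exists>c\<in>C. f x g c \<notin> C}"
      by (rule back_subst)
    then have "openin T (topspace T - {x \<in> carrier G. \<exists>g\<in>carrier G. \<exists>c\<in>C. f x g c \<notin> C})"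
      by (intro openin_diff openin_topspace)
    moreover have "topspace T - {x \<in> carrier G. \<exists>g\<in>carrier G. \<exists>c\<in>C. f x g c \<notin> C} =
        {x \<in> carrier G. \<forall>g\<in>carrier G. \<forall>c\<in>C. f x g c \<in> C}"
      by auto
    ultimately show ?thesis by simp
  qed
  have cs: "continuous_map (prod_topology T ?Y) T (\<lambda>p. snd (snd p))"
  proof -
    have "continuous_map (prod_topology T ?Y) (subtopology T C) (snd \<circ> snd)"
      by (intro continuous_map_compose[OF continuous_map_snd continuous_map_snd])
    then show ?thesis
      by (simp add: continuous_map_in_subtopology o_def)
  qed
  have cf: "continuous_map (prod_topology T ?Y) T (\<lambda>p. fst (snd p))"
    using continuous_map_compose[OF continuous_map_snd continuous_map_fst] by (simp add: o_def)
  have N_eq: "N = {x \<in> carrier G. \<forall>g\<in>carrier G. \<forall>c\<in>C. c \<otimes> (g \<otimes> x \<otimes> inv g) \<in> C} \<inter>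
      {x \<in> carrier G. \<forall>g\<in>carrier G. \<forall>c\<in>C. c \<otimes> (g \<otimes> inv x \<otimes> inv g) \<in> C}"
    unfolding N_def by auto
  have "openin T N"
    unfolding N_eq by (intro openin_Int op continuous_intros continuous_map_fst cs cf)
  moreover have "N \<lhd> G"
  proof (rule normal_invI)
    show "subgroup N G"
    proof (rule subgroupI)
      have "\<one> \<in> N" using CG by (auto simp: N_def subset_iff)
      then show "N \<noteq> {}" by blast
      show "inv a \<in> N" if "a \<in> N" for a using that by (auto simp: N_def)
      show "a \<otimes> b \<in> N" if "a \<in> N" "b \<in> N" for a b
      proof -
        have ab: "a \<in> carrier G" "b \<in> carrier G" using that by (auto simp: N_def)
        have "c \<otimes> (g \<otimes> (a \<otimes> b) \<otimes> inv g) \<in> C" "c \<otimes> (g \<otimes> inv (a \<otimes> b) \<otimes> inv g) \<in> C"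
          if "g \<in> carrier G" "c \<in> C" for g c
        proof -
          have c: "c \<in> carrier G" using that CG by auto
          have "c \<otimes> (g \<otimes> (a \<otimes> b) \<otimes> inv g) = (c \<otimes> (g \<otimes> a \<otimes> inv g)) \<otimes> (g \<otimes> b \<otimes> inv g)"
            using ab that c by (simp add: m_assoc)
          also have "\<dots> \<in> C" using that \<open>a \<in> N\<close> \<open>b \<in> N\<close> by (auto simp: N_def)
          finally show "c \<otimes> (g \<otimes> (a \<otimes> b) \<otimes> inv g) \<in> C" .
          have "c \<otimes> (g \<otimes> inv (a \<otimes> b) \<otimes> inv g) = (c \<otimes> (g \<otimes> inv b \<otimes> inv g)) \<otimes> (g \<otimes> inv a \<otimes> inv g)"
            using ab that c by (simp add: m_assoc inv_mult_group)
          also have "\<dots> \<in> C" using that \<open>a \<in> N\<close> \<open>b \<in> N\<close> by (auto simp: N_def)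
          finally show "c \<otimes> (g \<otimes> inv (a \<otimes> b) \<otimes> inv g) \<in> C" .
        qed
        then show ?thesis using ab by (auto simp: N_def)
      qed
    qed (auto simp: N_def)
    show "x \<otimes> h \<otimes> inv x \<in> N" if x: "x \<in> carrier G" and h: "h \<in> N" for x h
    proof -
      have hG: "h \<in> carrier G" using h by (auto simp: N_def)
      have "g \<otimes> (x \<otimes> h \<otimes> inv x) \<otimes> inv g = (g \<otimes> x) \<otimes> h \<otimes> inv (g \<otimes> x)"
        "g \<otimes> inv (x \<otimes> h \<otimes> inv x) \<otimes> inv g = (g \<otimes> x) \<otimes> inv h \<otimes> inv (g \<otimes> x)"
        if "g \<in> carrier G" for g
        using that x hG by (simp_all add: m_assoc inv_mult_group)
      then show ?thesis using x hG h by (auto simp: N_def)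
    qed
  qed
  moreover have "N \<subseteq> C"
  proof
    fix x assume "x \<in> N"
    then have "x \<in> carrier G" "\<one> \<otimes> (\<one> \<otimes> x \<otimes> inv \<one>) \<in> C"
      using C(3) by (auto simp only: N_def)
    then show "x \<in> C" by simp
  qed
  ultimately show ?thesis
    using that C(4) by (auto simp: open_normal_def)
qed

end

section \<open>Commutator subgroups and continuous homomorphisms\<close>

context profinite
begin

lemma closed_subgroup_carrier: "closed_subgroup G T (carrier G)"
  using subgroup_self closedin_topspace[of T] by (simp add: closed_subgroup_def)

lemma closed_subgroup_Inter:
  assumes "\<A> \<noteq> {}" "\<And>H. H \<in> \<A> \<Longrightarrow> closed_subgroup G T H"
  shows "closed_subgroup G T (\<Inter>\<A>)"
  using assms subgroups_Inter[of \<A>] closedin_Inter[of \<A> T] by (auto simp: closed_subgroup_def)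

lemma closed_normal_imp_subgroup: "closed_normal G T N \<Longrightarrow> closed_subgroup G T N"
  by (simp add: closed_normal_def closed_subgroup_def normal_imp_subgroup)

lemma open_normal_imp_open_subgroup: "open_normal G T N \<Longrightarrow> open_subgroup G T N"
  by (simp add: open_normal_def open_subgroup_def normal_imp_subgroup)

lemma open_normal_imp_closed_normal: "open_normal G T N \<Longrightarrow> closed_normal G T N"
  using open_imp_closed_subgroup[of N] open_normal_imp_open_subgroup[of N]
  by (simp add: closed_normal_def closed_subgroup_def open_normal_def)

lemma closed_subgroup_subset: "closed_subgroup G T H \<Longrightarrow> H \<subseteq> carrier G"
  by (simp add: closed_subgroup_def subgroup.subset)

lemma closed_subgroup_closed_generate:
  assumes "A \<subseteq> carrier G"
  shows "closed_subgroup G T (closed_generate G T A)"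
  unfolding closed_generate_def hull_def
  using closed_subgroup_carrier assms by (intro closed_subgroup_Inter) auto

lemma closed_generate_minimal:
  "A \<subseteq> H \<Longrightarrow> closed_subgroup G T H \<Longrightarrow> closed_generate G T A \<subseteq> H"
  unfolding closed_generate_def by (rule hull_minimal)

lemma closed_generate_incl: "A \<subseteq> closed_generate G T A"
  unfolding closed_generate_def by (rule hull_subset)

lemma closed_generate_mono: "A \<subseteq> B \<Longrightarrow> closed_generate G T A \<subseteq> closed_generate G T B"
  unfolding closed_generate_def by (rule hull_mono)

lemma commutator_closed [simp]:
  "x \<in> carrier G \<Longrightarrow> y \<in> carrier G \<Longrightarrow> commutator G x y \<in> carrier G"
  by (simp add: commutator_def)

lemma commutator_eq_one_iff:
  assumes "x \<in> carrier G" "y \<in> carrier G"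
  shows "commutator G x y = \<one> \<longleftrightarrow> x \<otimes> y = y \<otimes> x"
proof -
  have "commutator G x y = inv (y \<otimes> x) \<otimes> (x \<otimes> y)"
    using assms by (simp add: commutator_def inv_mult_group m_assoc)
  then show ?thesis
    using assms by (metis inv_closed inv_equality inv_inv l_inv m_closed)
qed

lemma closed_subgroup_commutator_subgroup:
  assumes "K \<subseteq> carrier G" "L \<subseteq> carrier G"
  shows "closed_subgroup G T (commutator_subgroup G T K L)"
  unfolding commutator_subgroup_def
  using assms by (intro closed_subgroup_closed_generate) (auto intro!: commutator_closed)

lemma commutator_in_commutator_subgroup:
  "x \<in> K \<Longrightarrow> y \<in> L \<Longrightarrow> commutator G x y \<in> commutator_subgroup G T K L"
  unfolding commutator_subgroup_def
  by (rule subsetD[OF closed_generate_incl]) auto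

lemma commutator_subgroup_minimal:
  assumes "closed_subgroup G T H" "\<And>x y. x \<in> K \<Longrightarrow> y \<in> L \<Longrightarrow> commutator G x y \<in> H"
  shows "commutator_subgroup G T K L \<subseteq> H"
  unfolding commutator_subgroup_def
  using assms by (intro closed_generate_minimal) auto

lemma commutator_subgroup_mono:
  "K \<subseteq> K' \<Longrightarrow> L \<subseteq> L' \<Longrightarrow> commutator_subgroup G T K L \<subseteq> commutator_subgroup G T K' L'"
  unfolding commutator_subgroup_def by (intro closed_generate_mono) blast

lemma closed_subgroup_lower_central:
  assumes "closed_subgroup G T K"
  shows "closed_subgroup G T (lower_central G T i K)"
proof (induction i)
  case (Suc i)
  then show ?case
    using assms by (auto intro!: closed_subgroup_commutator_subgroup dest: closed_subgroup_subset)
qed (use assms in simp)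

lemma lower_central_carrier:
  assumes "K \<subseteq> carrier G"
  shows "lower_central G T i K \<subseteq> carrier G"
proof (induction i)
  case (Suc i)
  then show ?case
    using assms closed_subgroup_subset[OF closed_subgroup_commutator_subgroup] by auto
qed (use assms in simp)

lemma lower_central_mono:
  "K \<subseteq> L \<Longrightarrow> lower_central G T i K \<subseteq> lower_central G T i L"
proof (induction i)
  case (Suc i)
  then show ?case
    using commutator_subgroup_mono by (cases "i = 0") simp_all
qed simp

lemma commutator_in_subgroup:
  "subgroup K G \<Longrightarrow> x \<in> K \<Longrightarrow> y \<in> K \<Longrightarrow> commutator G x y \<in> K"
  by (simp add: commutator_def subgroup.m_closed subgroup.m_inv_closed)

lemma lower_central_subset:
  assumes "closed_subgroup G T K"
  shows "lower_central G T i K \<subseteq> K"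
proof (induction i)
  case (Suc i)
  have "commutator_subgroup G T (lower_central G T i K) K \<subseteq> K"
    using assms Suc
    by (intro commutator_subgroup_minimal commutator_in_subgroup) (auto simp: closed_subgroup_def)
  then show ?case
    by simp
qed simp

end

section \<open>Continuous homomorphisms of profinite groups\<close>

locale profinite_hom = G: profinite G T + H: profinite H S
  for G :: "('a, 'k) monoid_scheme" and T and H :: "('b, 'l) monoid_scheme" and S +
  fixes \<pi> :: "'a \<Rightarrow> 'b"
  assumes hom: "\<pi> \<in> hom G H" and cont: "continuous_map T S \<pi>"
begin

sublocale group_hom G H \<pi>
  by unfold_locales (rule hom)

lemma closedin_image: "closedin T C \<Longrightarrow> closedin S (\<pi> ` C)"
  using image_compactin[OF _ cont] by (simp add: G.closedin_compactin H.closedin_compactin)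

lemma openin_preimage: "openin S U \<Longrightarrow> openin T {x \<in> carrier G. \<pi> x \<in> U}"
  using openin_continuous_map_preimage[OF cont] by simp

lemma closedin_preimage: "closedin S U \<Longrightarrow> closedin T {x \<in> carrier G. \<pi> x \<in> U}"
  using closedin_continuous_map_preimage[OF cont] by simp

lemma closed_subgroup_image:
  "closed_subgroup G T K \<Longrightarrow> closed_subgroup H S (\<pi> ` K)"
  by (simp add: closed_subgroup_def closedin_image subgroup_img_is_subgroup)

lemma subgroup_preimage: "subgroup L H \<Longrightarrow> subgroup {x \<in> carrier G. \<pi> x \<in> L} G"
  by (rule G.subgroupI)
    (auto simp: subgroup.m_closed subgroup.m_inv_closed subgroup.one_closed intro: exI[of _ "\<one>\<^bsub>G\<^esub>"])

lemma closed_subgroup_preimage: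
  "closed_subgroup H S L \<Longrightarrow> closed_subgroup G T {x \<in> carrier G. \<pi> x \<in> L}"
  by (simp add: closed_subgroup_def closedin_preimage subgroup_preimage)

lemma open_subgroup_preimage:
  "open_subgroup H S L \<Longrightarrow> open_subgroup G T {x \<in> carrier G. \<pi> x \<in> L}"
  by (simp add: open_subgroup_def openin_preimage subgroup_preimage)

lemma normal_preimage: "L \<lhd> H \<Longrightarrow> {x \<in> carrier G. \<pi> x \<in> L} \<lhd> G"
  unfolding G.normal_inv_iff H.normal_inv_iff
  using subgroup_preimage by auto

lemma closed_normal_preimage:
  "closed_normal H S L \<Longrightarrow> closed_normal G T {x \<in> carrier G. \<pi> x \<in> L}"
  by (simp add: closed_normal_def closedin_preimage normal_preimage)

lemma open_normal_preimage:
  "open_normal H S L \<Longrightarrow> open_normal G T {x \<in> carrier G. \<pi> x \<in> L}"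
  by (simp add: open_normal_def openin_preimage normal_preimage)

lemma closed_normal_kernel: "closed_normal G T (kernel G H \<pi>)"
  using normal_kernel closedin_preimage[OF H.closedin_one]
  by (simp add: closed_normal_def kernel_def)

text \<open>One inclusion uses the preimage of the closed hull of the image; the other uses that the
  image of a closed subgroup is closed, by compactness.\<close>

lemma image_closed_generate:
  assumes "A \<subseteq> carrier G"
  shows "\<pi> ` closed_generate G T A = closed_generate H S (\<pi> ` A)"
proof
  have "\<pi> ` A \<subseteq> carrier H" using assms by auto
  then have "closed_subgroup G T {x \<in> carrier G. \<pi> x \<in> closed_generate H S (\<pi> ` A)}"
    by (intro closed_subgroup_preimage H.closed_subgroup_closed_generate)
  moreover have "A \<subseteq> {x \<in> carrier G. \<pi> x \<in> closed_generate H S (\<pi> ` A)}"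
    using assms H.closed_generate_incl[of "\<pi> ` A"] by auto
  ultimately show "\<pi> ` closed_generate G T A \<subseteq> closed_generate H S (\<pi> ` A)"
    using G.closed_generate_minimal by blast
  show "closed_generate H S (\<pi> ` A) \<subseteq> \<pi> ` closed_generate G T A"
    using assms G.closed_generate_incl[of A]
    by (intro H.closed_generate_minimal closed_subgroup_image G.closed_subgroup_closed_generate image_mono)
qed

lemma image_commutator:
  "x \<in> carrier G \<Longrightarrow> y \<in> carrier G \<Longrightarrow> \<pi> (commutator G x y) = commutator H (\<pi> x) (\<pi> y)"
  by (simp add: commutator_def)

lemma image_commutator_subgroup:
  assumes "K \<subseteq> carrier G" "L \<subseteq> carrier G"
  shows "\<pi> ` commutator_subgroup G T K L = commutator_subgroup H S (\<pi> ` K) (\<pi> ` L)"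
proof -
  have sub: "{commutator G x y |x y. x \<in> K \<and> y \<in> L} \<subseteq> carrier G"
    using assms by (auto intro!: G.commutator_closed)
  have "\<pi> ` {commutator G x y |x y. x \<in> K \<and> y \<in> L} =
        {commutator H x y |x y. x \<in> \<pi> ` K \<and> y \<in> \<pi> ` L}"
  proof (intro equalityI subsetI)
    fix z assume "z \<in> \<pi> ` {commutator G x y |x y. x \<in> K \<and> y \<in> L}"
    then obtain x y where "x \<in> K" "y \<in> L" "z = \<pi> (commutator G x y)"
      by blast
    with assms image_commutator[of x y] show "z \<in> {commutator H x y |x y. x \<in> \<pi> ` K \<and> y \<in> \<pi> ` L}"
      by blast
  next
    fix z assume "z \<in> {commutator H x y |x y. x \<in> \<pi> ` K \<and> y \<in> \<pi> ` L}"
    then obtain x y where xy: "x \<in> K" "y \<in> L" "z = commutator H (\<pi> x) (\<pi> y)"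
      by blast
    then have "z = \<pi> (commutator G x y)"
      using assms image_commutator[of x y] by (simp add: subset_iff)
    with xy show "z \<in> \<pi> ` {commutator G x y |x y. x \<in> K \<and> y \<in> L}"
      by blast
  qed
  with image_closed_generate[OF sub] show ?thesis
    by (simp add: commutator_subgroup_def)
qed

text \<open>Stated for every continuous homomorphism, so that it serves quotient maps and also the
  inclusion of a closed subgroup, where it says that \<open>\<gamma>\<close> does not depend on the
  ambient group.\<close>

lemma image_lower_central:
  assumes "K \<subseteq> carrier G"
  shows "\<pi> ` lower_central G T i K = lower_central H S i (\<pi> ` K)"
  by (induction i)
    (auto simp: image_commutator_subgroup G.lower_central_carrier assms)

end

section \<open>Conjugation, products and intersections of normal subgroups\<close>

context profinite
begin

text \<open>Conjugation becomes an instance of \<open>profinite_hom\<close>, so that normality of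
  commutator subgroups follows from their behaviour under images.\<close>

lemma conj_hom:
  assumes "g \<in> carrier G"
  shows "profinite_hom G T G T (\<lambda>x. g \<otimes> x \<otimes> inv g)"
proof
  show "(\<lambda>x. g \<otimes> x \<otimes> inv g) \<in> hom G G"
    using assms by (auto simp: hom_def m_assoc)
  show "continuous_map T T (\<lambda>x. g \<otimes> x \<otimes> inv g)"
    using assms by (intro continuous_intros) auto
qed

lemma normal_iff_conj_image:
  "N \<lhd> G \<longleftrightarrow> subgroup N G \<and> (\<forall>g\<in>carrier G. (\<lambda>x. g \<otimes> x \<otimes> inv g) ` N \<subseteq> N)"
  unfolding normal_inv_iff by auto

lemma conj_image_normal:
  assumes "N \<lhd> G" "g \<in> carrier G"
  shows "(\<lambda>x. g \<otimes> x \<otimes> inv g) ` N = N"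
proof
  show "(\<lambda>x. g \<otimes> x \<otimes> inv g) ` N \<subseteq> N"
    using assms normal_iff_conj_image by blast
  show "N \<subseteq> (\<lambda>x. g \<otimes> x \<otimes> inv g) ` N"
  proof
    fix x assume x: "x \<in> N"
    then have "x \<in> carrier G" using assms(1) normal_imp_subgroup subgroup.subset by blast
    moreover have "inv g \<otimes> x \<otimes> g \<in> N"
      using normal.inv_op_closed1[OF assms x] .
    ultimately show "x \<in> (\<lambda>x. g \<otimes> x \<otimes> inv g) ` N"
      using assms(2) by (intro image_eqI[of _ _ "inv g \<otimes> x \<otimes> g"]) (auto simp: m_assoc)
  qed
qed

lemma closed_normal_commutator_subgroup:
  assumes "closed_normal G T K" "closed_normal G T L"
  shows "closed_normal G T (commutator_subgroup G T K L)"
proof -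
  have sub: "K \<subseteq> carrier G" "L \<subseteq> carrier G"
    using assms closed_subgroup_subset closed_normal_imp_subgroup by auto
  have "(\<lambda>x. g \<otimes> x \<otimes> inv g) ` commutator_subgroup G T K L = commutator_subgroup G T K L"
    if "g \<in> carrier G" for g
    using profinite_hom.image_commutator_subgroup[OF conj_hom[OF that] sub]
      conj_image_normal[OF _ that] assms by (simp add: closed_normal_def)
  then show ?thesis
    using closed_subgroup_commutator_subgroup[OF sub]
    by (simp add: closed_normal_def closed_subgroup_def normal_iff_conj_image)
qed

lemma closed_normal_lower_central:
  assumes "closed_normal G T K"
  shows "closed_normal G T (lower_central G T i K)"
  by (induction i) (auto intro: closed_normal_commutator_subgroup assms)

lemma set_mult_incl1: "subgroup K G \<Longrightarrow> H \<subseteq> carrier G \<Longrightarrow> H \<subseteq> H <#> K"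
  unfolding set_mult_def using subgroup.one_closed[of K G] r_one by force

lemma set_mult_incl2: "subgroup H G \<Longrightarrow> K \<subseteq> carrier G \<Longrightarrow> K \<subseteq> H <#> K"
  unfolding set_mult_def using subgroup.one_closed[of H G] l_one by force

lemma set_mult_minimal: "subgroup L G \<Longrightarrow> H \<subseteq> L \<Longrightarrow> K \<subseteq> L \<Longrightarrow> H <#> K \<subseteq> L"
  unfolding set_mult_def by (auto intro: subgroup.m_closed)

lemma closed_normal_set_mult:
  "closed_normal G T H \<Longrightarrow> closed_normal G T N \<Longrightarrow> closed_normal G T (H <#> N)"
  by (simp add: closed_normal_def normal_subgroup_set_mult_closed closedin_set_mult)

lemma open_normal_set_mult:
  assumes "closed_normal G T H" "open_normal G T N"
  shows "open_normal G T (H <#> N)"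
proof -
  have N: "N \<lhd> G" "H \<lhd> G" using assms by (auto simp: closed_normal_def open_normal_def)
  then have "open_subgroup G T (H <#> N)"
    using assms(2) subgroup.subset[OF normal_imp_subgroup[OF N(1)]]
    by (intro open_subgroup_mono[OF open_normal_imp_open_subgroup])
      (auto simp: normal_subgroup_set_mult_closed normal_imp_subgroup intro: subsetD[OF set_mult_incl2])
  then show ?thesis
    using N by (simp add: open_normal_def open_subgroup_def normal_subgroup_set_mult_closed)
qed

lemma closed_normal_Int:
  "closed_normal G T H \<Longrightarrow> closed_normal G T N \<Longrightarrow> closed_normal G T (H \<inter> N)"
  by (simp add: closed_normal_def normal_subgroup_intersect closedin_Int)

lemma open_normal_Int:
  "open_normal G T H \<Longrightarrow> open_normal G T N \<Longrightarrow> open_normal G T (H \<inter> N)"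
  by (simp add: open_normal_def normal_subgroup_intersect openin_Int)

lemma normal_Inter:
  assumes "\<A> \<noteq> {}" "\<And>N. N \<in> \<A> \<Longrightarrow> N \<lhd> G"
  shows "\<Inter>\<A> \<lhd> G"
  using assms subgroups_Inter[of \<A>] unfolding normal_inv_iff by auto

lemma closed_normal_Inter:
  assumes "\<A> \<noteq> {}" "\<And>N. N \<in> \<A> \<Longrightarrow> closed_normal G T N"
  shows "closed_normal G T (\<Inter>\<A>)"
  using assms normal_Inter[of \<A>] closedin_Inter[of \<A> T] by (auto simp: closed_normal_def)

lemma open_normal_Inter:
  assumes "\<A> \<noteq> {}" "finite \<A>" "\<And>N. N \<in> \<A> \<Longrightarrow> open_normal G T N"
  shows "open_normal G T (\<Inter>\<A>)"
  using assms normal_Inter[of \<A>] openin_Inter[of \<A> T] by (auto simp: open_normal_def)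

lemma open_normal_carrier: "open_normal G T (carrier G)"
  using normal_self openin_topspace[of T] by (simp add: open_normal_def)

lemma closed_normal_carrier: "closed_normal G T (carrier G)"
  by (simp add: open_normal_carrier open_normal_imp_closed_normal)

lemma closed_normal_one: "closed_normal G T {\<one>}"
  by (simp add: closed_normal_def one_is_normal closedin_one)

text \<open>\<open>z\<close> lies in \<open>C <#> U\<close> exactly if
  \<open>z \<otimes> inv u\<close> lies in \<open>C\<close> for some \<open>u\<close> in
  \<open>U\<close>; the \<open>u\<close> for which it does not form an open set containing
  \<open>\<one>\<close>. Hence a closed set is the intersection of its products with open normal
  subgroups.\<close>

lemma separate_closed:
  assumes "closedin T C" "z \<in> carrier G" "z \<notin> C"
  obtains U where "open_normal G T U" "z \<notin> C <#> U"
proof -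
  have C: "C \<subseteq> carrier G" using closedin_subset[OF assms(1)] by simp
  have "openin T {u \<in> carrier G. z \<otimes> inv u \<in> carrier G - C}"
    using openin_diff[OF openin_topspace assms(1)] assms(2)
    by (intro openin_preimage_carrier continuous_intros) auto
  then obtain U where U: "open_normal G T U" "U \<subseteq> {u \<in> carrier G. z \<otimes> inv u \<in> carrier G - C}"
    using open_normal_base[of "{u \<in> carrier G. z \<otimes> inv u \<in> carrier G - C}"] assms by auto
  have "z \<notin> C <#> U"
  proof
    assume "z \<in> C <#> U"
    then obtain c u where cu: "c \<in> C" "u \<in> U" "z = c \<otimes> u" by (auto simp: set_mult_def)
    then have "u \<in> carrier G" "c \<in> carrier G" using U(2) C by auto
    then have "z \<otimes> inv u = c" using cu by (simp add: m_assoc)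
    then show False using U(2) cu by auto
  qed
  then show ?thesis using U(1) that by blast
qed

lemma separate_closed_normal:
  assumes "closed_normal G T N" "z \<in> carrier G" "z \<notin> N"
  obtains M where "open_normal G T M" "N \<subseteq> M" "z \<notin> M"
proof -
  obtain U where U: "open_normal G T U" "z \<notin> N <#> U"
    using separate_closed[of N z] assms by (auto simp: closed_normal_def)
  then show ?thesis
    using that[of "N <#> U"] open_normal_set_mult[OF assms(1)]
      set_mult_incl1[of U N] closed_subgroup_subset[OF closed_normal_imp_subgroup[OF assms(1)]]
    by (simp add: open_normal_def normal_imp_subgroup)
qed

lemma open_subgroup_contains_open_normal:
  assumes "open_subgroup G T H"
  obtains N where "open_normal G T N" "N \<subseteq> H"
  using open_normal_base[of H] assms subgroup.one_closed[of H G] by (auto simp: open_subgroup_def)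

end

section \<open>Quotients, subgroups and the subgroup M(A)\<close>

text \<open>For a quotient, both separation axioms come from one source: the clopen images of cosets
  of open normal subgroups.\<close>

lemma clopen_separated_imp:
  assumes "\<And>x y. x \<in> topspace X \<Longrightarrow> y \<in> topspace X \<Longrightarrow> x \<noteq> y \<Longrightarrow>
    \<exists>D. openin X D \<and> closedin X D \<and> x \<in> D \<and> y \<notin> D"
  shows "Hausdorff_space X" "totally_disconnected_space X"
proof -
  show "Hausdorff_space X"
    unfolding Hausdorff_space_def
  proof (intro allI impI, elim conjE)
    fix x y assume xy: "x \<in> topspace X" "y \<in> topspace X" "x \<noteq> y"
    then obtain D where "openin X D" "closedin X D" "x \<in> D" "y \<notin> D"
      using assms by meson
    then show "\<exists>U V. openin X U \<and> openin X V \<and> x \<in> U \<and> y \<in> V \<and> disjnt U V"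
      using xy openin_diff[OF openin_topspace, of X D]
      by (intro exI[of _ D] exI[of _ "topspace X - D"]) (simp add: disjnt_def)
  qed
  show "totally_disconnected_space X"
    unfolding totally_disconnected_space_def
  proof (intro allI impI)
    fix S assume S: "connectedin X S"
    have "x = y" if "x \<in> S" "y \<in> S" for x y
    proof (rule ccontr)
      assume "x \<noteq> y"
      moreover have "x \<in> topspace X" "y \<in> topspace X"
        using that S connectedin_subset_topspace by fast+
      ultimately obtain D where "openin X D" "closedin X D" "x \<in> D" "y \<notin> D"
        using assms by meson
      then show False
        using connectedin_clopen_cases[OF S, of D] that by (auto simp: disjnt_def)
    qed
    then show "\<exists>x. S \<subseteq> {x}" by (metis singletonI subsetI)
  qed
qed

lemma topspace_quotient_topology:
  assumes "topspace T = carrier G"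
  shows "topspace (quotient_topology G T N) = carrier (G Mod N)"
proof -
  have "{x \<in> topspace T. N #>\<^bsub>G\<^esub> x \<in> carrier (G Mod N)} = topspace T"
    by (auto simp: carrier_FactGroup assms)
  then have "openin (quotient_topology G T N) (carrier (G Mod N))"
    unfolding openin_quotient_topology using openin_topspace[of T] by simp
  then show ?thesis
    by (metis openin_quotient_topology openin_subset openin_topspace subset_antisym)
qed

lemma continuous_map_quotient_topology_iff:
  "topspace T = carrier G \<Longrightarrow> continuous_map (quotient_topology G T N) X f \<longleftrightarrow>
     f \<in> carrier (G Mod N) \<rightarrow> topspace X \<and> continuous_map T X (\<lambda>x. f (N #>\<^bsub>G\<^esub> x))"
proof -
  assume top: "topspace T = carrier G"
  have eq: "{x \<in> topspace T. N #>\<^bsub>G\<^esub> x \<in> {C \<in> carrier (G Mod N). f C \<in> U}} = {x \<in> topspace T. f (N #>\<^bsub>G\<^esub> x) \<in> U}" for U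
    by (auto simp: carrier_FactGroup top)
  have ts: "topspace (quotient_topology G T N) = carrier (G Mod N)"
    using topspace_quotient_topology[OF top] .
  show ?thesis
    unfolding continuous_map_def ts openin_quotient_topology eq
    by (auto simp: carrier_FactGroup top Pi_iff)
qed

section \<open>Quotients and closed subgroups as profinite groups\<close>

context profinite
begin

lemma open_r_coset_base:
  assumes "openin T W" "z \<in> W"
  obtains U where "open_normal G T U" "U #> z \<subseteq> W"
proof -
  have z: "z \<in> carrier G" "W \<subseteq> carrier G"
    using assms openin_subset[OF assms(1)] by auto
  have "openin T {u \<in> carrier G. u \<otimes> z \<in> W}"
    using z assms(1) by (intro openin_preimage_carrier continuous_intros) auto
  then obtain U where "open_normal G T U" "U \<subseteq> {u \<in> carrier G. u \<otimes> z \<in> W}"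
    using open_normal_base[of "{u \<in> carrier G. u \<otimes> z \<in> W}"] z assms(2) by auto
  then show ?thesis
    using that by (auto simp: r_coset_def)
qed

lemma r_coset_mono: "N \<subseteq> M \<Longrightarrow> N #> x \<subseteq> M #> x"
  by (auto simp: r_coset_def)

text \<open>Cosets of a subgroup containing \<open>N\<close> are saturated for the quotient map, so
  their images are open or closed as soon as they are so in \<open>G\<close>.\<close>

lemma preimage_image_r_coset:
  assumes "N \<lhd> G" "subgroup M G" "N \<subseteq> M" "x \<in> carrier G"
  shows "{z \<in> carrier G. N #> z \<in> (\<lambda>z. N #> z) ` (M #> x)} = M #> x"
proof (intro equalityI subsetI)
  fix z assume "z \<in> {z \<in> carrier G. N #> z \<in> (\<lambda>z. N #> z) ` (M #> x)}"
  then obtain y where y: "z \<in> carrier G" "y \<in> M #> x" "N #> z = N #> y" by auto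
  have "z \<in> N #> z"
    using rcos_self[OF y(1) normal_imp_subgroup[OF assms(1)]] .
  also have "\<dots> \<subseteq> M #> y"
    using y r_coset_mono[OF assms(3)] by simp
  also have "\<dots> = M #> x"
    using repr_independence[OF y(2) assms(4,2)] by simp
  finally show "z \<in> M #> x" .
next
  fix z assume z: "z \<in> M #> x"
  then have "z \<in> carrier G"
    using r_coset_subset_G[OF subgroup.subset[OF assms(2)] assms(4)] by auto
  with z show "z \<in> {z \<in> carrier G. N #> z \<in> (\<lambda>z. N #> z) ` (M #> x)}" by auto
qed

text \<open>Points are separated by images of cosets of open normal subgroups above
  \<open>N\<close>. Continuity of the multiplication is checked pointwise, because the product of
  two quotient topologies is not given as a quotient topology.\<close>

lemma profinite_hom_quotient:
  assumes N: "closed_normal G T N"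
  shows "profinite_hom G T (G Mod N) (quotient_topology G T N) (\<lambda>x. N #> x)"
proof -
  let ?Q = "quotient_topology G T N"
  have nN: "N \<lhd> G" using N by (simp add: closed_normal_def)
  interpret N: normal N G by (rule nN)
  interpret Q: Group.group "G Mod N" by (rule N.factorgroup_is_group)
  have inv_r: "inv\<^bsub>G Mod N\<^esub> (N #> x) = N #> inv x" if "x \<in> carrier G" for x
    using that by (subst N.inv_FactGroup) (auto simp: carrier_FactGroup N.rcos_inv)
  have ts: "topspace ?Q = carrier (G Mod N)"
    using topspace_quotient_topology[OF topspace] .
  have cont: "continuous_map T ?Q (\<lambda>x. N #> x)"
    unfolding continuous_map_def ts openin_quotient_topology by (auto simp: carrier_FactGroup)
  have clopen: "openin ?Q ((\<lambda>z. N #> z) ` (M #> x))" "closedin ?Q ((\<lambda>z. N #> z) ` (M #> x))"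
    if M: "open_normal G T M" "N \<subseteq> M" and x: "x \<in> carrier G" for M x
  proof -
    have sM: "subgroup M G" using M(1) by (simp add: open_normal_def normal_imp_subgroup)
    have sub: "M #> x \<subseteq> carrier G" using r_coset_subset_G[OF subgroup.subset[OF sM] x] .
    have pre: "{z \<in> carrier G. N #> z \<in> (\<lambda>z. N #> z) ` (M #> x)} = M #> x"
      using preimage_image_r_coset[OF nN sM M(2) x] .
    have "openin T (M #> x)" using M(1) x by (simp add: open_normal_def openin_r_coset)
    then show "openin ?Q ((\<lambda>z. N #> z) ` (M #> x))"
      using sub pre by (auto simp: openin_quotient_topology carrier_FactGroup)
    have "closedin T (M #> x)"
      using open_normal_imp_closed_normal[OF M(1)] x by (simp add: closed_normal_def closedin_r_coset)
    then have "openin T (carrier G - (M #> x))"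
      using openin_diff[OF openin_topspace, of T "M #> x"] by simp
    moreover have "{z \<in> carrier G. N #> z \<in> carrier (G Mod N) - (\<lambda>z. N #> z) ` (M #> x)} = carrier G - (M #> x)"
      using pre by (auto simp: carrier_FactGroup)
    ultimately have "openin ?Q (carrier (G Mod N) - (\<lambda>z. N #> z) ` (M #> x))"
      by (simp add: openin_quotient_topology)
    then show "closedin ?Q ((\<lambda>z. N #> z) ` (M #> x))"
      using sub by (simp add: closedin_def ts) (auto simp: carrier_FactGroup)
  qed
  have sep: "\<exists>D. openin ?Q D \<and> closedin ?Q D \<and> X \<in> D \<and> Y \<notin> D"
    if XY: "X \<in> topspace ?Q" "Y \<in> topspace ?Q" "X \<noteq> Y" for X Y
  proof -
    obtain x y where xy: "x \<in> carrier G" "y \<in> carrier G" "X = N #> x" "Y = N #> y"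
      using XY(1,2) by (auto simp: ts carrier_FactGroup)
    have "y \<otimes> inv x \<notin> N"
    proof
      assume "y \<otimes> inv x \<in> N"
      then have "y \<in> N #> x"
        using xy N.subset by (auto simp: r_coset_eq_preimage)
      then show False
        using repr_independence[OF _ xy(1) N.subgroup_axioms] xy XY(3) by simp
    qed
    then obtain M where M: "open_normal G T M" "N \<subseteq> M" "y \<otimes> inv x \<notin> M"
      using separate_closed_normal[OF N, of "y \<otimes> inv x"] xy by auto
    have sM: "subgroup M G" using M(1) by (simp add: open_normal_def normal_imp_subgroup)
    have "y \<notin> M #> x"
      using M(3) xy subgroup.subset[OF sM] by (auto simp: r_coset_eq_preimage)
    then have "Y \<notin> (\<lambda>z. N #> z) ` (M #> x)"
      using preimage_image_r_coset[OF nN sM M(2) xy(1)] xy by auto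
    moreover have "X \<in> (\<lambda>z. N #> z) ` (M #> x)"
      using rcos_self[OF xy(1) sM] xy by auto
    ultimately show ?thesis
      using clopen[OF M(1,2) xy(1)] by meson
  qed
  have cpt: "compact_space ?Q"
  proof -
    have "compactin ?Q ((\<lambda>x. N #> x) ` topspace T)"
      using image_compactin[OF _ cont] compact by (simp add: compact_space_def)
    then show ?thesis by (simp add: compact_space_def ts carrier_FactGroup)
  qed
  have mult: "continuous_map (prod_topology ?Q ?Q) ?Q (\<lambda>(X, Y). X <#> Y)"
    unfolding continuous_map_def
  proof (intro conjI allI impI)
    show "(\<lambda>(X, Y). X <#> Y) \<in> topspace (prod_topology ?Q ?Q) \<rightarrow> topspace ?Q"
      using Q.m_closed by (auto simp: ts)
    fix W assume W: "openin ?Q W"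
    have W': "openin T {x \<in> carrier G. N #> x \<in> W}"
      using W by (simp add: openin_quotient_topology)
    show "openin (prod_topology ?Q ?Q) {p \<in> topspace (prod_topology ?Q ?Q). (case p of (X, Y) \<Rightarrow> X <#> Y) \<in> W}"
    proof (subst openin_subopen, intro ballI)
      fix p assume "p \<in> {p \<in> topspace (prod_topology ?Q ?Q). (case p of (X, Y) \<Rightarrow> X <#> Y) \<in> W}"
      then obtain x y where xy: "x \<in> carrier G" "y \<in> carrier G" "p = (N #> x, N #> y)"
          "(N #> x) <#> (N #> y) \<in> W"
        by (auto simp: ts carrier_FactGroup)
      have "x \<otimes> y \<in> {x \<in> carrier G. N #> x \<in> W}"
        using xy N.rcos_sum by simp
      then obtain U where U: "open_normal G T U" "U #> (x \<otimes> y) \<subseteq> {x \<in> carrier G. N #> x \<in> W}"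
        using open_r_coset_base[OF W'] by blast
      \<comment> \<open>\<open>U\<close> controls only the translate at
        \<open>x \<otimes> y\<close>. Enlarging it by \<open>N\<close> makes the cosets saturated; a
        product of elements of \<open>M #> x\<close> and \<open>M #> y\<close> then lies in
        \<open>N #> (u \<otimes> (x \<otimes> y))\<close> with \<open>u\<close> in \<open>U\<close>,
        and this coset belongs to \<open>W\<close>.\<close>
      define M where "M = N <#> U"
      have M: "open_normal G T M" unfolding M_def using open_normal_set_mult[OF N U(1)] .
      have nM: "M \<lhd> G" using M by (simp add: open_normal_def)
      have sU: "subgroup U G" using U(1) by (simp add: open_normal_def normal_imp_subgroup)
      have sM: "subgroup M G" using nM by (rule normal_imp_subgroup)
      have NM: "N \<subseteq> M" unfolding M_def using set_mult_incl1[OF sU N.subset] .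
      let ?D = "\<lambda>x. (\<lambda>z. N #> z) ` (M #> x)"
      have "openin (prod_topology ?Q ?Q) (?D x \<times> ?D y)"
        using clopen(1)[OF M NM] xy by (simp add: openin_prod_Times_iff)
      moreover have "p \<in> ?D x \<times> ?D y"
        using xy rcos_self[OF _ sM] by auto
      moreover have "(N #> a) <#> (N #> b) \<in> W" "a \<in> carrier G" "b \<in> carrier G"
        if ab: "a \<in> M #> x" "b \<in> M #> y" for a b
      proof -
        show abG: "a \<in> carrier G" "b \<in> carrier G"
          using ab xy r_coset_subset_G[OF subgroup.subset[OF sM]] by auto
        have "a \<otimes> b \<in> (M #> x) <#> (M #> y)"
          using ab by (auto simp: set_mult_def)
        also have "\<dots> = M #> (x \<otimes> y)"
          using normal.rcos_sum[OF nM xy(1,2)] .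
        finally obtain n u where nu: "n \<in> N" "u \<in> U" "a \<otimes> b = n \<otimes> u \<otimes> (x \<otimes> y)"
          unfolding M_def by (auto simp: r_coset_def set_mult_def)
        have nuG: "n \<in> carrier G" "u \<in> carrier G"
          using nu sU N.subset subgroup.subset by auto
        have "a \<otimes> b \<in> N #> (u \<otimes> (x \<otimes> y))"
          using nu nuG xy by (auto simp: r_coset_def m_assoc)
        then have "N #> (a \<otimes> b) = N #> (u \<otimes> (x \<otimes> y))"
          using repr_independence[OF _ _ N.subgroup_axioms, of "a \<otimes> b" "u \<otimes> (x \<otimes> y)"] nuG xy by simp
        also have "\<dots> \<in> W"
          using U(2) nu(2) by (auto simp: r_coset_def)
        finally show "(N #> a) <#> (N #> b) \<in> W"
          using N.rcos_sum[OF abG] by simp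
      qed
      then have "?D x \<times> ?D y \<subseteq> {p \<in> topspace (prod_topology ?Q ?Q). (case p of (X, Y) \<Rightarrow> X <#> Y) \<in> W}"
        by (auto simp: ts carrier_FactGroup)
      ultimately show "\<exists>V. openin (prod_topology ?Q ?Q) V \<and> p \<in> V \<and>
          V \<subseteq> {p \<in> topspace (prod_topology ?Q ?Q). (case p of (X, Y) \<Rightarrow> X <#> Y) \<in> W}"
        by (intro exI[of _ "?D x \<times> ?D y"] conjI)
    qed
  qed
  have inv: "continuous_map ?Q ?Q (\<lambda>X. inv\<^bsub>G Mod N\<^esub> X)"
    unfolding continuous_map_quotient_topology_iff[OF topspace]
  proof
    show "(\<lambda>X. inv\<^bsub>G Mod N\<^esub> X) \<in> carrier (G Mod N) \<rightarrow> topspace ?Q"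
      by (auto simp: ts)
    have "continuous_map T ?Q (\<lambda>x. N #> inv x)"
      using continuous_map_compose[OF continuous_inv[OF continuous_map_id] cont]
      by (simp add: o_def id_def)
    then show "continuous_map T ?Q (\<lambda>x. inv\<^bsub>G Mod N\<^esub> (N #> x))"
      by (rule continuous_map_eq) (simp add: inv_r)
  qed
  have "profinite_group (G Mod N) ?Q"
    using cpt clopen_separated_imp[OF sep] Q.is_group mult inv
    by (simp add: profinite_group_def topological_group_def ts)
  then show ?thesis
    using profinite_axioms cont N.r_coset_hom_Mod
    by (simp add: profinite_hom_def profinite_hom_axioms_def profinite_iff)
qed

lemma kernel_quotient:
  assumes "N \<lhd> G"
  shows "kernel G (G Mod N) (\<lambda>x. N #> x) = N"
proof -
  have s: "subgroup N G" using assms by (rule normal_imp_subgroup)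
  have "N #> x = N \<longleftrightarrow> x \<in> N" if "x \<in> carrier G" for x
    using that s rcos_self[OF that s] coset_join2[OF that s] by auto
  then show ?thesis
    using subgroup.subset[OF s] by (auto simp: kernel_def)
qed

lemma profinite_hom_inclusion:
  assumes H: "closed_subgroup G T H"
  shows "profinite_hom (G\<lparr>carrier := H\<rparr>) (subtopology T H) G T (\<lambda>x. x)"
proof -
  have sH: "subgroup H G" "closedin T H" using H by (auto simp: closed_subgroup_def)
  have HG: "H \<subseteq> carrier G" using closed_subgroup_subset[OF H] .
  interpret H: Group.group "G\<lparr>carrier := H\<rparr>" using subgroup_imp_group[OF sH(1)] .
  have ts: "topspace (subtopology T H) = H" using HG by auto
  have id: "continuous_map (subtopology T H) T (\<lambda>x. x)"
    using continuous_map_from_subtopology[OF continuous_map_id[of T], of H] by (simp add: id_def)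
  have "continuous_map (prod_topology (subtopology T H) (subtopology T H)) T (\<lambda>p. fst p \<otimes> snd p)"
  proof (intro continuous_intros)
    show "continuous_map (prod_topology (subtopology T H) (subtopology T H)) T fst"
      using continuous_map_compose[OF continuous_map_fst id] by (simp add: o_def)
    show "continuous_map (prod_topology (subtopology T H) (subtopology T H)) T snd"
      using continuous_map_compose[OF continuous_map_snd id] by (simp add: o_def)
  qed
  then have mult: "continuous_map (prod_topology (subtopology T H) (subtopology T H)) (subtopology T H) (\<lambda>(x, y). x \<otimes> y)"
    using sH(1) HG by (auto simp: continuous_map_in_subtopology case_prod_unfold subgroup.m_closed)
  have "continuous_map (subtopology T H) T (\<lambda>x. inv x)"
    by (intro continuous_intros id)
  then have "continuous_map (subtopology T H) (subtopology T H) (\<lambda>x. inv x)"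
    using sH(1) by (auto simp: continuous_map_in_subtopology subgroup.m_inv_closed)
  then have inv: "continuous_map (subtopology T H) (subtopology T H) (\<lambda>x. inv\<^bsub>G\<lparr>carrier := H\<rparr>\<^esub> x)"
    by (rule continuous_map_eq) (simp add: sH(1) m_inv_consistent)
  have "totally_disconnected_space (subtopology T H)"
    using totally_disconnected by (simp add: totally_disconnected_space_def connectedin_subtopology)
  moreover have "compact_space (subtopology T H)"
    using sH(2) by (simp add: closedin_compactin compact_space_subtopology)
  ultimately have "profinite_group (G\<lparr>carrier := H\<rparr>) (subtopology T H)"
    using mult inv H.is_group Hausdorff ts
    by (simp add: profinite_group_def topological_group_def Hausdorff_space_subtopology)
  moreover have "(\<lambda>x. x) \<in> hom (G\<lparr>carrier := H\<rparr>) G"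
    using HG by (auto simp: hom_def)
  ultimately show ?thesis
    using profinite_axioms id by (simp add: profinite_hom_def profinite_hom_axioms_def profinite_iff)
qed

lemma profinite_subgroup:
  "closed_subgroup G T H \<Longrightarrow> profinite (G\<lparr>carrier := H\<rparr>) (subtopology T H)"
  using profinite_hom_inclusion by (simp add: profinite_hom_def)

lemma lower_central_subgroup:
  assumes "closed_subgroup G T H" "K \<subseteq> H"
  shows "lower_central (G\<lparr>carrier := H\<rparr>) (subtopology T H) i K = lower_central G T i K"
  using profinite_hom.image_lower_central[OF profinite_hom_inclusion[OF assms(1)], of K i] assms(2)
  by simp

lemma open_subgroup_subgroup_iff:
  assumes "open_subgroup G T H"
  shows "open_subgroup (G\<lparr>carrier := H\<rparr>) (subtopology T H) K \<longleftrightarrow> open_subgroup G T K \<and> K \<subseteq> H"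
  using assms incl_subgroup[of H K] subgroup_incl[of K H] subgroup.subset[of K "G\<lparr>carrier := H\<rparr>"]
  by (auto simp: open_subgroup_def openin_open_subtopology)

lemma closedin_subtopology_closed:
  "closedin T H \<Longrightarrow> closedin (subtopology T H) K \<longleftrightarrow> closedin T K \<and> K \<subseteq> H"
  by (simp add: closedin_closed_subtopology)

text \<open>Otherwise the sets \<open>K n - U\<close> would be nested, closed and non-empty, and
  compactness would give a common point outside \<open>U\<close>.\<close>

lemma decseq_closed_in_open:
  assumes "decseq K" "\<And>n. closedin T (K n)" "(\<Inter>n. K n) \<subseteq> U" "openin T U"
  obtains n :: nat where "K n \<subseteq> U"
proof (rule ccontr)
  assume "\<not> thesis"
  then have "K n - U \<noteq> {}" for n using that by blast
  moreover have "closedin T (K n - U)" for n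
    using assms by (intro closedin_diff) auto
  moreover have "decseq (\<lambda>n. K n - U)"
    using assms(1) by (auto simp: decseq_def)
  ultimately have "(\<Inter>n. K n - U) \<noteq> {}"
    by (intro compact_space_imp_nest[OF compact])
  then show False using assms(3) by auto
qed

text \<open>An open normal \<open>U\<close> with \<open>z\<close> outside \<open>C <#> U\<close>
  would contain some \<open>K n\<close>. This is the passage to the limit: a membership that holds
  modulo every kernel holds exactly.\<close>

lemma Inter_set_mult_closed:
  assumes "decseq K" "\<And>n. closedin T (K n)" "(\<Inter>n. K n) = {\<one>}" "closedin T C"
    "z \<in> carrier G" "\<And>n::nat. z \<in> C <#> K n"
  shows "z \<in> C"
proof (rule ccontr)
  assume "z \<notin> C"
  then obtain U where U: "open_normal G T U" "z \<notin> C <#> U"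
    using separate_closed assms by blast
  then have "openin T U" "{\<one>} \<subseteq> U"
    by (auto simp: open_normal_def dest: normal_imp_subgroup subgroup.one_closed)
  then obtain n where "K n \<subseteq> U"
    using decseq_closed_in_open[of K U] assms by metis
  then show False
    using assms(6)[of n] U(2) by (auto simp: set_mult_def)
qed

section \<open>The subgroup M_G(A)\<close>

lemma proper_open_invariant_iff:
  assumes "closed_normal G T A"
  shows "proper_open_invariant G T A B \<longleftrightarrow>
    closed_normal G T B \<and> B \<subset> A \<and> openin (subtopology T A) B"
proof -
  have A: "closed_subgroup G T A" using closed_normal_imp_subgroup[OF assms] .
  interpret A: profinite "G\<lparr>carrier := A\<rparr>" "subtopology T A" using profinite_subgroup[OF A] .
  \<comment> \<open>An open subgroup of the profinite group \<open>A\<close> is closed in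
    \<open>A\<close>, and \<open>A\<close> is closed in \<open>G\<close>.\<close>
  have "closedin T B" if "B \<lhd> G" "B \<subset> A" "openin (subtopology T A) B"
  proof -
    have "subgroup B G" "subgroup A G" "B \<subseteq> A"
      using that A by (auto simp: closed_subgroup_def normal_imp_subgroup)
    then have "subgroup B (G\<lparr>carrier := A\<rparr>)"
      by (rule subgroup_incl)
    then have "closedin (subtopology T A) B"
      using A.open_imp_closed_subgroup[of B] that by (simp add: open_subgroup_def closed_subgroup_def)
    then show ?thesis
      using A by (simp add: closed_subgroup_def closedin_subtopology_closed)
  qed
  then show ?thesis
    unfolding proper_open_invariant_def closed_normal_def by blast
qed

definition "max_open_invariant A B \<longleftrightarrow> proper_open_invariant G T A B \<and>
   (\<forall>C. proper_open_invariant G T A C \<and> B \<subseteq> C \<longrightarrow> C = B)"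

lemma M_sub_eq: "M_sub G T A = A \<inter> \<Inter>{B. max_open_invariant A B}"
  by (simp add: M_sub_def max_open_invariant_def)

lemma closed_normal_M_sub:
  assumes "closed_normal G T A"
  shows "closed_normal G T (M_sub G T A)"
proof -
  have "closed_normal G T (\<Inter>(insert A {B. max_open_invariant A B}))"
    using assms proper_open_invariant_iff[OF assms]
    by (intro closed_normal_Inter) (auto simp: max_open_invariant_def)
  then show ?thesis by (simp add: M_sub_eq)
qed

text \<open>An open normal \<open>M\<close> above \<open>Y\<close> that misses a point of
  \<open>A\<close> leaves only finitely many proper open invariant subgroups above
  \<open>A \<inter> M\<close>, and maximality among these is maximality among all.\<close>

lemma ex_max_open_invariant:
  assumes A: "closed_normal G T A" and Y: "closed_normal G T Y" "Y \<subset> A"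
  obtains B where "max_open_invariant A B" "Y \<subseteq> B"
proof -
  obtain z where z: "z \<in> A" "z \<notin> Y" using Y(2) by blast
  have AG: "A \<subseteq> carrier G" "subgroup A G"
    using closed_subgroup_subset[OF closed_normal_imp_subgroup[OF A]] A
    by (auto simp: closed_normal_def normal_imp_subgroup)
  obtain M where M: "open_normal G T M" "Y \<subseteq> M" "z \<notin> M"
    using separate_closed_normal[OF Y(1)] z AG by blast
  have sM: "subgroup M G" using M(1) by (simp add: open_normal_def normal_imp_subgroup)
  define F where "F = {C. proper_open_invariant G T A C \<and> A \<inter> M \<subseteq> C}"
  have AM: "A \<inter> M \<in> F"
    using A M z normal_subgroup_intersect[of A M] openin_subtopology_Int2[of T M A]
    by (auto simp: F_def proper_open_invariant_def closed_normal_def open_normal_def)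
  \<comment> \<open>Such a \<open>C\<close> is recovered from the cosets of \<open>M\<close> that it
    meets, so the size of \<open>F\<close> is bounded by that of the power set of
    \<open>rcosets M\<close>.\<close>
  have "C = A \<inter> \<Union>((\<lambda>c. M #> c) ` C)" if "C \<in> F" for C
  proof (intro equalityI subsetI)
    have C: "subgroup C G" "C \<subseteq> A" "A \<inter> M \<subseteq> C"
      using that by (auto simp: F_def proper_open_invariant_def normal_imp_subgroup)
    show "c \<in> A \<inter> \<Union>((\<lambda>c. M #> c) ` C)" if "c \<in> C" for c
      using that C AG rcos_self[OF _ sM, of c] by auto
    show "a \<in> C" if a: "a \<in> A \<inter> \<Union>((\<lambda>c. M #> c) ` C)" for a
    proof -
      obtain m c where mc: "m \<in> M" "c \<in> C" "a = m \<otimes> c"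
        using a by (auto simp: r_coset_def)
      have "m \<in> carrier G" "c \<in> carrier G"
        using mc C AG subgroup.subset[OF sM] by auto
      then have "m = a \<otimes> inv c" using mc by (simp add: m_assoc)
      also have "\<dots> \<in> A"
        using a mc C AG by (auto intro!: subgroup.m_closed subgroup.m_inv_closed)
      finally have "m \<in> C" using C mc by auto
      then show ?thesis using mc C by (auto intro: subgroup.m_closed)
    qed
  qed
  then have "F \<subseteq> (\<lambda>\<U>. A \<inter> \<Union>\<U>) ` Pow (rcosets M)"
  proof (intro subsetI)
    fix C assume C: "C \<in> F"
    assume *: "\<And>C. C \<in> F \<Longrightarrow> C = A \<inter> \<Union>((\<lambda>c. M #> c) ` C)"
    have "(\<lambda>c. M #> c) ` C \<in> Pow (rcosets M)"
      using C AG by (auto simp: F_def proper_open_invariant_def RCOSETS_def)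
    with *[OF C] show "C \<in> (\<lambda>\<U>. A \<inter> \<Union>\<U>) ` Pow (rcosets M)" by (rule image_eqI)
  qed
  then have "finite F"
    using finite_rcosets[OF open_normal_imp_open_subgroup[OF M(1)]] finite_subset by blast
  then obtain B where B: "B \<in> F" "A \<inter> M \<subseteq> B" "\<And>C. C \<in> F \<Longrightarrow> B \<subseteq> C \<Longrightarrow> B = C"
    using finite_has_maximal2[OF _ AM] by metis
  have "max_open_invariant A B"
    using B unfolding max_open_invariant_def F_def by blast
  moreover have "Y \<subseteq> B" using B(2) Y(2) M(2) by blast
  ultimately show ?thesis using that by blast
qed

text \<open>\<open>M\<^sub>G(A)\<close> plays the role of a Frattini subgroup.\<close>

lemma subset_set_mult_M_sub:
  assumes A: "closed_normal G T A" and X: "closed_normal G T X"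
    and sub: "A \<subseteq> X <#> M_sub G T A"
  shows "A \<subseteq> X"
proof (rule ccontr)
  assume "\<not> A \<subseteq> X"
  then have "A \<inter> X \<subset> A" by blast
  then obtain B where B: "max_open_invariant A B" "A \<inter> X \<subseteq> B"
    using ex_max_open_invariant[OF A closed_normal_Int[OF A X]] by blast
  have sB: "subgroup B G" "B \<subset> A"
    using B by (auto simp: max_open_invariant_def proper_open_invariant_def normal_imp_subgroup)
  have sA: "subgroup A G" "subgroup X G"
    using A X by (simp_all add: closed_normal_def normal_imp_subgroup)
  have "a \<in> B" if a: "a \<in> A" for a
  proof -
    obtain x m where xm: "x \<in> X" "m \<in> M_sub G T A" "a = x \<otimes> m"
      using sub a by (auto simp: set_mult_def)
    have m: "m \<in> A" "m \<in> B" using xm B(1) by (auto simp: M_sub_eq)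
    have "x \<in> carrier G" "m \<in> carrier G" using xm m sA subgroup.subset by auto
    then have "x = a \<otimes> inv m" using xm by (simp add: m_assoc)
    then have "x \<in> A" using a m sA by (auto intro: subgroup.m_closed subgroup.m_inv_closed)
    then show ?thesis using xm m B(2) sB by (auto intro: subgroup.m_closed)
  qed
  then show False using sB by blast
qed

lemma M_sub_strict:
  assumes A: "closed_normal G T A" "A \<noteq> {\<one>}"
  shows "M_sub G T A \<subset> A"
proof -
  have sA: "subgroup A G" using A by (simp add: closed_normal_def normal_imp_subgroup)
  have "{\<one>} \<subset> A" using A(2) subgroup.one_closed[OF sA] by auto
  then obtain B where "max_open_invariant A B"
    using ex_max_open_invariant[OF A(1) closed_normal_one] by metis
  then show ?thesis
    by (auto simp: M_sub_eq max_open_invariant_def proper_open_invariant_def)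
qed

end

section \<open>Groups with virtually nilpotent quotients\<close>

text \<open>Simplification would otherwise turn \<open>c + 1\<close> into \<open>Suc c\<close> and
  unfold \<open>\<gamma>\<close> into a commutator subgroup.\<close>

declare lower_central.simps(2) [simp del]

context profinite_hom
begin

lemma image_preimage_kernel:
  assumes "U \<subseteq> carrier G"
  shows "{x \<in> carrier G. \<pi> x \<in> \<pi> ` U} = (\<Union>k\<in>kernel G H \<pi>. U #>\<^bsub>G\<^esub> k)"
proof (intro equalityI subsetI)
  fix x assume "x \<in> {x \<in> carrier G. \<pi> x \<in> \<pi> ` U}"
  then obtain u where u: "x \<in> carrier G" "u \<in> U" "\<pi> x = \<pi> u" by auto
  then have "inv\<^bsub>G\<^esub> u \<otimes>\<^bsub>G\<^esub> x \<in> kernel G H \<pi>" "x = u \<otimes>\<^bsub>G\<^esub> (inv\<^bsub>G\<^esub> u \<otimes>\<^bsub>G\<^esub> x)"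
    using assms by (auto simp: kernel_def subset_iff)
  with u show "x \<in> (\<Union>k\<in>kernel G H \<pi>. U #>\<^bsub>G\<^esub> k)"
    by (auto simp: r_coset_def)
next
  fix x assume "x \<in> (\<Union>k\<in>kernel G H \<pi>. U #>\<^bsub>G\<^esub> k)"
  then show "x \<in> {x \<in> carrier G. \<pi> x \<in> \<pi> ` U}"
    using assms by (auto simp: r_coset_def kernel_def subset_iff)
qed

lemma subset_set_mult_kernel:
  assumes "A \<subseteq> carrier G" "B \<subseteq> carrier G" "\<pi> ` A \<subseteq> \<pi> ` B"
  shows "A \<subseteq> B <#>\<^bsub>G\<^esub> kernel G H \<pi>"
proof
  fix a assume a: "a \<in> A"
  then obtain b where b: "b \<in> B" "\<pi> a = \<pi> b" using assms(3) by blast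
  have "a \<in> carrier G" "b \<in> carrier G" using a b assms by auto
  then have "inv\<^bsub>G\<^esub> b \<otimes>\<^bsub>G\<^esub> a \<in> kernel G H \<pi>" "a = b \<otimes>\<^bsub>G\<^esub> (inv\<^bsub>G\<^esub> b \<otimes>\<^bsub>G\<^esub> a)"
    using b(2) by (simp_all add: kernel_def)
  with b(1) show "a \<in> B <#>\<^bsub>G\<^esub> kernel G H \<pi>" unfolding set_mult_def by blast
qed

lemma subset_if_image_subset:
  assumes "A \<subseteq> carrier G" "subgroup B G" "kernel G H \<pi> \<subseteq> B" "\<pi> ` A \<subseteq> \<pi> ` B"
  shows "A \<subseteq> B"
  by (rule order_trans[OF subset_set_mult_kernel[OF assms(1) subgroup.subset[OF assms(2)] assms(4)]
      G.set_mult_minimal[OF assms(2) order_refl assms(3)]])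

end

locale profinite_epi = profinite_hom +
  assumes surj: "\<pi> ` carrier G = carrier H"
begin

text \<open>The saturation of \<open>U\<close> is a union of translates, hence open. Its complement
  is closed, and by surjectivity the image of that complement is the complement of the image of
  \<open>U\<close>.\<close>

lemma openin_image:
  assumes "openin T U"
  shows "openin S (\<pi> ` U)"
proof -
  have U: "U \<subseteq> carrier G" using openin_subset[OF assms] by simp
  have "openin T (\<Union>k\<in>kernel G H \<pi>. U #>\<^bsub>G\<^esub> k)"
    using assms by (intro openin_Union) (auto simp: kernel_def G.openin_r_coset)
  then have "openin T {x \<in> carrier G. \<pi> x \<in> \<pi> ` U}"
    by (simp add: image_preimage_kernel[OF U])
  then have "closedin T (carrier G - {x \<in> carrier G. \<pi> x \<in> \<pi> ` U})"
    using closedin_diff[OF closedin_topspace, of T] by simp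
  then have "closedin S (\<pi> ` (carrier G - {x \<in> carrier G. \<pi> x \<in> \<pi> ` U}))"
    by (rule closedin_image)
  moreover have "\<pi> ` (carrier G - {x \<in> carrier G. \<pi> x \<in> \<pi> ` U}) = carrier H - \<pi> ` U"
    using surj by auto
  moreover have "carrier H - (carrier H - \<pi> ` U) = \<pi> ` U"
    using U by auto
  ultimately show ?thesis
    using openin_diff[OF openin_topspace, of S "carrier H - \<pi> ` U"] by simp
qed

lemma open_subgroup_image: "open_subgroup G T K \<Longrightarrow> open_subgroup H S (\<pi> ` K)"
  by (simp add: open_subgroup_def openin_image subgroup_img_is_subgroup)

lemma normal_image:
  assumes "N \<lhd> G"
  shows "\<pi> ` N \<lhd> H"
  unfolding H.normal_inv_iff
proof (intro conjI ballI)
  have sN: "subgroup N G" using assms by (rule normal_imp_subgroup)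
  show "subgroup (\<pi> ` N) H" using sN by (rule subgroup_img_is_subgroup)
  fix y h assume "y \<in> carrier H" "h \<in> \<pi> ` N"
  then obtain x n where xn: "x \<in> carrier G" "y = \<pi> x" "n \<in> N" "h = \<pi> n"
    using surj by (metis imageE)
  then have "n \<in> carrier G" using subgroup.subset[OF sN] by auto
  then have "y \<otimes>\<^bsub>H\<^esub> h \<otimes>\<^bsub>H\<^esub> inv\<^bsub>H\<^esub> y = \<pi> (x \<otimes>\<^bsub>G\<^esub> n \<otimes>\<^bsub>G\<^esub> inv\<^bsub>G\<^esub> x)"
    using xn by simp
  then show "y \<otimes>\<^bsub>H\<^esub> h \<otimes>\<^bsub>H\<^esub> inv\<^bsub>H\<^esub> y \<in> \<pi> ` N"
    using normal.inv_op_closed2[OF assms] xn by auto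
qed

lemma closed_normal_image: "closed_normal G T N \<Longrightarrow> closed_normal H S (\<pi> ` N)"
  by (simp add: closed_normal_def normal_image closedin_image)

lemma open_normal_image: "open_normal G T N \<Longrightarrow> open_normal H S (\<pi> ` N)"
  by (simp add: open_normal_def normal_image openin_image)

lemma image_subset_one_iff: "A \<subseteq> carrier G \<Longrightarrow> \<pi> ` A \<subseteq> {\<one>\<^bsub>H\<^esub>} \<longleftrightarrow> A \<subseteq> kernel G H \<pi>"
  by (auto simp: kernel_def)

text \<open>Open subgroups are carried over by preimages and images, and each contains an open
  normal one. A condition on the quotient thus becomes one on subgroups of \<open>G\<close>.\<close>

lemma virtually_nilpotent_iff:
  "virtually_nilpotent c H S \<longleftrightarrow>
    (\<exists>R. open_normal G T R \<and> lower_central G T (c + 1) R \<subseteq> kernel G H \<pi>)"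
proof
  assume "virtually_nilpotent c H S"
  then obtain L where L: "open_subgroup H S L" "lower_central H S (c + 1) L = {\<one>\<^bsub>H\<^esub>}"
    unfolding virtually_nilpotent_def by metis
  obtain R where R: "open_normal G T R" "R \<subseteq> {x \<in> carrier G. \<pi> x \<in> L}"
    using G.open_subgroup_contains_open_normal[OF open_subgroup_preimage[OF L(1)]] by metis
  have RG: "R \<subseteq> carrier G" "\<pi> ` R \<subseteq> L" using R(2) by auto
  have "\<pi> ` lower_central G T (c + 1) R \<subseteq> lower_central H S (c + 1) L"
    unfolding image_lower_central[OF RG(1)] using H.lower_central_mono[OF RG(2)] .
  then have "lower_central G T (c + 1) R \<subseteq> kernel G H \<pi>"
    using image_subset_one_iff[OF G.lower_central_carrier[OF RG(1), of "c + 1"]] L(2) by simp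
  with R(1) show "\<exists>R. open_normal G T R \<and> lower_central G T (c + 1) R \<subseteq> kernel G H \<pi>"
    by blast
next
  assume "\<exists>R. open_normal G T R \<and> lower_central G T (c + 1) R \<subseteq> kernel G H \<pi>"
  then obtain R where R: "open_normal G T R" "lower_central G T (c + 1) R \<subseteq> kernel G H \<pi>"
    by metis
  have oR: "open_subgroup G T R" using G.open_normal_imp_open_subgroup[OF R(1)] .
  have RG: "R \<subseteq> carrier G"
    using G.closed_subgroup_subset[OF G.open_imp_closed_subgroup[OF oR]] .
  have "lower_central H S (c + 1) (\<pi> ` R) \<subseteq> {\<one>\<^bsub>H\<^esub>}"
    using image_subset_one_iff[OF G.lower_central_carrier[OF RG, of "c + 1"]] R(2)
      image_lower_central[OF RG, of "c + 1"] by simp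
  moreover have "\<one>\<^bsub>H\<^esub> \<in> lower_central H S (c + 1) (\<pi> ` R)"
    using H.closed_subgroup_lower_central[OF closed_subgroup_image[OF G.open_imp_closed_subgroup[OF oR]], of "c + 1"]
    by (simp add: closed_subgroup_def subgroup.one_closed)
  ultimately show "virtually_nilpotent c H S"
    unfolding virtually_nilpotent_def using open_subgroup_image[OF oR] by (intro exI[of _ "\<pi> ` R"]) auto
qed

end

section \<open>Reformulation of JNN_cF and consequences of Fitting-freeness\<close>

context profinite
begin

lemma profinite_epi_quotient:
  assumes "closed_normal G T N"
  shows "profinite_epi G T (G Mod N) (quotient_topology G T N) (\<lambda>x. N #> x)"
  using profinite_hom_quotient[OF assms]
  by (simp add: profinite_epi_def profinite_epi_axioms_def carrier_FactGroup)

text \<open>Each quotient condition is transported along \<open>G \<rightarrow> G Mod N\<close>,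
  whose kernel is \<open>N\<close>; monotonicity of \<open>\<gamma>\<close> allows open normal
  subgroups in place of open ones.\<close>

lemma JNNF_iff:
  "JNNF c G T \<longleftrightarrow>
    (\<forall>R. open_normal G T R \<longrightarrow> lower_central G T (c + 1) R \<noteq> {\<one>}) \<and>
    (\<forall>N. closed_normal G T N \<and> N \<noteq> {\<one>} \<longrightarrow>
      (\<exists>R. open_normal G T R \<and> lower_central G T (c + 1) R \<subseteq> N))"
proof -
  have "virtually_nilpotent c (G Mod N) (quotient_topology G T N) \<longleftrightarrow>
      (\<exists>R. open_normal G T R \<and> lower_central G T (c + 1) R \<subseteq> N)" if "closed_normal G T N" for N
    using profinite_epi.virtually_nilpotent_iff[OF profinite_epi_quotient[OF that]]
      kernel_quotient[of N] that by (simp add: closed_normal_def)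
  moreover have "virtually_nilpotent c G T \<longleftrightarrow>
    (\<exists>R. open_normal G T R \<and> lower_central G T (c + 1) R = {\<one>})"
  proof
    assume "virtually_nilpotent c G T"
    then obtain H where H: "open_subgroup G T H" "lower_central G T (c + 1) H = {\<one>}"
      unfolding virtually_nilpotent_def by metis
    obtain R where R: "open_normal G T R" "R \<subseteq> H"
      using open_subgroup_contains_open_normal[OF H(1)] by metis
    have "lower_central G T (c + 1) R \<subseteq> {\<one>}"
      using lower_central_mono[OF R(2), of "c + 1"] H(2) by simp
    moreover have "\<one> \<in> lower_central G T (c + 1) R"
      using closed_subgroup_lower_central[OF closed_normal_imp_subgroup[OF open_normal_imp_closed_normal[OF R(1)]], of "c + 1"]
      by (simp add: closed_subgroup_def subgroup.one_closed)
    ultimately show "\<exists>R. open_normal G T R \<and> lower_central G T (c + 1) R = {\<one>}"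
      using R(1) by (intro exI[of _ R]) auto
  next
    assume "\<exists>R. open_normal G T R \<and> lower_central G T (c + 1) R = {\<one>}"
    then show "virtually_nilpotent c G T"
      unfolding virtually_nilpotent_def using open_normal_imp_open_subgroup by metis
  qed
  ultimately show ?thesis
    unfolding JNNF_def by simp
qed

lemma closed_normal_one_mem: "closed_normal G T N \<Longrightarrow> \<one> \<in> N"
  by (simp add: closed_normal_def normal_imp_subgroup subgroup.one_closed)

lemma closed_normal_subset: "closed_normal G T N \<Longrightarrow> N \<subseteq> carrier G"
  using closed_subgroup_subset closed_normal_imp_subgroup by simp

lemma Fitting_freeD:
  assumes "Fitting_free G T" "closed_normal G T A"
    and comm: "\<And>x y. x \<in> A \<Longrightarrow> y \<in> A \<Longrightarrow> x \<otimes> y = y \<otimes> x"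
  shows "A = {\<one>}"
proof -
  have "subgroup A G" using assms(2) by (simp add: closed_normal_def normal_imp_subgroup)
  then have "Group.group (G\<lparr>carrier := A\<rparr>)" by (rule subgroup_imp_group)
  then have "comm_group (G\<lparr>carrier := A\<rparr>)"
    by (rule group.group_comm_groupI) (simp add: comm)
  then show ?thesis using assms(1,2) by (simp add: Fitting_free_def)
qed

text \<open>If a term \<open>L\<close> of the series satisfies \<open>[L, K] = 1\<close>, it
  commutes with its overgroup \<open>K\<close>, hence with itself. Being closed and normal in
  \<open>G\<close> it is trivial, and the induction descends to \<open>K\<close>.\<close>

lemma lower_central_eq_one_imp:
  assumes "Fitting_free G T" "closed_normal G T K" "lower_central G T (Suc i) K = {\<one>}"
  shows "K = {\<one>}"
  using assms(3)
proof (induction i)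
  case (Suc i)
  let ?L = "lower_central G T (Suc i) K"
  have L: "closed_normal G T ?L" using closed_normal_lower_central[OF assms(2)] .
  have LK: "?L \<subseteq> K" using lower_central_subset[OF closed_normal_imp_subgroup[OF assms(2)]] .
  have "?L = {\<one>}"
  proof (rule Fitting_freeD[OF assms(1) L])
    fix x y assume xy: "x \<in> ?L" "y \<in> ?L"
    have "commutator G x y \<in> commutator_subgroup G T ?L K"
      using xy LK by (intro commutator_in_commutator_subgroup) auto
    then have "commutator G x y = \<one>" using Suc.prems by (simp add: lower_central.simps)
    then show "x \<otimes> y = y \<otimes> x"
      using commutator_eq_one_iff[of x y] xy closed_normal_subset[OF L] by blast
  qed
  then show ?case by (rule Suc.IH)
qed (simp add: lower_central.simps)

lemma lower_central_neq_one:
  "Fitting_free G T \<Longrightarrow> closed_normal G T K \<Longrightarrow> K \<noteq> {\<one>} \<Longrightarrow> lower_central G T (c + 1) K \<noteq> {\<one>}"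
  using lower_central_eq_one_imp[of K c] by auto

lemma commutator_subgroup_neq_one:
  assumes "Fitting_free G T" "closed_normal G T K" "K \<noteq> {\<one>}"
  shows "commutator_subgroup G T K K \<noteq> {\<one>}"
  using lower_central_eq_one_imp[of K 1] assms by (auto simp: lower_central.simps)

text \<open>If \<open>F\<close> were non-trivial, it would contain some \<open>\<gamma>(R)\<close>.
  An open normal \<open>U\<close> meeting \<open>F\<close> trivially then gives
  \<open>\<gamma>(R \<inter> U) = 1\<close>, so \<open>G\<close> would be virtually
  class-\<open>c\<close> nilpotent.\<close>

lemma finite_normal_trivial:
  assumes "JNNF c G T" "closed_normal G T F" "finite F"
  shows "F = {\<one>}"
proof (rule ccontr)
  assume "F \<noteq> {\<one>}"
  then obtain R where R: "open_normal G T R" "lower_central G T (c + 1) R \<subseteq> F"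
    using assms(1,2) unfolding JNNF_iff by metis
  have "closedin T (F - {\<one>})"
    using assms(3) closed_normal_subset[OF assms(2)] Hausdorff
    by (intro closedin_Hausdorff_finite) auto
  then have "openin T (carrier G - (F - {\<one>}))"
    using openin_diff[OF openin_topspace, of T] by simp
  then obtain U where U: "open_normal G T U" "U \<subseteq> carrier G - (F - {\<one>})"
    using open_normal_base[of "carrier G - (F - {\<one>})"] by auto
  have RU: "open_normal G T (R \<inter> U)" using open_normal_Int[OF R(1) U(1)] .
  have "lower_central G T (c + 1) (R \<inter> U) \<subseteq> lower_central G T (c + 1) R"
    by (intro lower_central_mono) auto
  moreover have "lower_central G T (c + 1) (R \<inter> U) \<subseteq> R \<inter> U"
    by (intro lower_central_subset closed_normal_imp_subgroup open_normal_imp_closed_normal RU)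
  ultimately have "lower_central G T (c + 1) (R \<inter> U) \<subseteq> {\<one>}"
    using R(2) U(2) by blast
  moreover have "\<one> \<in> lower_central G T (c + 1) (R \<inter> U)"
    by (intro closed_normal_one_mem closed_normal_lower_central open_normal_imp_closed_normal RU)
  ultimately show False
    using assms(1) RU unfolding JNNF_iff by blast
qed

section \<open>Non-triviality of M_G(A)\<close>

lemma commutator_in_normal:
  assumes "N \<lhd> G" "x \<in> carrier G" "y \<in> carrier G"
  shows "x \<in> N \<Longrightarrow> commutator G x y \<in> N" "y \<in> N \<Longrightarrow> commutator G x y \<in> N"
proof -
  have s: "subgroup N G" using assms(1) by (rule normal_imp_subgroup)
  show "commutator G x y \<in> N" if "x \<in> N"
  proof -
    have "commutator G x y = inv x \<otimes> (inv y \<otimes> x \<otimes> y)"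
      using assms by (simp add: commutator_def m_assoc)
    then show ?thesis
      using normal.inv_op_closed1[OF assms(1,3) that] s that
      by (auto intro: subgroup.m_closed subgroup.m_inv_closed)
  qed
  show "commutator G x y \<in> N" if "y \<in> N"
  proof -
    have "inv x \<otimes> inv y \<otimes> x \<in> N"
      using normal.inv_op_closed1[OF assms(1,2)] subgroup.m_inv_closed[OF s that] by simp
    then show ?thesis
      using s that by (auto simp: commutator_def intro: subgroup.m_closed)
  qed
qed

lemma proper_open_invariant_mono:
  assumes A: "closed_normal G T A" and B: "proper_open_invariant G T A B"
    and C: "C \<lhd> G" "B \<subseteq> C" "C \<subset> A"
  shows "proper_open_invariant G T A C"
proof -
  have sA: "closed_subgroup G T A" using closed_normal_imp_subgroup[OF A] .
  interpret A: profinite "G\<lparr>carrier := A\<rparr>" "subtopology T A" using profinite_subgroup[OF sA] .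
  have s: "subgroup B (G\<lparr>carrier := A\<rparr>)" "subgroup C (G\<lparr>carrier := A\<rparr>)"
    using sA B C by (auto simp: closed_subgroup_def proper_open_invariant_def normal_imp_subgroup
        intro!: subgroup_incl[of _ A])
  then have "open_subgroup (G\<lparr>carrier := A\<rparr>) (subtopology T A) C"
    using A.open_subgroup_mono[of B C] B C by (auto simp: open_subgroup_def proper_open_invariant_def)
  then show ?thesis
    using C by (simp add: open_subgroup_def proper_open_invariant_def)
qed

text \<open>\<open>B\<close> behaves like a prime ideal. If neither \<open>X\<close> nor
  \<open>Y\<close> lies in \<open>B\<close>, maximality gives \<open>A = B X = B Y\<close>, so
  commutators of \<open>A\<close> are computed modulo \<open>B\<close> from representatives in
  \<open>X\<close> and \<open>Y\<close>. They lie in \<open>X \<inter> Y\<close>, hence in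
  \<open>B\<close>, although \<open>A / B\<close> is not abelian.\<close>

lemma max_open_invariant_prime:
  assumes A: "closed_normal G T A" and B: "max_open_invariant A B"
    and nab: "\<not> commutator_subgroup G T A A \<subseteq> B"
    and X: "closed_normal G T X" "X \<subseteq> A" and Y: "closed_normal G T Y" "Y \<subseteq> A"
    and sub: "X \<inter> Y \<subseteq> B"
  shows "X \<subseteq> B \<or> Y \<subseteq> B"
proof (rule ccontr)
  assume "\<not> ?thesis"
  then have nsub: "\<not> X \<subseteq> B" "\<not> Y \<subseteq> B" by auto
  have B': "proper_open_invariant G T A B" "closed_normal G T B" "B \<subset> A"
    using B proper_open_invariant_iff[OF A] by (auto simp: max_open_invariant_def)
  have sA: "subgroup A G" using A by (simp add: closed_normal_def normal_imp_subgroup)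
  have sB: "subgroup B G" "B \<lhd> G" using B' by (simp_all add: closed_normal_def normal_imp_subgroup)
  have full: "A \<subseteq> B <#> Z" if Z: "closed_normal G T Z" "Z \<subseteq> A" "\<not> Z \<subseteq> B" for Z
  proof -
    have cl: "closed_normal G T (B <#> Z)" using closed_normal_set_mult[OF B'(2) Z(1)] .
    have sZ: "subgroup Z G" using Z by (simp add: closed_normal_def normal_imp_subgroup)
    have BZ: "B \<subseteq> B <#> Z" "Z \<subseteq> B <#> Z" "B <#> Z \<subseteq> A"
      using set_mult_incl1[OF sZ subgroup.subset[OF sB(1)]] set_mult_incl2[OF sB(1) subgroup.subset[OF sZ]]
        set_mult_minimal[OF sA _ Z(2), of B] B'(3) by auto
    show ?thesis
    proof (rule ccontr)
      assume "\<not> A \<subseteq> B <#> Z"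
      then have "B <#> Z \<subset> A" using BZ by blast
      then have "proper_open_invariant G T A (B <#> Z)"
        using proper_open_invariant_mono[OF A B'(1) _ BZ(1)] cl by (simp add: closed_normal_def)
      then have "B <#> Z = B"
        using B BZ(1) unfolding max_open_invariant_def by blast
      then show False
        using BZ(2) Z(3) by simp
    qed
  qed
  interpret q: profinite_epi G T "G Mod B" "quotient_topology G T B" "\<lambda>x. B #> x"
    using profinite_epi_quotient[OF B'(2)] .
  have rep: "\<exists>z\<in>Z. B #> a = B #> z" if "A \<subseteq> B <#> Z" "Z \<subseteq> A" "a \<in> A" for a Z
  proof -
    obtain b z where bz: "b \<in> B" "z \<in> Z" "a = b \<otimes> z"
      using \<open>A \<subseteq> B <#> Z\<close> \<open>a \<in> A\<close> by (auto simp: set_mult_def)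
    then have "a \<in> B #> z" by (auto simp: r_coset_def)
    moreover have "z \<in> carrier G" using bz \<open>Z \<subseteq> A\<close> subgroup.subset[OF sA] by auto
    ultimately have "B #> z = B #> a" using repr_independence sB(1) by metis
    then show ?thesis using bz by auto
  qed
  have "commutator_subgroup G T A A \<subseteq> B"
  proof (rule commutator_subgroup_minimal[OF closed_normal_imp_subgroup[OF B'(2)]])
    fix a a' assume aa: "a \<in> A" "a' \<in> A"
    obtain x where x: "x \<in> X" "B #> a = B #> x" using rep[OF full[OF X nsub(1)] X(2) aa(1)] by metis
    obtain y where y: "y \<in> Y" "B #> a' = B #> y" using rep[OF full[OF Y nsub(2)] Y(2) aa(2)] by metis
    have c: "a \<in> carrier G" "a' \<in> carrier G" "x \<in> carrier G" "y \<in> carrier G"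
      using aa x(1) y(1) X(2) Y(2) subgroup.subset[OF sA] by auto
    have "commutator G x y \<in> X \<inter> Y"
      using commutator_in_normal[of X x y] commutator_in_normal[of Y x y] c x y X Y
      by (simp add: closed_normal_def)
    then have "commutator G x y \<in> B" using sub by blast
    then have "B #> commutator G x y = B" using coset_join2 sB c by simp
    moreover have "B #> commutator G a a' = B #> commutator G x y"
      using q.image_commutator[OF c(1,2)] q.image_commutator[OF c(3,4)] x y by simp
    ultimately show "commutator G a a' \<in> B"
      using rcos_self[OF _ sB(1), of "commutator G a a'"] c by simp
  qed
  then show False using nab by simp
qed

text \<open>\<open>D\<close> embeds into the finite coset space of \<open>U\<close>.\<close>

lemma finite_if_Int_open_normal_trivial:
  assumes U: "open_normal G T U" and sD: "subgroup D G" and triv: "D \<inter> U \<subseteq> {\<one>}"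
  shows "finite D"
proof -
  have sU: "subgroup U G" using U by (simp add: open_normal_def normal_imp_subgroup)
  have "inj_on (\<lambda>d. U #> d) D"
  proof (rule inj_onI)
    fix d e assume de: "d \<in> D" "e \<in> D" "U #> d = U #> e"
    have c: "d \<in> carrier G" "e \<in> carrier G" using de subgroup.subset[OF sD] by auto
    have "d \<in> U #> e" using de(3) rcos_self[OF c(1) sU] by simp
    then have "d \<otimes> inv e \<in> U"
      using c r_coset_eq_preimage[OF subgroup.subset[OF sU] c(2)] by simp
    moreover have "d \<otimes> inv e \<in> D"
      using de(1,2) sD by (meson subgroup.m_closed subgroup.m_inv_closed)
    ultimately have "d \<otimes> inv e = \<one>" using triv by blast
    then show "d = e" using c by (metis inv_equality inv_inv inv_closed)
  qed
  moreover have "(\<lambda>d. U #> d) ` D \<subseteq> rcosets U"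
    using subgroup.subset[OF sD] by (auto simp: RCOSETS_def)
  ultimately show ?thesis
    using finite_rcosets[OF open_normal_imp_open_subgroup[OF U]] by (rule inj_on_finite)
qed

text \<open>Suppose \<open>M(A) = 1\<close>. Let \<open>B\<close> be a maximal invariant subgroup
  not containing \<open>[A, A]\<close> and \<open>D\<close> the intersection of all the others. Then
  \<open>D \<inter> B = 1\<close>, so \<open>D\<close> is finite, as \<open>B\<close> is open in
  \<open>A\<close>, and therefore trivial. By compactness finitely many of the others then already
  intersect inside \<open>B\<close>, which contradicts its primeness.\<close>

lemma M_sub_neq_one:
  assumes FF: "Fitting_free G T" and J: "JNNF c G T" and A: "closed_normal G T A" "A \<noteq> {\<one>}"
  shows "M_sub G T A \<noteq> {\<one>}"
proof
  assume M1: "M_sub G T A = {\<one>}"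
  let ?A' = "commutator_subgroup G T A A"
  have A': "?A' \<noteq> {\<one>}" "closed_normal G T ?A'"
    using commutator_subgroup_neq_one[OF FF A] closed_normal_commutator_subgroup[OF A(1) A(1)] by auto
  have "?A' \<subseteq> A"
    using A(1) by (intro commutator_subgroup_minimal closed_normal_imp_subgroup commutator_in_subgroup)
      (auto simp: closed_normal_def normal_imp_subgroup)
  moreover have "\<not> ?A' \<subseteq> M_sub G T A"
    using A' M1 closed_normal_one_mem[OF A'(2)] by auto
  ultimately obtain B where B: "max_open_invariant A B" "\<not> ?A' \<subseteq> B"
    unfolding M_sub_eq by blast
  let ?\<B> = "{C. max_open_invariant A C \<and> C \<noteq> B}"
  have cn: "closed_normal G T C" "C \<subset> A" if "max_open_invariant A C" for C
    using that proper_open_invariant_iff[OF A(1)] by (auto simp: max_open_invariant_def)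
  have cnI: "closed_normal G T (A \<inter> \<Inter>\<F>)" if "\<F> \<subseteq> ?\<B>" for \<F>
    using closed_normal_Inter[of "insert A \<F>"] that cn A(1) by auto
  have prime: "\<not> A \<inter> \<Inter>\<F> \<subseteq> B" if "finite \<F>" "\<F> \<subseteq> ?\<B>" for \<F>
    using that
  proof (induction \<F> rule: finite_induct)
    case empty
    then show ?case using cn(2)[OF B(1)] by auto
  next
    case (insert C \<F>)
    have C: "max_open_invariant A C" "C \<noteq> B" using insert.prems by auto
    have "\<not> C \<subseteq> B"
      using C B(1) by (auto simp: max_open_invariant_def)
    moreover have "\<not> A \<inter> \<Inter>\<F> \<subseteq> B" using insert by auto
    moreover have "closed_normal G T (A \<inter> \<Inter>\<F>)" using insert.prems by (intro cnI) auto
    ultimately have "\<not> C \<inter> (A \<inter> \<Inter>\<F>) \<subseteq> B"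
      using max_open_invariant_prime[OF A(1) B, of C "A \<inter> \<Inter>\<F>"] cn[OF C(1)] by blast
    then show ?case by auto
  qed
  \<comment> \<open>\<open>B\<close> is open only relative to \<open>A\<close>. The set
    \<open>O'\<close> turns the complement of \<open>B\<close> in \<open>A\<close> into a closed
    subset of \<open>G\<close>, and is a neighbourhood of \<open>\<one>\<close> meeting
    \<open>A\<close> in \<open>B\<close>.\<close>
  obtain O' where O': "openin T O'" "B = O' \<inter> A"
    using B(1) by (auto simp: max_open_invariant_def proper_open_invariant_def openin_subtopology)
  let ?D = "A \<inter> \<Inter>?\<B>"
  have D: "closed_normal G T ?D" by (rule cnI) simp
  have "?D \<inter> B = {\<one>}"
    using M1 B(1) unfolding M_sub_eq by auto
  show False
  proof (cases "?D = {\<one>}")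
    case False
    have "\<one> \<in> O'"
      using O' closed_normal_one_mem[OF cn(1)[OF B(1)]] by auto
    then obtain U where U: "open_normal G T U" "U \<subseteq> O'"
      using open_normal_base[OF O'(1)] by metis
    have "?D \<inter> U \<subseteq> {\<one>}"
      using U O' \<open>?D \<inter> B = {\<one>}\<close> by blast
    moreover have "subgroup ?D G" using D by (simp add: closed_normal_def normal_imp_subgroup)
    ultimately have "finite ?D"
      using finite_if_Int_open_normal_trivial[OF U(1)] by simp
    then show False
      using finite_normal_trivial[OF J D] False by simp
  next
    case True
    let ?\<C> = "insert (A - O') ?\<B>"
    have "closedin T C" if "C \<in> ?\<C>" for C
      using that cn A(1) O'(1) by (auto simp: closed_normal_def)
    moreover have "\<Inter>\<F> \<noteq> {}" if F: "finite \<F>" "\<F> \<subseteq> ?\<C>" for \<F>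
    proof -
      have "\<not> A \<inter> \<Inter>(\<F> - {A - O'}) \<subseteq> B"
        using F by (intro prime) auto
      then obtain x where "x \<in> A" "x \<notin> B" "x \<in> \<Inter>(\<F> - {A - O'})" by blast
      then have "x \<in> \<Inter>\<F>" using O' by blast
      then show ?thesis by blast
    qed
    ultimately have "\<Inter>?\<C> \<noteq> {}"
      using compact[unfolded compact_space_fip, THEN spec, of ?\<C>] by meson
    then obtain x where "x \<in> A" "x \<notin> O'" "x \<in> \<Inter>?\<B>" by auto
    then have "x \<in> ?D" by auto
    then have "x = \<one>" using True by simp
    then show False
      using \<open>x \<notin> O'\<close> O' closed_normal_one_mem[OF cn(1)[OF B(1)]] by auto
  qed
qed

section \<open>Generalized obliquity\<close>

lemma lower_central_set_mult:
  assumes N: "closed_normal G T N" and K: "K \<subseteq> carrier G"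
  shows "lower_central G T i (N <#> K) \<subseteq> N <#> lower_central G T i K"
proof
  interpret q: profinite_epi G T "G Mod N" "quotient_topology G T N" "\<lambda>x. N #> x"
    using profinite_epi_quotient[OF N] .
  have sN: "subgroup N G" using N by (simp add: closed_normal_def normal_imp_subgroup)
  have NK: "N <#> K \<subseteq> carrier G"
    using set_mult_closed[OF subgroup.subset[OF sN] K] .
  \<comment> \<open>\<open>N <#> K\<close> and \<open>K\<close> have the same image modulo
    \<open>N\<close>, so their lower central terms agree there.\<close>
  have "(\<lambda>x. N #> x) ` (N <#> K) = (\<lambda>x. N #> x) ` K"
  proof
    show "(\<lambda>x. N #> x) ` K \<subseteq> (\<lambda>x. N #> x) ` (N <#> K)"
      by (intro image_mono set_mult_incl2[OF sN K])
    show "(\<lambda>x. N #> x) ` (N <#> K) \<subseteq> (\<lambda>x. N #> x) ` K"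
    proof
      fix C assume "C \<in> (\<lambda>x. N #> x) ` (N <#> K)"
      then obtain n k where nk: "n \<in> N" "k \<in> K" "C = N #> (n \<otimes> k)"
        by (auto simp: set_mult_def)
      then have "n \<otimes> k \<in> N #> k" by (auto simp: r_coset_def)
      then have "C = N #> k" using nk K repr_independence[OF _ _ sN] by (metis subsetD)
      then show "C \<in> (\<lambda>x. N #> x) ` K" using nk by blast
    qed
  qed
  then have eq: "(\<lambda>x. N #> x) ` lower_central G T i (N <#> K) = (\<lambda>x. N #> x) ` lower_central G T i K"
    using q.image_lower_central[OF NK] q.image_lower_central[OF K] by simp
  fix x assume x: "x \<in> lower_central G T i (N <#> K)"
  then obtain y where y: "y \<in> lower_central G T i K" "N #> x = N #> y"
    using eq by (metis imageE imageI)
  have "x \<in> N #> x"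
    using rcos_self[OF _ sN] x lower_central_carrier[OF NK] by blast
  then have "x \<in> N #> y" using y(2) by simp
  then show "x \<in> N <#> lower_central G T i K"
    using y(1) by (auto simp: r_coset_def set_mult_def)
qed

lemma finite_subgroups_above:
  assumes "open_subgroup G T U"
  shows "finite {M. subgroup M G \<and> U \<subseteq> M}"
proof -
  have sU: "subgroup U G" using assms by (simp add: open_subgroup_def)
  have "M \<in> \<Union> ` Pow (rcosets U)" if M: "subgroup M G" "U \<subseteq> M" for M
  proof (rule image_eqI)
    show "(\<lambda>x. U #> x) ` M \<in> Pow (rcosets U)"
      using subgroup.subset[OF M(1)] by (auto simp: RCOSETS_def)
    show "M = \<Union> ((\<lambda>x. U #> x) ` M)"
    proof (intro equalityI subsetI)
      fix x assume "x \<in> M"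
      then show "x \<in> \<Union> ((\<lambda>x. U #> x) ` M)"
        using rcos_self[OF _ sU, of x] subgroup.subset[OF M(1)] by blast
    next
      fix x assume "x \<in> \<Union> ((\<lambda>x. U #> x) ` M)"
      then show "x \<in> M" using M by (auto simp: r_coset_def intro: subgroup.m_closed)
    qed
  qed
  then have "{M. subgroup M G \<and> U \<subseteq> M} \<subseteq> \<Union> ` Pow (rcosets U)"
    by (intro subsetI) (elim CollectE conjE)
  then show ?thesis
    by (rule finite_subset) (simp add: finite_rcosets[OF assms])
qed

text \<open>Generalized obliquity. Given a sequence of counterexamples \<open>N i\<close>, pigeonhole yields a limit
  \<open>L\<close> of a subsequence, and \<open>Y = \<gamma>(L)\<close> satisfies \<open>Y \<le> N i \<cdot> \<gamma>(Q j) \<le> N i \<cdot> M(Y)\<close> for suitable \<open>j\<close>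
  and large \<open>i\<close>, which forces \<open>Y \<le> N i\<close>.\<close>

lemma obliquity:
  assumes FF: "Fitting_free G T" and J: "JNNF c G T"
    and Q: "decseq Q" "\<And>n. open_normal G T (Q n)" "\<And>U. open_normal G T U \<Longrightarrow> \<exists>n::nat. Q n \<subseteq> U"
    and P: "open_normal G T P"
  shows "\<exists>n. \<forall>N. closed_normal G T N \<longrightarrow>
    N \<subseteq> P \<or> lower_central G T (c + 1) (Q n) \<subseteq> lower_central G T (c + 1) N"
proof (rule ccontr)
  let ?g = "lower_central G T (c + 1)"
  assume "\<not> ?thesis"
  then obtain N where N: "\<And>n. closed_normal G T (N n)" "\<And>n. \<not> N n \<subseteq> P" "\<And>n. \<not> ?g (Q n) \<subseteq> ?g (N n)"
    by metis
  have sQ: "subgroup (Q n) G" for n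
    using Q(2)[of n] by (simp add: open_normal_def normal_imp_subgroup)
  have QG: "Q n \<subseteq> carrier G" for n
    using subgroup.subset[OF sQ] .
  have NG: "N n \<subseteq> carrier G" for n using closed_normal_subset[OF N(1)] .
  have onNQ: "open_normal G T (N i <#> Q j)" for i j
    using open_normal_set_mult[OF N(1) Q(2)] .
  have fin: "finite ((\<lambda>i. N i <#> Q j) ` I)" for j I
    using set_mult_incl2[OF _ QG] N(1) onNQ
    by (intro finite_subset[OF _ finite_subgroups_above[OF open_normal_imp_open_subgroup[OF Q(2)[of j]]]])
      (auto simp: closed_normal_def open_normal_def normal_imp_subgroup subset_iff)
  \<comment> \<open>For fixed \<open>j\<close> the groups \<open>N i <#> Q j\<close> lie above the
    open subgroup \<open>Q j\<close>, so infinitely many indices share one value. The choice is made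
    inside the index set of the previous stage, which makes \<open>f\<close> decreasing.\<close>
  have "\<exists>f. \<forall>j. infinite {i. N i <#> Q j = f j} \<and> f (Suc j) \<subseteq> f j"
  proof (rule dependent_nat_choice)
    have "\<exists>i0\<in>UNIV. infinite {i \<in> UNIV. N i <#> Q 0 = N i0 <#> Q 0}"
      by (intro pigeonhole_infinite fin) simp
    then show "\<exists>M. infinite {i. N i <#> Q 0 = M}" by auto
  next
    fix M j assume "infinite {i. N i <#> Q j = M}"
    then have "\<exists>i0\<in>{i. N i <#> Q j = M}. infinite {i \<in> {i. N i <#> Q j = M}. N i <#> Q (Suc j) = N i0 <#> Q (Suc j)}"
      by (intro pigeonhole_infinite fin)
    then obtain i0 where i0: "N i0 <#> Q j = M"
      "infinite {i \<in> {i. N i <#> Q j = M}. N i <#> Q (Suc j) = N i0 <#> Q (Suc j)}" by auto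
    then have "infinite {i. N i <#> Q (Suc j) = N i0 <#> Q (Suc j)}"
      by (auto elim!: infinite_super[rotated])
    moreover have "N i0 <#> Q (Suc j) \<subseteq> N i0 <#> Q j"
      using Q(1) by (intro mono_set_mult) (auto simp: decseq_Suc_iff)
    ultimately show "\<exists>M'. infinite {i. N i <#> Q (Suc j) = M'} \<and> M' \<subseteq> M"
      using i0(1) by blast
  qed
  then obtain f where f: "\<And>j. infinite {i. N i <#> Q j = f j}" "\<And>j. f (Suc j) \<subseteq> f j"
    by metis
  have ex: "\<exists>i\<ge>k. N i <#> Q j = f j" for j k
    using f(1)[of j] unfolding infinite_nat_iff_unbounded_le by auto
  have fn: "open_normal G T (f j)" for j using ex[of 0 j] onNQ by metis
  define L where "L = (\<Inter>j. f j)"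
  have L: "closed_normal G T L"
    unfolding L_def using fn by (intro closed_normal_Inter open_normal_imp_closed_normal) auto
  \<comment> \<open>A decreasing intersection inside the open set \<open>P\<close> has a member
    \<open>f j\<close> inside \<open>P\<close>; but \<open>f j\<close> contains some
    \<open>N i\<close>.\<close>
  have "\<not> L \<subseteq> P"
  proof
    assume "L \<subseteq> P"
    moreover have "decseq f" using f(2) by (simp add: decseq_Suc_iff)
    moreover have "closedin T (f n)" for n
      using open_normal_imp_closed_normal[OF fn] by (simp add: closed_normal_def)
    ultimately obtain j where j: "f j \<subseteq> P"
      using decseq_closed_in_open[of f P] P unfolding L_def open_normal_def by metis
    obtain i where "N i <#> Q j = f j" using ex[of 0 j] by blast
    then have "N i \<subseteq> P" using j set_mult_incl1[OF sQ NG] by blast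
    then show False using N(2) by blast
  qed
  then have "L \<noteq> {\<one>}"
    using closed_normal_one_mem[OF open_normal_imp_closed_normal[OF P]] by auto
  define Y where "Y = ?g L"
  have Y: "closed_normal G T Y" "Y \<noteq> {\<one>}"
    unfolding Y_def using closed_normal_lower_central[OF L] lower_central_neq_one[OF FF L \<open>L \<noteq> {\<one>}\<close>] by auto
  have ex_Q: "\<exists>n. ?g (Q n) \<subseteq> Z" if Z: "closed_normal G T Z" "Z \<noteq> {\<one>}" for Z
  proof -
    obtain R where R: "open_normal G T R" "?g R \<subseteq> Z"
      using J Z unfolding JNNF_iff by metis
    obtain n where "Q n \<subseteq> R" using Q(3)[OF R(1)] by blast
    then show ?thesis using lower_central_mono R(2) by blast
  qed
  obtain j where j: "?g (Q j) \<subseteq> M_sub G T Y"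
    using ex_Q[OF closed_normal_M_sub[OF Y(1)] M_sub_neq_one[OF FF J Y]] by blast
  \<comment> \<open>The contradiction compares \<open>\<gamma>(Q i)\<close> with
    \<open>\<gamma>(N i)\<close>. Since \<open>Y\<close> inside \<open>N i\<close> gives only
    \<open>\<gamma>(Y)\<close> inside \<open>\<gamma>(N i)\<close>, the index \<open>i\<close> has
    to be at least a \<open>k\<close> with \<open>\<gamma>(Q k)\<close> inside
    \<open>\<gamma>(Y)\<close>.\<close>
  obtain k where k: "?g (Q k) \<subseteq> ?g Y"
    using ex_Q[OF closed_normal_lower_central[OF Y(1)] lower_central_neq_one[OF FF Y]] by blast
  obtain i where i: "i \<ge> k" "N i <#> Q j = f j" using ex by blast
  have "L \<subseteq> N i <#> Q j" unfolding i(2) L_def by blast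
  then have "Y \<subseteq> ?g (N i <#> Q j)" unfolding Y_def by (rule lower_central_mono)
  also have "\<dots> \<subseteq> N i <#> ?g (Q j)" using lower_central_set_mult[OF N(1) QG] .
  also have "\<dots> \<subseteq> N i <#> M_sub G T Y" using j by (intro mono_set_mult) auto
  finally have "Y \<subseteq> N i" using subset_set_mult_M_sub[OF Y(1) N(1)] by blast
  then have "?g Y \<subseteq> ?g (N i)" by (rule lower_central_mono)
  moreover have "?g (Q i) \<subseteq> ?g (Q k)"
    using Q(1) i(1) by (intro lower_central_mono) (auto simp: decseq_def)
  ultimately show False using k N(3) by blast
qed

end

section \<open>Conjugates and finitely generated groups\<close>

lemma (in Group.group) rcosets_r_coset:
  assumes "subgroup H G" "C \<in> rcosets H" "x \<in> carrier G"
  shows "C #> x \<in> rcosets H"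
proof -
  obtain g where "g \<in> carrier G" "C = H #> g"
    using assms(2) by (auto simp: RCOSETS_def)
  then show ?thesis
    using assms coset_mult_assoc[OF subgroup.subset[OF assms(1)], of g x] by (auto simp: RCOSETS_def)
qed

text \<open>\<open>N\<close> acts trivially on the cosets of \<open>H\<close>, since
  \<open>g \<otimes> x \<otimes> inv g\<close> stays in \<open>N\<close> and hence in
  \<open>H\<close>.\<close>

lemma (in Group.group) rcosets_r_coset_normal:
  assumes "subgroup H G" "N \<lhd> G" "N \<subseteq> H" "C \<in> rcosets H" "x \<in> N"
  shows "C #> x = C"
proof -
  obtain g where g: "g \<in> carrier G" "C = H #> g"
    using assms(4) by (auto simp: RCOSETS_def)
  have x: "x \<in> carrier G"
    using assms(2,5) normal_imp_subgroup subgroup.subset by blast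
  have HG: "H \<subseteq> carrier G" using assms(1) by (rule subgroup.subset)
  have "g \<otimes> x \<otimes> inv g \<in> H"
    using normal.inv_op_closed2[OF assms(2) g(1) assms(5)] assms(3) by blast
  then have "H #> (g \<otimes> x \<otimes> inv g) = H"
    using coset_join2 assms(1) g x by simp
  then have "H #> g = (H #> (g \<otimes> x \<otimes> inv g)) #> g" by simp
  also have "\<dots> = H #> (g \<otimes> x)"
    using g x HG by (simp add: coset_mult_assoc m_assoc)
  also have "\<dots> = C #> x"
    using g x HG by (simp add: coset_mult_assoc)
  finally show ?thesis using g by simp
qed

text \<open>A right action, matching \<open>conjugates\<close>: successive conjugations compose in
  the order of the product.\<close>

definition (in Group.group) conj_set :: "'a \<Rightarrow> 'a set \<Rightarrow> 'a set" where
  "conj_set g V = (\<lambda>x. inv g \<otimes> x \<otimes> g) ` V"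

text \<open>The normalizer of \<open>V\<close>. Equality instead of inclusion makes it closed under
  inverses.\<close>

definition (in Group.group) normalizing :: "'a set \<Rightarrow> 'a set" where
  "normalizing V = {g \<in> carrier G. conj_set g V = V}"

context Group.group
begin

lemma conjugates_eq:
  assumes "V \<subseteq> carrier G"
  shows "conjugates G V = {conj_set g V | g. g \<in> carrier G}"
proof -
  have "inv g <# (V #> g) = conj_set g V" if "g \<in> carrier G" for g
    using that assms by (auto simp: l_coset_def r_coset_def conj_set_def m_assoc subset_iff image_iff)
  then show ?thesis unfolding conjugates_def by auto
qed

lemma conj_set_mult:
  assumes "V \<subseteq> carrier G" "g \<in> carrier G" "h \<in> carrier G"
  shows "conj_set h (conj_set g V) = conj_set (g \<otimes> h) V"
  using assms by (auto simp: conj_set_def image_image inv_mult_group m_assoc subset_iff intro!: image_cong)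

lemma conj_set_one: "V \<subseteq> carrier G \<Longrightarrow> conj_set \<one> V = V"
  by (auto simp: conj_set_def subset_iff image_iff)

lemma conj_set_carrier: "V \<subseteq> carrier G \<Longrightarrow> g \<in> carrier G \<Longrightarrow> conj_set g V \<subseteq> carrier G"
  by (auto simp: conj_set_def)

lemma conj_set_mono: "V \<subseteq> W \<Longrightarrow> conj_set g V \<subseteq> conj_set g W"
  by (auto simp: conj_set_def)

lemma conj_set_normal:
  assumes "N \<lhd> G" "g \<in> carrier G"
  shows "conj_set g N = N"
proof -
  have NG: "N \<subseteq> carrier G" using assms(1) normal_imp_subgroup subgroup.subset by blast
  have le: "conj_set h N \<subseteq> N" if "h \<in> carrier G" for h
    using normal.inv_op_closed1[OF assms(1) that] by (auto simp: conj_set_def)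
  have "N = conj_set g (conj_set (inv g) N)"
    using assms(2) NG by (simp add: conj_set_mult conj_set_one)
  also have "\<dots> \<subseteq> conj_set g N" using le[of "inv g"] assms(2) by (intro conj_set_mono) simp
  finally show ?thesis using le[OF assms(2)] by blast
qed

lemma normal_iff_conj_set:
  "N \<lhd> G \<longleftrightarrow> subgroup N G \<and> (\<forall>g\<in>carrier G. conj_set g N = N)"
proof (intro iffI conjI ballI)
  assume *: "subgroup N G \<and> (\<forall>g\<in>carrier G. conj_set g N = N)"
  have "x \<otimes> h \<otimes> inv x \<in> N" if "x \<in> carrier G" "h \<in> N" for x h
  proof -
    have "x \<otimes> h \<otimes> inv x \<in> conj_set (inv x) N" using that by (auto simp: conj_set_def)
    then show ?thesis using * that by simp
  qed
  then show "N \<lhd> G" using * by (simp add: normal_inv_iff)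
qed (auto simp: normal_imp_subgroup conj_set_normal)

lemma subgroup_normalizing:
  assumes "V \<subseteq> carrier G"
  shows "subgroup (normalizing V) G"
proof (rule subgroupI)
  show "normalizing V \<subseteq> carrier G" by (auto simp: normalizing_def)
  have "\<one> \<in> normalizing V" using assms by (simp add: normalizing_def conj_set_one)
  then show "normalizing V \<noteq> {}" by blast
  show "inv a \<in> normalizing V" if "a \<in> normalizing V" for a
  proof -
    have a: "a \<in> carrier G" "conj_set a V = V" using that by (auto simp: normalizing_def)
    have "conj_set (inv a) V = conj_set (inv a) (conj_set a V)" using a by simp
    also have "\<dots> = V" using a(1) assms by (simp add: conj_set_mult conj_set_one)
    finally show ?thesis using a by (simp add: normalizing_def)
  qed
  show "a \<otimes> b \<in> normalizing V" if "a \<in> normalizing V" "b \<in> normalizing V" for a b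
    using that assms conj_set_mult[of V a b] by (auto simp: normalizing_def)
qed

lemma subset_normalizing:
  assumes "subgroup V G"
  shows "V \<subseteq> normalizing V"
proof
  fix v assume v: "v \<in> V"
  have VG: "V \<subseteq> carrier G" using assms by (rule subgroup.subset)
  have le: "conj_set w V \<subseteq> V" if "w \<in> V" for w
    using that assms by (auto simp: conj_set_def intro!: subgroup.m_closed subgroup.m_inv_closed)
  have "V = conj_set v (conj_set (inv v) V)"
    using v VG by (simp add: conj_set_mult conj_set_one subset_iff)
  also have "\<dots> \<subseteq> conj_set v V"
    using le[of "inv v"] v assms by (intro conj_set_mono) (simp add: subgroup.m_inv_closed)
  finally show "v \<in> normalizing V"
    using le[OF v] v VG by (auto simp: normalizing_def)
qed

lemma normal_in_normalizing:
  assumes "subgroup V G"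
  shows "V \<lhd> G\<lparr>carrier := normalizing V\<rparr>"
proof -
  have VG: "V \<subseteq> carrier G" using assms by (rule subgroup.subset)
  have sN: "subgroup (normalizing V) G" using subgroup_normalizing[OF VG] .
  interpret N: Group.group "G\<lparr>carrier := normalizing V\<rparr>" using subgroup_imp_group[OF sN] .
  have "x \<otimes> h \<otimes> inv x \<in> V" if "x \<in> normalizing V" "h \<in> V" for x h
  proof -
    have "inv x \<in> normalizing V" using subgroup.m_inv_closed[OF sN that(1)] .
    then have "conj_set (inv x) V = V" by (simp add: normalizing_def)
    moreover have "x \<otimes> h \<otimes> inv x \<in> conj_set (inv x) V"
      using that by (auto simp: conj_set_def normalizing_def)
    ultimately show ?thesis by simp
  qed
  then show ?thesis
    unfolding N.normal_inv_iff
    using subgroup_incl[OF assms sN subset_normalizing[OF assms]] by (auto simp: m_inv_consistent[OF sN])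
qed

text \<open>Orbit-stabilizer: sending the coset \<open>normalizing V #> g\<close> to
  \<open>conj_set g V\<close> is injective. A bound on the number of conjugates becomes a bound on
  an index.\<close>

lemma rcosets_normalizing:
  assumes "V \<subseteq> carrier G" "finite (conjugates G V)"
  shows "finite (rcosets (normalizing V))" "card (rcosets (normalizing V)) \<le> card (conjugates G V)"
proof -
  have sN: "subgroup (normalizing V) G" using subgroup_normalizing[OF assms(1)] .
  let ?r = "\<lambda>C. SOME g. g \<in> carrier G \<and> C = normalizing V #> g"
  have r: "?r C \<in> carrier G \<and> C = normalizing V #> ?r C" if "C \<in> rcosets (normalizing V)" for C
  proof -
    have "\<exists>g. g \<in> carrier G \<and> C = normalizing V #> g"
      using that by (auto simp: RCOSETS_def)
    then show ?thesis by (rule someI_ex)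
  qed
  have inj: "inj_on (\<lambda>C. conj_set (?r C) V) (rcosets (normalizing V))"
  proof (rule inj_onI)
    fix C D assume CD: "C \<in> rcosets (normalizing V)" "D \<in> rcosets (normalizing V)"
      and eq: "conj_set (?r C) V = conj_set (?r D) V"
    define g h where "g = ?r C" "h = ?r D"
    have gh: "g \<in> carrier G" "h \<in> carrier G" "C = normalizing V #> g" "D = normalizing V #> h"
      using r[OF CD(1)] r[OF CD(2)] by (auto simp: g_h_def)
    have "conj_set g V = conj_set h V"
      unfolding g_h_def by (rule eq)
    then have "conj_set (g \<otimes> inv h) V = conj_set (inv h) (conj_set h V)"
      using gh assms(1) by (simp flip: conj_set_mult)
    also have "\<dots> = V" using gh assms(1) by (simp add: conj_set_mult conj_set_one)
    finally have "g \<otimes> inv h \<in> normalizing V" using gh by (simp add: normalizing_def)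
    then have "g \<in> normalizing V #> h"
      using gh by (auto simp: r_coset_def m_assoc intro!: bexI[of _ "g \<otimes> inv h"])
    then show "C = D"
      using repr_independence[OF _ gh(2) sN] gh by simp
  qed
  have sub: "(\<lambda>C. conj_set (?r C) V) ` (rcosets (normalizing V)) \<subseteq> conjugates G V"
    using r unfolding conjugates_eq[OF assms(1)] by blast
  show "finite (rcosets (normalizing V))"
    using inj sub assms(2) by (rule inj_on_finite)
  show "card (rcosets (normalizing V)) \<le> card (conjugates G V)"
    using inj sub assms(2) by (rule card_inj_on_le)
qed

end

section \<open>Open subgroups of bounded index in finitely generated groups\<close>

context profinite
begin

text \<open>Each \<open>v\<close> in \<open>V\<close> contributes two closed conditions on
  \<open>g\<close>, one for conjugation by \<open>g\<close> and one for conjugation by its inverse;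
  together they force equality and not just inclusion.\<close>

lemma closed_subgroup_normalizing:
  assumes "closed_subgroup G T V"
  shows "closed_subgroup G T (normalizing V)"
proof -
  have V: "subgroup V G" "closedin T V" "V \<subseteq> carrier G"
    using assms closed_subgroup_subset by (auto simp: closed_subgroup_def)
  let ?A = "\<lambda>v. {g \<in> carrier G. inv g \<otimes> v \<otimes> g \<in> V} \<inter> {g \<in> carrier G. g \<otimes> v \<otimes> inv g \<in> V}"
  have "normalizing V = \<Inter>(?A ` V)"
  proof (intro equalityI subsetI)
    fix g assume g: "g \<in> normalizing V"
    then have g': "inv g \<in> normalizing V"
      using subgroup.m_inv_closed[OF subgroup_normalizing[OF V(3)]] by simp
    have *: "inv h \<otimes> v \<otimes> h \<in> V" if "h \<in> normalizing V" "v \<in> V" for h v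
      using that by (auto simp: normalizing_def conj_set_def)
    show "g \<in> \<Inter>(?A ` V)"
      using *[OF g] *[OF g'] g by (auto simp: normalizing_def)
  next
    fix g assume g: "g \<in> \<Inter>(?A ` V)"
    then have gA: "g \<in> ?A v" if "v \<in> V" for v using that by blast
    have gG: "g \<in> carrier G" using gA[OF subgroup.one_closed[OF V(1)]] by simp
    have "v \<in> conj_set g V" if "v \<in> V" for v
      unfolding conj_set_def
      using gA[OF that] gG that V(3)
      by (intro image_eqI[of _ _ "g \<otimes> v \<otimes> inv g"]) (auto simp: m_assoc subset_iff)
    moreover have "conj_set g V \<subseteq> V" using gA by (auto simp: conj_set_def)
    ultimately show "g \<in> normalizing V" using gG by (auto simp: normalizing_def)
  qed
  moreover have "closedin T (\<Inter>(?A ` V))"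
  proof (intro closedin_Inter)
    show "?A ` V \<noteq> {}" using subgroup.one_closed[OF V(1)] by blast
    show "closedin T S" if S: "S \<in> ?A ` V" for S
    proof -
      obtain v where v: "v \<in> V" "S = ?A v" using S by blast
      have "v \<in> carrier G" using v V by auto
      then show ?thesis
        unfolding v(2) using V(2)
        by (intro closedin_Int closedin_preimage_carrier continuous_intros) auto
    qed
  qed
  ultimately show ?thesis
    using subgroup_normalizing[OF V(3)] by (simp add: closed_subgroup_def)
qed

text \<open>Allows a property to be verified on topological generators: a subgroup containing an
  open normal subgroup is open, hence closed.\<close>

lemma closed_generate_eq_carrierD:
  assumes "closed_generate G T A = carrier G" "A \<subseteq> Z" "subgroup Z G" "open_normal G T N" "N \<subseteq> Z"
  shows "Z = carrier G"
proof -
  have "open_subgroup G T Z"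
    using open_subgroup_mono[OF open_normal_imp_open_subgroup] assms by simp
  then have "closed_generate G T A \<subseteq> Z"
    using assms(2) by (intro closed_generate_minimal open_imp_closed_subgroup)
  then show ?thesis using assms(1,3) subgroup.subset by blast
qed

text \<open>An open subgroup of index \<open>m\<close> is determined by the action of the generators on its cosets,
  transported to \<open>{..<m}\<close>, together with the number of the trivial coset.\<close>

lemma finite_open_subgroups_of_index:
  assumes "finitely_generated G T"
  shows "finite {H. open_subgroup G T H \<and> card (rcosets H) \<le> n}"
proof -
  obtain A where A: "finite A" "A \<subseteq> carrier G" "closed_generate G T A = carrier G"
    using assms unfolding finitely_generated_def generator_group_def by metis
  have "finite {H. open_subgroup G T H \<and> card (rcosets H) = m}" (is "finite ?\<H>") for m
  proof -
    have "\<forall>H\<in>?\<H>. \<exists>h. bij_betw h (rcosets H) {0..<m}"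
      using finite_rcosets ex_bij_betw_finite_nat by blast
    then obtain \<beta> where \<beta>: "\<And>H. H \<in> ?\<H> \<Longrightarrow> bij_betw (\<beta> H) (rcosets H) {0..<m}"
      by metis
    let ?\<beta>' = "\<lambda>H. inv_into (rcosets H) (\<beta> H)"
    define \<Phi> where "\<Phi> H = (\<beta> H H, restrict (\<lambda>(s, i). \<beta> H (?\<beta>' H i #> s)) (A \<times> {0..<m}))" for H
    have sH: "subgroup H G" "H \<in> rcosets H" if "H \<in> ?\<H>" for H
    proof -
      show s: "subgroup H G" using that by (simp add: open_subgroup_def)
      show "H \<in> rcosets H" using subgroup.subgroup_in_rcosets[OF s is_group] .
    qed
    have \<beta>'_in: "?\<beta>' H i \<in> rcosets H" if "H \<in> ?\<H>" "i < m" for H i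
      using inv_into_into[of i "\<beta> H" "rcosets H"] \<beta>[OF that(1)] that(2) by (simp add: bij_betw_def)
    have \<beta>_\<beta>': "\<beta> H (?\<beta>' H i) = i" if "H \<in> ?\<H>" "i < m" for H i
      using bij_betw_inv_into_right[OF \<beta>[OF that(1)]] that(2) by simp
    have \<beta>'_\<beta>: "?\<beta>' H (\<beta> H C) = C" if "H \<in> ?\<H>" "C \<in> rcosets H" for H C
      using bij_betw_inv_into_left[OF \<beta>[OF that(1)] that(2)] .
    have \<beta>_less: "\<beta> H C < m" if "H \<in> ?\<H>" "C \<in> rcosets H" for H C
      using bij_betw_apply[OF \<beta>[OF that(1)] that(2)] by simp
    have "\<Phi> ` ?\<H> \<subseteq> {0..<m} \<times> ((A \<times> {0..<m}) \<rightarrow>\<^sub>E {0..<m})"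
    proof (rule image_subsetI)
      fix H assume H: "H \<in> ?\<H>"
      have "\<beta> H (?\<beta>' H i #> s) < m" if "s \<in> A" "i < m" for s i
        using that A(2) by (intro \<beta>_less[OF H] rcosets_r_coset sH[OF H] \<beta>'_in[OF H]) auto
      then show "\<Phi> H \<in> {0..<m} \<times> ((A \<times> {0..<m}) \<rightarrow>\<^sub>E {0..<m})"
        using \<beta>_less[OF H sH(2)[OF H]] by (auto simp: \<Phi>_def)
    qed
    then have fin: "finite (\<Phi> ` ?\<H>)"
      using A(1) by (elim finite_subset) (intro finite_cartesian_product finite_PiE, auto)
    have "inj_on \<Phi> ?\<H>"
    proof (rule inj_onI)
      fix H K assume H: "H \<in> ?\<H>" and K: "K \<in> ?\<H>" and eq: "\<Phi> H = \<Phi> K"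
      \<comment> \<open>The coset of \<open>H\<close> with a given number goes to the coset of
        \<open>K\<close> with the same number. Equality of the codes makes this map commute with the
        generators and send \<open>H\<close> to \<open>K\<close>.\<close>
      define \<theta> where "\<theta> C = ?\<beta>' K (\<beta> H C)" for C
      have \<theta>_in: "\<theta> C \<in> rcosets K" if "C \<in> rcosets H" for C
        unfolding \<theta>_def using \<beta>'_in[OF K] \<beta>_less[OF H that] by blast
      have "\<beta> K K = \<beta> H H" using eq by (simp add: \<Phi>_def)
      then have \<theta>H: "\<theta> H = K" using \<beta>'_\<beta>[OF K sH(2)[OF K]] by (simp add: \<theta>_def)
      have \<theta>_inj: "C = D" if "C \<in> rcosets H" "D \<in> rcosets H" "\<theta> C = \<theta> D" for C D
      proof -
        have "\<beta> K (\<theta> C) = \<beta> K (\<theta> D)" using that by simp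
        then have "\<beta> H C = \<beta> H D"
          using \<beta>_\<beta>'[OF K \<beta>_less[OF H that(1)]] \<beta>_\<beta>'[OF K \<beta>_less[OF H that(2)]] by (simp add: \<theta>_def)
        then show ?thesis using \<beta>'_\<beta>[OF H] that by metis
      qed
      have gen: "\<theta> (C #> s) = \<theta> C #> s" if "s \<in> A" "C \<in> rcosets H" for s C
      proof -
        have sG: "s \<in> carrier G" using that A by auto
        have "snd (\<Phi> H) (s, \<beta> H C) = snd (\<Phi> K) (s, \<beta> H C)" using eq by simp
        then have "\<beta> H (?\<beta>' H (\<beta> H C) #> s) = \<beta> K (?\<beta>' K (\<beta> H C) #> s)"
          using that(1) \<beta>_less[OF H that(2)] by (simp add: \<Phi>_def)
        then have "\<beta> H (C #> s) = \<beta> K (\<theta> C #> s)"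
          using \<beta>'_\<beta>[OF H that(2)] by (simp add: \<theta>_def)
        then have "\<theta> (C #> s) = ?\<beta>' K (\<beta> K (\<theta> C #> s))" by (simp add: \<theta>_def)
        also have "\<dots> = \<theta> C #> s"
          using \<beta>'_\<beta>[OF K rcosets_r_coset[OF sH(1)[OF K] \<theta>_in[OF that(2)] sG]] .
        finally show ?thesis .
      qed
      \<comment> \<open>The elements whose action \<open>\<theta>\<close> respects. Besides the
        generators they include \<open>N1 \<inter> N2\<close>, which acts trivially on both coset
        spaces; so they are all of \<open>G\<close>, and the stabilizers \<open>H\<close> and
        \<open>K\<close> of the base cosets coincide.\<close>
      define Z where "Z = {x \<in> carrier G. \<forall>C\<in>rcosets H. \<theta> (C #> x) = \<theta> C #> x}"
      have rc: "C \<subseteq> carrier G" if "C \<in> rcosets H \<or> C \<in> rcosets K" for C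
        using that subgroup.rcosets_carrier[OF sH(1) is_group] H K by blast
      have sZ: "subgroup Z G"
      proof (rule subgroupI)
        show "Z \<subseteq> carrier G" by (auto simp: Z_def)
        have "\<one> \<in> Z" using rc \<theta>_in by (simp add: Z_def)
        then show "Z \<noteq> {}" by blast
        show "inv a \<in> Z" if a: "a \<in> Z" for a
        proof -
          have aG: "a \<in> carrier G" using a by (simp add: Z_def)
          have "\<theta> (C #> inv a) = \<theta> C #> inv a" if C: "C \<in> rcosets H" for C
          proof -
            have Ca: "C #> inv a \<in> rcosets H" using rcosets_r_coset[OF sH(1)[OF H] C] aG by simp
            have "\<theta> (C #> inv a) = (\<theta> (C #> inv a) #> a) #> inv a"
              using aG rc \<theta>_in[OF Ca] by (simp add: coset_mult_assoc)
            also have "\<theta> (C #> inv a) #> a = \<theta> ((C #> inv a) #> a)"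
              using a Ca by (simp add: Z_def)
            also have "(C #> inv a) #> a = C" using aG rc C by (simp add: coset_mult_assoc)
            finally show ?thesis .
          qed
          then show ?thesis using aG by (simp add: Z_def)
        qed
        show "a \<otimes> b \<in> Z" if a: "a \<in> Z" and b: "b \<in> Z" for a b
        proof -
          have G: "a \<in> carrier G" "b \<in> carrier G" using a b by (auto simp: Z_def)
          have "\<theta> (C #> (a \<otimes> b)) = \<theta> C #> (a \<otimes> b)" if C: "C \<in> rcosets H" for C
          proof -
            have "\<theta> (C #> (a \<otimes> b)) = \<theta> ((C #> a) #> b)" using G rc C by (simp add: coset_mult_assoc)
            also have "\<dots> = \<theta> (C #> a) #> b"
              using b rcosets_r_coset[OF sH(1)[OF H] C G(1)] by (simp add: Z_def)
            also have "\<dots> = (\<theta> C #> a) #> b" using a C by (simp add: Z_def)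
            also have "\<dots> = \<theta> C #> (a \<otimes> b)" using G rc \<theta>_in[OF C] by (simp add: coset_mult_assoc)
            finally show ?thesis .
          qed
          then show ?thesis using G by (simp add: Z_def)
        qed
      qed
      obtain N1 where N1: "open_normal G T N1" "N1 \<subseteq> H"
        using open_subgroup_contains_open_normal[of H] H by (metis (mono_tags, lifting) mem_Collect_eq)
      obtain N2 where N2: "open_normal G T N2" "N2 \<subseteq> K"
        using open_subgroup_contains_open_normal[of K] K by (metis (mono_tags, lifting) mem_Collect_eq)
      have nN: "N1 \<lhd> G" "N2 \<lhd> G" using N1 N2 by (auto simp: open_normal_def)
      have NZ: "N1 \<inter> N2 \<subseteq> Z"
      proof
        fix x assume x: "x \<in> N1 \<inter> N2"
        then have "x \<in> carrier G" using nN(1) normal_imp_subgroup subgroup.subset by blast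
        moreover have "\<theta> (C #> x) = \<theta> C #> x" if "C \<in> rcosets H" for C
          using rcosets_r_coset_normal[OF sH(1)[OF H] nN(1) N1(2) that, of x]
            rcosets_r_coset_normal[OF sH(1)[OF K] nN(2) N2(2) \<theta>_in[OF that], of x] x by simp
        ultimately show "x \<in> Z" by (simp add: Z_def)
      qed
      have "A \<subseteq> Z" using A(2) gen unfolding Z_def by blast
      then have "Z = carrier G"
        using closed_generate_eq_carrierD[OF A(3) _ sZ open_normal_Int[OF N1(1) N2(1)] NZ] by simp
      have "x \<in> H \<longleftrightarrow> x \<in> K" if x: "x \<in> carrier G" for x
      proof -
        have mem: "y \<in> L \<longleftrightarrow> L #> y = L" if "subgroup L G" "y \<in> carrier G" for y L
          using that rcos_self[OF that(2,1)] coset_join2[OF that(2,1)] by auto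
        have "x \<in> H \<longleftrightarrow> H #> x = H" using mem sH(1)[OF H] x by simp
        also have "\<dots> \<longleftrightarrow> \<theta> (H #> x) = \<theta> H"
          using \<theta>_inj[OF rcosets_r_coset[OF sH(1)[OF H] sH(2)[OF H] x] sH(2)[OF H]] by auto
        also have "\<theta> (H #> x) = K #> x"
          using \<open>Z = carrier G\<close> x sH(2)[OF H] \<theta>H by (auto simp: Z_def)
        also have "K #> x = \<theta> H \<longleftrightarrow> x \<in> K" using mem sH(1)[OF K] x \<theta>H by simp
        finally show ?thesis .
      qed
      then show "H = K"
        using subgroup.subset[OF sH(1)[OF H]] subgroup.subset[OF sH(1)[OF K]] by blast
    qed
    with fin show ?thesis by (rule finite_imageD)
  qed
  then have "finite (\<Union>m\<le>n. {H. open_subgroup G T H \<and> card (rcosets H) = m})" by simp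
  then show ?thesis by (rule rev_finite_subset) auto
qed

text \<open>Only finitely many open normal subgroups have index at most \<open>n\<close>, so their
  intersection is again open; an open normal \<open>U\<close> contains the intersection for
  \<open>n\<close> its own index.\<close>

lemma finitely_generated_base:
  assumes "finitely_generated G T"
  obtains Q :: "nat \<Rightarrow> 'a set" where "decseq Q" "\<And>n. open_normal G T (Q n)"
    "\<And>U. open_normal G T U \<Longrightarrow> \<exists>n. Q n \<subseteq> U"
proof
  \<comment> \<open>For \<open>n = 0\<close> no subgroup qualifies; \<open>carrier G\<close> keeps
    the intersection from being \<open>UNIV\<close>.\<close>
  define Q where "Q n = \<Inter>(insert (carrier G) {N. open_normal G T N \<and> card (rcosets N) \<le> n})" for n :: nat
  show "decseq Q" unfolding decseq_def Q_def by (intro allI impI Inter_anti_mono) auto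
  show "open_normal G T (Q n)" for n
  proof -
    have "finite {N. open_normal G T N \<and> card (rcosets N) \<le> n}"
      using finite_open_subgroups_of_index[OF assms, of n]
      by (rule rev_finite_subset) (auto simp: open_normal_imp_open_subgroup)
    then show ?thesis
      unfolding Q_def by (intro open_normal_Inter) (auto simp: open_normal_carrier)
  qed
  show "\<exists>n. Q n \<subseteq> U" if "open_normal G T U" for U
    using that unfolding Q_def by (intro exI[of _ "card (rcosets U)"]) blast
qed

section \<open>Passage to open subgroups and confinement of commuting conjugates\<close>

lemma hereditarily_JNNF_imp_JNNF:
  assumes "hereditarily_JNNF c G T"
  shows "JNNF c G T"
proof -
  have "open_subgroup G T (carrier G)"
    using open_normal_imp_open_subgroup[OF open_normal_carrier] .
  then have "JNNF c (G\<lparr>carrier := carrier G\<rparr>) (subtopology T (carrier G))"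
    using assms unfolding hereditarily_JNNF_def by (elim allE impE)
  moreover have "subtopology T (carrier G) = T" using subtopology_topspace[of T] by simp
  ultimately show ?thesis by simp
qed

text \<open>A non-trivial abelian closed normal subgroup of \<open>H\<close> would contain
  \<open>\<gamma>(R)\<close> for an open \<open>R\<close>. With an open normal \<open>N\<close> of
  \<open>G\<close> inside \<open>R\<close>, the group \<open>\<gamma>(N)\<close> would be abelian
  and normal in all of \<open>G\<close>, hence trivial, against JNN_cF.\<close>

lemma Fitting_free_open_subgroup:
  assumes FF: "Fitting_free G T" and her: "hereditarily_JNNF c G T" and H: "open_subgroup G T H"
  shows "Fitting_free (G\<lparr>carrier := H\<rparr>) (subtopology T H)"
  unfolding Fitting_free_def
proof (intro allI impI, elim conjE, rule ccontr)
  let ?H = "G\<lparr>carrier := H\<rparr>" and ?S = "subtopology T H"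
  have cH: "closed_subgroup G T H" using open_imp_closed_subgroup[OF H] .
  interpret H: profinite ?H ?S using profinite_subgroup[OF cH] .
  fix A assume A: "closed_normal ?H ?S A" and comm: "comm_group (?H\<lparr>carrier := A\<rparr>)"
    and "A \<noteq> {\<one>\<^bsub>?H\<^esub>}"
  moreover have "JNNF c ?H ?S" using her H by (simp add: hereditarily_JNNF_def)
  ultimately obtain R where R: "open_normal ?H ?S R" "lower_central ?H ?S (c + 1) R \<subseteq> A"
    using H.JNNF_iff by metis
  have oR: "open_subgroup G T R" "R \<subseteq> H"
    using H.open_normal_imp_open_subgroup[OF R(1)] open_subgroup_subgroup_iff[OF H] by auto
  obtain N where N: "open_normal G T N" "N \<subseteq> R"
    using open_subgroup_contains_open_normal[OF oR(1)] by metis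
  let ?g = "lower_central G T (c + 1)"
  have gA: "?g N \<subseteq> A"
    using lower_central_mono[OF N(2), of "c + 1"] R(2) lower_central_subgroup[OF cH oR(2), of "c + 1"] by simp
  have "?g N = {\<one>}"
  proof (rule Fitting_freeD[OF FF])
    show "closed_normal G T (?g N)"
      using N(1) by (intro closed_normal_lower_central open_normal_imp_closed_normal)
    show "x \<otimes> y = y \<otimes> x" if "x \<in> ?g N" "y \<in> ?g N" for x y
    proof -
      interpret A: comm_group "?H\<lparr>carrier := A\<rparr>" by (rule comm)
      show ?thesis using A.m_comm[of x y] that gA by auto
    qed
  qed
  then show False
    using hereditarily_JNNF_imp_JNNF[OF her] N(1) unfolding JNNF_iff by blast
qed

text \<open>Obliquity inside \<open>H\<close>, where \<open>V\<close> is normal although it need not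
  be so in \<open>G\<close>. The threshold found in \<open>H\<close> is replaced by an open normal
  subgroup of \<open>G\<close>, so that thresholds for different \<open>H\<close> can be
  intersected.\<close>

lemma obliquity_open_subgroup:
  assumes FF: "Fitting_free G T" and her: "hereditarily_JNNF c G T" and H: "open_subgroup G T H"
    and Q: "decseq Q" "\<And>n. open_normal G T (Q n)" "\<And>U. open_normal G T U \<Longrightarrow> \<exists>n::nat. Q n \<subseteq> U"
    and P: "open_normal G T P"
  shows "\<exists>R. open_normal G T R \<and> (\<forall>V. closed_subgroup G T V \<and> V \<lhd> G\<lparr>carrier := H\<rparr> \<longrightarrow>
    V \<subseteq> P \<or> lower_central G T (c + 1) R \<subseteq> lower_central G T (c + 1) V)"
proof -
  let ?H = "G\<lparr>carrier := H\<rparr>" and ?S = "subtopology T H"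
  have cH: "closed_subgroup G T H" using open_imp_closed_subgroup[OF H] .
  have sH: "subgroup H G" "openin T H" "closedin T H"
    using H cH by (auto simp: open_subgroup_def closed_subgroup_def)
  interpret H: profinite ?H ?S using profinite_subgroup[OF cH] .
  have JH: "JNNF c ?H ?S" using her H by (simp add: hereditarily_JNNF_def)
  have onH: "open_normal ?H ?S (U \<inter> H)" if "open_normal G T U" for U
    using that normal_Int_subgroup[OF sH(1), of U]
    by (auto simp: open_normal_def openin_subtopology)
  have "\<exists>n. \<forall>N. closed_normal ?H ?S N \<longrightarrow>
    N \<subseteq> P \<inter> H \<or> lower_central ?H ?S (c + 1) (Q n \<inter> H) \<subseteq> lower_central ?H ?S (c + 1) N"
  proof (rule H.obliquity[OF Fitting_free_open_subgroup[OF FF her H] JH])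
    show "decseq (\<lambda>n. Q n \<inter> H)" using Q(1) by (auto simp: decseq_def)
    show "open_normal ?H ?S (Q n \<inter> H)" for n using onH Q(2) by simp
    show "open_normal ?H ?S (P \<inter> H)" using onH P by simp
    show "\<exists>n. Q n \<inter> H \<subseteq> U" if "open_normal ?H ?S U" for U
    proof -
      have "open_subgroup G T U"
        using H.open_normal_imp_open_subgroup[OF that] open_subgroup_subgroup_iff[OF H] by simp
      then obtain N where "open_normal G T N" "N \<subseteq> U"
        using open_subgroup_contains_open_normal by metis
      then show ?thesis using Q(3) by (meson inf.coboundedI1 subset_trans)
    qed
  qed
  then obtain n where n: "\<And>N. closed_normal ?H ?S N \<Longrightarrow>
    N \<subseteq> P \<inter> H \<or> lower_central ?H ?S (c + 1) (Q n \<inter> H) \<subseteq> lower_central ?H ?S (c + 1) N"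
    by metis
  have "open_subgroup G T (Q n \<inter> H)"
    using H.open_normal_imp_open_subgroup[OF onH[OF Q(2)]] open_subgroup_subgroup_iff[OF H] by simp
  then obtain R where R: "open_normal G T R" "R \<subseteq> Q n \<inter> H"
    using open_subgroup_contains_open_normal by metis
  have "V \<subseteq> P \<or> lower_central G T (c + 1) R \<subseteq> lower_central G T (c + 1) V"
    if V: "closed_subgroup G T V" "V \<lhd> ?H" for V
  proof -
    have VH: "V \<subseteq> H" using subgroup.subset[OF normal_imp_subgroup[OF V(2)]] by simp
    have "closed_normal ?H ?S V"
      using V VH sH by (simp add: closed_normal_def closed_subgroup_def closedin_subtopology_closed)
    from n[OF this] have "V \<subseteq> P \<or> lower_central G T (c + 1) (Q n \<inter> H) \<subseteq> lower_central G T (c + 1) V"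
      using lower_central_subgroup[OF cH VH] lower_central_subgroup[OF cH, of "Q n \<inter> H"] by auto
    then show ?thesis using lower_central_mono[OF R(2)] by blast
  qed
  then show ?thesis using R(1) by blast
qed

text \<open>Conjugates have to commute only modulo \<open>K\<close>: in the application
  \<open>K\<close> is the kernel of a projection, and subgroups of the quotient are replaced by
  their preimages. \<open>Z\<close> expresses how small \<open>K\<close> must be, and
  \<open>P\<close> confines \<open>V\<close>.\<close>

definition commuting_conjugates_within :: "nat \<Rightarrow> 'a set \<Rightarrow> 'a set \<Rightarrow> bool" where
  "commuting_conjugates_within n Z P \<longleftrightarrow> (\<forall>K. closed_subgroup G T K \<and> \<not> Z \<subseteq> K \<longrightarrow>
     (\<forall>V. closed_subgroup G T V \<and> \<not> V \<lhd> G \<and> finite (conjugates G V) \<and> card (conjugates G V) \<le> n \<and>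
     (\<forall>g x y. g \<in> carrier G \<and> conj_set g V \<noteq> V \<and> x \<in> V \<and> y \<in> conj_set g V \<longrightarrow>
        commutator G x y \<in> K) \<longrightarrow> V \<subseteq> P))"

lemma commuting_conjugates_within_mono:
  assumes "commuting_conjugates_within n Z P" "Z' \<subseteq> Z"
  shows "commuting_conjugates_within n Z' P"
  unfolding commuting_conjugates_within_def
proof (rule all_forward[OF assms(1)[unfolded commuting_conjugates_within_def]], erule imp_forward)
  show "closed_subgroup G T K \<and> \<not> Z \<subseteq> K" if "closed_subgroup G T K \<and> \<not> Z' \<subseteq> K" for K
    using that assms(2) by blast
qed

text \<open>\<open>V\<close> is normal in its normalizer, an open subgroup of index at most
  \<open>n\<close>; there are finitely many of these, so one \<open>R\<close> serves all. If
  \<open>V\<close> is not inside \<open>P\<close>, obliquity there puts \<open>\<gamma>(R)\<close>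
  into \<open>V\<close> and, as it is normal in \<open>G\<close>, into every conjugate of
  \<open>V\<close>. Commuting modulo \<open>K\<close> then forces
  \<open>[\<gamma>(R), \<gamma>(R)] \<le> K\<close>, which the choice of \<open>Z\<close> as this
  commutator subgroup excludes.\<close>

lemma commuting_conjugates_bound:
  assumes FF: "Fitting_free G T" and her: "hereditarily_JNNF c G T" and fg: "finitely_generated G T"
    and P: "open_normal G T P"
  shows "\<exists>Z. closed_normal G T Z \<and> Z \<noteq> {\<one>} \<and> commuting_conjugates_within n Z P"
proof -
  let ?g = "lower_central G T (c + 1)"
  obtain Q :: "nat \<Rightarrow> 'a set" where Q: "decseq Q" "\<And>n. open_normal G T (Q n)"
    "\<And>U. open_normal G T U \<Longrightarrow> \<exists>n. Q n \<subseteq> U"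
    using finitely_generated_base[OF fg] by metis
  let ?\<H> = "{H. open_subgroup G T H \<and> card (rcosets H) \<le> n}"
  have "\<forall>H\<in>?\<H>. \<exists>R. open_normal G T R \<and> (\<forall>V. closed_subgroup G T V \<and> V \<lhd> G\<lparr>carrier := H\<rparr> \<longrightarrow>
    V \<subseteq> P \<or> ?g R \<subseteq> ?g V)"
    using obliquity_open_subgroup[OF FF her _ Q P] by simp
  then obtain r where r': "\<forall>H\<in>?\<H>. open_normal G T (r H) \<and> (\<forall>V. closed_subgroup G T V \<and>
      V \<lhd> G\<lparr>carrier := H\<rparr> \<longrightarrow> V \<subseteq> P \<or> ?g (r H) \<subseteq> ?g V)"
    by (elim bchoice[THEN exE])
  have r: "open_normal G T (r H)" if "H \<in> ?\<H>" for H
    using bspec[OF r' that] by (rule conjunct1)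
  have r2: "V \<subseteq> P \<or> ?g (r H) \<subseteq> ?g V"
    if "H \<in> ?\<H>" "closed_subgroup G T V" "V \<lhd> G\<lparr>carrier := H\<rparr>" for H V
    using bspec[OF r' that(1)] that(2,3) by (elim conjE allE[of _ V] impE) simp_all
  define R where "R = \<Inter>(insert (carrier G) (r ` ?\<H>))"
  have R: "open_normal G T R"
    unfolding R_def using r finite_open_subgroups_of_index[OF fg, of n]
    by (intro open_normal_Inter) (auto simp: open_normal_carrier)
  have gR: "closed_normal G T (?g R)" "?g R \<noteq> {\<one>}"
    using closed_normal_lower_central[OF open_normal_imp_closed_normal[OF R]]
      R hereditarily_JNNF_imp_JNNF[OF her] unfolding JNNF_iff by simp_all
  define Z where "Z = commutator_subgroup G T (?g R) (?g R)"
  show ?thesis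
    unfolding commuting_conjugates_within_def
  proof (intro exI[of _ Z] conjI allI impI; (elim conjE)?)
    show "closed_normal G T Z"
      unfolding Z_def using gR by (intro closed_normal_commutator_subgroup)
    show "Z \<noteq> {\<one>}"
      unfolding Z_def using commutator_subgroup_neq_one[OF FF gR] .
    fix K V assume K: "closed_subgroup G T K" "\<not> Z \<subseteq> K" and V: "closed_subgroup G T V" "\<not> V \<lhd> G"
      and fin: "finite (conjugates G V)" and card: "card (conjugates G V) \<le> n"
      and comm: "\<forall>g x y. g \<in> carrier G \<and> conj_set g V \<noteq> V \<and> x \<in> V \<and> y \<in> conj_set g V \<longrightarrow> commutator G x y \<in> K"
    have sV: "subgroup V G" "V \<subseteq> carrier G" using V closed_subgroup_subset by (auto simp: closed_subgroup_def)
    let ?N = "normalizing V"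
    have "open_subgroup G T ?N"
      using open_subgroup_if_finite_rcosets[OF closed_subgroup_normalizing[OF V(1)]] rcosets_normalizing(1)[OF sV(2) fin] .
    then have N: "?N \<in> ?\<H>"
      using rcosets_normalizing(2)[OF sV(2) fin] card by simp
    show "V \<subseteq> P"
    proof (rule ccontr)
      assume "\<not> V \<subseteq> P"
      then have "?g (r ?N) \<subseteq> ?g V"
        using r2[OF N V(1) normal_in_normalizing[OF sV(1)]] by simp
      moreover have "?g R \<subseteq> ?g (r ?N)"
        using N unfolding R_def by (intro lower_central_mono) blast
      ultimately have gV: "?g R \<subseteq> V"
        using lower_central_subset[OF V(1)] by blast
      obtain g where g: "g \<in> carrier G" "conj_set g V \<noteq> V"
        using V(2) sV(1) normal_iff_conj_set by blast
      have "conj_set g (?g R) = ?g R"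
        using gR(1) g(1) by (intro conj_set_normal) (simp add: closed_normal_def)
      then have gV': "?g R \<subseteq> conj_set g V"
        using conj_set_mono[OF gV, of g] by simp
      have "Z \<subseteq> K"
        unfolding Z_def using gV gV' comm g
        by (intro commutator_subgroup_minimal[OF K(1)]) blast
      then show False using K(2) by simp
    qed
  qed
qed

end

section \<open>Inverse limits\<close>

text \<open>An inverse limit seen from \<open>G\<close>: compatible epimorphisms whose kernels
  intersect trivially. Both directions of the theorem pass through this form, and the concrete limit
  group occurs only in the translations.\<close>

locale profinite_tower = profinite G T
  for G :: "('a, 'k) monoid_scheme" (structure) and T +
  fixes Gs :: "nat \<Rightarrow> ('b, 'm) monoid_scheme" and Ts \<rho> and \<pi> :: "nat \<Rightarrow> 'a \<Rightarrow> 'b"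
  assumes epi: "\<And>n. profinite_epi G T (Gs n) (Ts n) (\<pi> n)"
    and compat: "\<And>n x. x \<in> carrier G \<Longrightarrow> \<rho> n (\<pi> (Suc n) x) = \<pi> n x"
    and Inter_kernel: "(\<Inter>n. kernel G (Gs n) (\<pi> n)) = {\<one>}"
begin

sublocale epi: profinite_epi G T "Gs n" "Ts n" "\<pi> n" for n
  by (rule epi)

abbreviation K :: "nat \<Rightarrow> 'a set" where
  "K n \<equiv> kernel G (Gs n) (\<pi> n)"

lemma decseq_kernel: "decseq K"
proof (rule decseq_SucI)
  fix n
  have one: "\<rho> n \<one>\<^bsub>Gs (Suc n)\<^esub> = \<one>\<^bsub>Gs n\<^esub>"
    using compat[of \<one> n] by simp
  show "K (Suc n) \<subseteq> K n"
  proof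
    fix x assume "x \<in> K (Suc n)"
    then have "x \<in> carrier G" "\<pi> (Suc n) x = \<one>\<^bsub>Gs (Suc n)\<^esub>" by (auto simp: kernel_def)
    with one compat[of x n] show "x \<in> K n" by (simp add: kernel_def)
  qed
qed

lemma closedin_kernel: "closedin T (K n)"
  using epi.closed_normal_kernel by (simp add: closed_normal_def)

end

lemma product_group_simps:
  "x \<otimes>\<^bsub>product_group UNIV Gs\<^esub> y = (\<lambda>i. x i \<otimes>\<^bsub>Gs i\<^esub> y i)"
  "\<one>\<^bsub>product_group UNIV Gs\<^esub> = (\<lambda>i. \<one>\<^bsub>Gs i\<^esub>)"
  "carrier (product_group UNIV Gs) = {x. \<forall>i. x i \<in> carrier (Gs i)}"
  by (auto simp: product_group_def)

lemma limit_group_simps: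
  "x \<otimes>\<^bsub>limit_group Gs \<rho>\<^esub> y = (\<lambda>i. x i \<otimes>\<^bsub>Gs i\<^esub> y i)"
  "\<one>\<^bsub>limit_group Gs \<rho>\<^esub> = (\<lambda>i. \<one>\<^bsub>Gs i\<^esub>)"
  "carrier (limit_group Gs \<rho>) = {x. \<forall>i. x i \<in> carrier (Gs i) \<and> \<rho> i (x (Suc i)) = x i}"
  by (auto simp: limit_group_def limit_carrier_def product_group_simps)

text \<open>A point of \<open>G\<^sub>n\<close> is lifted upwards along the surjections and pushed downwards along the maps.\<close>

lemma limit_projection_surj:
  assumes "inverse_system Gs Ts \<rho>" "y \<in> carrier (Gs n)"
  shows "\<exists>x\<in>carrier (limit_group Gs \<rho>). x n = y"
proof -
  have epi: "\<rho> m \<in> hom (Gs (Suc m)) (Gs m)" "\<rho> m ` carrier (Gs (Suc m)) = carrier (Gs m)" for m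
    using assms(1) by (auto simp: inverse_system_def epi_def)
  \<comment> \<open>The clause for \<open>k = 0\<close> fixes the start of the chosen sequence at
    \<open>y\<close>.\<close>
  have "\<exists>u. \<forall>k. (u k \<in> carrier (Gs (n + k)) \<and> (k = 0 \<longrightarrow> u k = y)) \<and> \<rho> (n + k) (u (Suc k)) = u k"
  proof (rule dependent_nat_choice)
    show "\<exists>x. x \<in> carrier (Gs (n + 0)) \<and> (0 = (0::nat) \<longrightarrow> x = y)" using assms(2) by auto
    fix x and k :: nat assume "x \<in> carrier (Gs (n + k)) \<and> (k = 0 \<longrightarrow> x = y)"
    then have "x \<in> \<rho> (n + k) ` carrier (Gs (Suc (n + k)))" using epi(2) by simp
    then show "\<exists>z. (z \<in> carrier (Gs (n + Suc k)) \<and> (Suc k = 0 \<longrightarrow> z = y)) \<and> \<rho> (n + k) z = x"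
      by auto
  qed
  then obtain u where u: "\<And>k. u k \<in> carrier (Gs (n + k))" "u 0 = y" "\<And>k. \<rho> (n + k) (u (Suc k)) = u k"
    by metis
  \<comment> \<open>Because subtraction is truncated, \<open>w j\<close> is a point of
    \<open>G_{n-j}\<close> only for \<open>j \<le> n\<close>; no other values enter
    \<open>x\<close>.\<close>
  define w where "w = rec_nat y (\<lambda>j z. \<rho> (n - Suc j) z)"
  have w: "w 0 = y" "w (Suc j) = \<rho> (n - Suc j) (w j)" for j
    by (simp_all add: w_def)
  have w_in: "w j \<in> carrier (Gs (n - j))" if "j \<le> n" for j
    using that
  proof (induction j)
    case (Suc j)
    have "w j \<in> carrier (Gs (Suc (n - Suc j)))"
      using Suc by (simp add: Suc_diff_Suc)
    then show ?case
      using hom_in_carrier[OF epi(1)] by (simp add: w(2))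
  qed (simp add: w assms(2))
  define x where "x m = (if n \<le> m then u (m - n) else w (n - m))" for m
  have "x m \<in> carrier (Gs m)" for m
    using u(1)[of "m - n"] w_in[of "n - m"] by (cases "n \<le> m") (auto simp: x_def)
  moreover have "\<rho> m (x (Suc m)) = x m" for m
  proof (cases "n \<le> m")
    case True
    then show ?thesis using u(3)[of "m - n"] by (simp add: x_def Suc_diff_le)
  next
    case False
    then have "x (Suc m) = w (n - Suc m)"
      by (auto simp: x_def u(2) w(1) not_le less_Suc_eq_le Suc_le_eq)
    moreover have "n - m = Suc (n - Suc m)" "n - Suc (n - Suc m) = m" using False by auto
    ultimately show ?thesis using False w(2)[of "n - Suc m"] by (simp add: x_def)
  qed
  ultimately show ?thesis
    using u(2) by (intro bexI[of _ x]) (auto simp: limit_group_simps x_def)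
qed

text \<open>The projections are the coordinates of the given isomorphism; its injectivity becomes
  the trivial intersection of the kernels.\<close>

lemma (in profinite) inverse_limit_imp_tower:
  assumes "inverse_system Gs Ts \<rho>" "is_inverse_limit G T Gs Ts \<rho>"
  shows "\<exists>\<pi>. profinite_tower G T Gs Ts \<rho> \<pi>"
proof -
  obtain \<phi> where \<phi>: "\<phi> \<in> iso G (limit_group Gs \<rho>)" "homeomorphic_map T (limit_topology Gs Ts \<rho>) \<phi>"
    using assms(2) unfolding is_inverse_limit_def by metis
  have im: "\<phi> ` carrier G = carrier (limit_group Gs \<rho>)" and inj: "inj_on \<phi> (carrier G)"
    and hm: "\<phi> \<in> hom G (limit_group Gs \<rho>)"
    using \<phi>(1) by (auto simp: iso_def bij_betw_def)
  have pg: "profinite (Gs n) (Ts n)" for n using assms(1) by (simp add: inverse_system_def profinite_iff)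
  define \<pi> where "\<pi> n x = \<phi> x n" for n x
  have in_lim: "\<phi> x \<in> carrier (limit_group Gs \<rho>)" if "x \<in> carrier G" for x
    using im that by blast
  have h: "\<pi> n \<in> hom G (Gs n)" for n
    using in_lim hom_mult[OF hm] by (auto simp: hom_def \<pi>_def limit_group_simps)
  have cont: "continuous_map T (Ts n) (\<pi> n)" for n
  proof -
    have "continuous_map T (limit_topology Gs Ts \<rho>) \<phi>"
      using \<phi>(2) homeomorphic_imp_continuous_map by blast
    then have "continuous_map T (product_topology Ts UNIV) \<phi>"
      by (simp add: limit_topology_def continuous_map_in_subtopology)
    then show ?thesis
      unfolding \<pi>_def by (rule continuous_map_componentwise_UNIV[THEN iffD1, rule_format])
  qed
  have s: "\<pi> n ` carrier G = carrier (Gs n)" for n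
  proof
    show "\<pi> n ` carrier G \<subseteq> carrier (Gs n)"
      using in_lim by (auto simp: \<pi>_def limit_group_simps)
    show "carrier (Gs n) \<subseteq> \<pi> n ` carrier G"
    proof
      fix y assume "y \<in> carrier (Gs n)"
      then obtain x where x: "x \<in> carrier (limit_group Gs \<rho>)" "x n = y"
        using limit_projection_surj[OF assms(1)] by metis
      then obtain z where "z \<in> carrier G" "x = \<phi> z" using im by blast
      then show "y \<in> \<pi> n ` carrier G" using x(2) by (auto simp: \<pi>_def)
    qed
  qed
  have e: "profinite_epi G T (Gs n) (Ts n) (\<pi> n)" for n
    using profinite_axioms pg h cont s
    by (simp add: profinite_epi_def profinite_epi_axioms_def profinite_hom_def profinite_hom_axioms_def)
  interpret L: group_hom G "Gs n" "\<pi> n" for n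
    using e[of n] by (simp add: profinite_epi_def profinite_hom.axioms group_hom_def group_hom_axioms_def
        is_group h pg[unfolded profinite_def])
  have one: "\<phi> \<one> = (\<lambda>n. \<one>\<^bsub>Gs n\<^esub>)"
    using L.hom_one by (auto simp: \<pi>_def)
  have "x = \<one>" if "x \<in> (\<Inter>n. kernel G (Gs n) (\<pi> n))" for x
  proof -
    have "x \<in> carrier G" "\<phi> x = \<phi> \<one>"
      using that by (auto simp: kernel_def \<pi>_def one)
    then show ?thesis using inj by (simp add: inj_on_eq_iff)
  qed
  moreover have "\<one> \<in> (\<Inter>n. kernel G (Gs n) (\<pi> n))"
    using L.hom_one by (simp add: kernel_def)
  ultimately have "(\<Inter>n. kernel G (Gs n) (\<pi> n)) = {\<one>}" by blast
  then have "profinite_tower G T Gs Ts \<rho> \<pi>"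
    using e profinite_axioms in_lim
    by (simp add: profinite_tower_def profinite_tower_axioms_def) (auto simp: \<pi>_def limit_group_simps)
  then show ?thesis by blast
qed

context profinite_tower
begin

text \<open>A coherent sequence has a preimage because its fibres under the \<open>\<pi> n\<close>
  are nested, closed and non-empty in a compact space. A continuous bijection from compact to
  Hausdorff is a homeomorphism.\<close>

lemma is_inverse_limit:
  assumes sys: "inverse_system Gs Ts \<rho>"
  shows "is_inverse_limit G T Gs Ts \<rho>"
proof -
  define \<phi> where "\<phi> x = (\<lambda>n. \<pi> n x)" for x
  have h: "\<phi> \<in> hom G (limit_group Gs \<rho>)"
    by (auto simp: hom_def \<phi>_def limit_group_simps compat)
  have inj: "inj_on \<phi> (carrier G)"
  proof (rule inj_onI)
    fix x y assume xy: "x \<in> carrier G" "y \<in> carrier G" "\<phi> x = \<phi> y"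
    have "x \<otimes> inv y \<in> K n" for n
    proof -
      have "\<pi> n x = \<pi> n y" using fun_cong[OF xy(3), of n] by (simp add: \<phi>_def)
      then show ?thesis using xy(1,2) by (simp add: kernel_def)
    qed
    then have "x \<otimes> inv y = \<one>" using Inter_kernel by blast
    then show "x = y" using xy by (metis inv_closed inv_equality inv_inv)
  qed
  have surj: "\<phi> ` carrier G = carrier (limit_group Gs \<rho>)"
  proof
    show "\<phi> ` carrier G \<subseteq> carrier (limit_group Gs \<rho>)"
      using h by (rule hom_carrier)
    show "carrier (limit_group Gs \<rho>) \<subseteq> \<phi> ` carrier G"
    proof
      fix y assume y: "y \<in> carrier (limit_group Gs \<rho>)"
      then have y': "y n \<in> carrier (Gs n)" "\<rho> n (y (Suc n)) = y n" for n
        by (auto simp: limit_group_simps)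
      let ?C = "\<lambda>n. {x \<in> carrier G. \<pi> n x \<in> {y n}}"
      have "(\<Inter>n. ?C n) \<noteq> {}"
      proof (rule compact_space_imp_nest[OF compact])
        show "closedin T (?C n)" for n
          using y'(1) epi.H.Hausdorff by (intro epi.closedin_preimage closedin_Hausdorff_singleton) auto
        show "?C n \<noteq> {}" for n
          using epi.surj[of n] y'(1)[of n] by (auto simp: image_iff set_eq_iff) metis
        show "decseq ?C"
        proof (rule decseq_SucI)
          fix n
          show "?C (Suc n) \<subseteq> ?C n"
          proof
            fix x assume "x \<in> ?C (Suc n)"
            then show "x \<in> ?C n" using compat[of x n] y'(2)[of n] by auto
          qed
        qed
      qed
      then obtain x where "\<And>n. x \<in> ?C n" by blast
      then have "x \<in> carrier G" "y = \<phi> x" by (auto simp: \<phi>_def)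
      then show "y \<in> \<phi> ` carrier G" by blast
    qed
  qed
  have lc: "carrier (limit_group Gs \<rho>) = limit_carrier Gs \<rho>"
    by (simp add: limit_group_def)
  have ts: "topspace (limit_topology Gs Ts \<rho>) = limit_carrier Gs \<rho>"
    by (auto simp: limit_topology_def limit_carrier_def product_group_simps)
  have "homeomorphic_map T (limit_topology Gs Ts \<rho>) \<phi>"
  proof (rule continuous_imp_homeomorphic_map[OF _ compact])
    show "Hausdorff_space (limit_topology Gs Ts \<rho>)"
      unfolding limit_topology_def
      using epi.H.Hausdorff by (intro Hausdorff_space_subtopology) (simp add: Hausdorff_space_product_topology)
    have "continuous_map T (product_topology Ts UNIV) \<phi>"
      unfolding \<phi>_def using epi.cont by (simp add: continuous_map_componentwise_UNIV)
    then show "continuous_map T (limit_topology Gs Ts \<rho>) \<phi>"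
      using surj lc by (auto simp: limit_topology_def continuous_map_in_subtopology)
    show "\<phi> ` topspace T = topspace (limit_topology Gs Ts \<rho>)"
      using surj lc ts by simp
    show "inj_on \<phi> (topspace T)" using inj by simp
  qed
  moreover have "\<phi> \<in> iso G (limit_group Gs \<rho>)"
    using h inj surj by (simp add: iso_def bij_betw_def)
  ultimately show ?thesis unfolding is_inverse_limit_def by blast
qed

end

section \<open>Towers of virtually nilpotent groups\<close>

context profinite
begin

lemma closed_normal_closure:
  assumes "A \<subseteq> carrier G"
  shows "closed_normal G T (closed_normal_closure G T A)" "A \<subseteq> closed_normal_closure G T A"
proof -
  show "closed_normal G T (closed_normal_closure G T A)"
    unfolding closed_normal_closure_def hull_def
    using closed_normal_carrier assms by (intro closed_normal_Inter) auto
  show "A \<subseteq> closed_normal_closure G T A"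
    unfolding closed_normal_closure_def by (rule hull_subset)
qed

lemma closed_normal_closure_minimal:
  "A \<subseteq> N \<Longrightarrow> closed_normal G T N \<Longrightarrow> closed_normal_closure G T A \<subseteq> N"
  unfolding closed_normal_closure_def by (rule hull_minimal)

end

locale nilpotent_tower = profinite_tower G T Gs Ts \<rho> \<pi>
  for G :: "('a, 'k) monoid_scheme" (structure) and T and Gs :: "nat \<Rightarrow> ('b, 'm) monoid_scheme"
    and Ts \<rho> \<pi> +
  fixes P and c :: nat
  assumes open_normal_P: "\<And>n. open_normal (Gs n) (Ts n) (P n)"
    and tower: "tower_conditions c Gs Ts \<rho> P"
    and Fitting_free: "Fitting_free G T"
begin

lemma kernel_antimono: "m \<le> n \<Longrightarrow> K n \<subseteq> K m"
  using decseqD[OF decseq_kernel, of m n] .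

text \<open>Preimages in \<open>G\<close> allow conditions on different \<open>G_n\<close> to be
  compared in one group, modulo the kernels \<open>K n\<close>.\<close>

definition P' :: "nat \<Rightarrow> 'a set" where
  "P' n = {x \<in> carrier G. \<pi> n x \<in> P n}"

abbreviation \<gamma> :: "'a set \<Rightarrow> 'a set" where
  "\<gamma> X \<equiv> lower_central G T (c + 1) X"

abbreviation \<gamma>s :: "nat \<Rightarrow> 'b set \<Rightarrow> 'b set" where
  "\<gamma>s n X \<equiv> lower_central (Gs n) (Ts n) (c + 1) X"

lemma P'_carrier: "P' n \<subseteq> carrier G"
  by (auto simp: P'_def)

lemma open_normal_P': "open_normal G T (P' n)"
  unfolding P'_def by (intro epi.open_normal_preimage open_normal_P)

lemma P_carrier: "P n \<subseteq> carrier (Gs n)"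
  using epi.H.closed_normal_subset[OF epi.H.open_normal_imp_closed_normal[OF open_normal_P]] .

lemma image_P': "\<pi> n ` P' n = P n"
proof
  show "\<pi> n ` P' n \<subseteq> P n" by (auto simp: P'_def)
  show "P n \<subseteq> \<pi> n ` P' n"
  proof
    fix y assume y: "y \<in> P n"
    then have "y \<in> \<pi> n ` carrier G" using P_carrier[of n] unfolding epi.surj by auto
    then obtain x where "x \<in> carrier G" "y = \<pi> n x" by auto
    with y show "y \<in> \<pi> n ` P' n" by (auto simp: P'_def)
  qed
qed

lemma gs_P: "\<gamma>s n (P n) = \<pi> n ` \<gamma> (P' n)"
  using epi.image_lower_central[OF P'_carrier[of n], of n "c + 1"] by (simp add: image_P')

text \<open>By compatibility of the projections, \<open>Q_n\<close> is the image of
  \<open>P' (Suc n)\<close> under \<open>\<pi> n\<close>.\<close>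

lemma gs_Q: "\<gamma>s n (\<rho> n ` P (Suc n)) = \<pi> n ` \<gamma> (P' (Suc n))"
proof -
  have "\<rho> n ` P (Suc n) = \<pi> n ` P' (Suc n)"
    unfolding image_P'[of "Suc n", symmetric] image_image
    using P'_carrier[of "Suc n"] compat by (intro image_cong) auto
  then show ?thesis
    using epi.image_lower_central[OF P'_carrier[of "Suc n"], of n "c + 1"] by simp
qed

text \<open>The clauses that mention a kernel are taken at \<open>Suc n\<close>, as there is none at
  \<open>0\<close>.\<close>

lemma tower_cond:
  shows "{\<one>\<^bsub>Gs n\<^esub>} \<subset> \<gamma>s n (\<rho> n ` P (Suc n))"
    and "kernel (Gs (Suc n)) (Gs n) (\<rho> n) \<subseteq> M_sub (Gs (Suc n)) (Ts (Suc n)) (\<gamma>s (Suc n) (P (Suc n)))"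
    and "\<gamma>s (Suc n) (\<rho> (Suc n) ` P (Suc (Suc n))) \<subseteq> kernel (Gs (Suc n)) (Gs n) (\<rho> n)"
    and "open_normal (Gs n) (Ts n) N \<Longrightarrow> \<gamma>s n N \<subseteq> P n \<or> \<gamma>s n (\<rho> n ` P (Suc n)) \<subseteq> \<gamma>s n N"
    and "closed_subgroup (Gs n) (Ts n) V \<Longrightarrow> \<not> V \<lhd> Gs n \<Longrightarrow> finite (conjugates (Gs n) V) \<Longrightarrow>
      card (conjugates (Gs n) V) \<le> n \<Longrightarrow> pairwise (centralize_each_other (Gs n)) (conjugates (Gs n) V) \<Longrightarrow>
      \<not> \<gamma>s n (P n) \<subseteq> \<gamma>s n (\<gamma>s n (closed_normal_closure (Gs n) (Ts n) V))"
proof -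
  note t = tower[unfolded tower_conditions_def Let_def]
  show "{\<one>\<^bsub>Gs n\<^esub>} \<subset> \<gamma>s n (\<rho> n ` P (Suc n))"
    using t[THEN spec, of n] by (elim conjE)
  show "kernel (Gs (Suc n)) (Gs n) (\<rho> n) \<subseteq> M_sub (Gs (Suc n)) (Ts (Suc n)) (\<gamma>s (Suc n) (P (Suc n)))"
    "\<gamma>s (Suc n) (\<rho> (Suc n) ` P (Suc (Suc n))) \<subseteq> kernel (Gs (Suc n)) (Gs n) (\<rho> n)"
    using t[THEN spec, of "Suc n"] by simp_all
  show "open_normal (Gs n) (Ts n) N \<Longrightarrow> \<gamma>s n N \<subseteq> P n \<or> \<gamma>s n (\<rho> n ` P (Suc n)) \<subseteq> \<gamma>s n N"
    using t[THEN spec, of n] by (elim conjE allE[of _ N] impE)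
  have "\<not> (\<exists>V. closed_subgroup (Gs n) (Ts n) V \<and> \<not> V \<lhd> Gs n \<and> finite (conjugates (Gs n) V) \<and>
      card (conjugates (Gs n) V) \<le> n \<and> pairwise (centralize_each_other (Gs n)) (conjugates (Gs n) V) \<and>
      \<gamma>s n (P n) \<subseteq> \<gamma>s n (\<gamma>s n (closed_normal_closure (Gs n) (Ts n) V)))"
    using t[THEN spec, of n] by (elim conjE)
  then show "closed_subgroup (Gs n) (Ts n) V \<Longrightarrow> \<not> V \<lhd> Gs n \<Longrightarrow> finite (conjugates (Gs n) V) \<Longrightarrow>
      card (conjugates (Gs n) V) \<le> n \<Longrightarrow> pairwise (centralize_each_other (Gs n)) (conjugates (Gs n) V) \<Longrightarrow>
      \<not> \<gamma>s n (P n) \<subseteq> \<gamma>s n (\<gamma>s n (closed_normal_closure (Gs n) (Ts n) V))"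
    by meson
qed

lemma g_P'_not_subset: "\<not> \<gamma> (P' (Suc n)) \<subseteq> K n"
proof
  assume "\<gamma> (P' (Suc n)) \<subseteq> K n"
  then have "\<pi> n ` \<gamma> (P' (Suc n)) \<subseteq> {\<one>\<^bsub>Gs n\<^esub>}" by (auto simp: kernel_def)
  then show False using tower_cond(1)[of n] unfolding gs_Q by blast
qed

lemma image_kernel_subset: "\<pi> (Suc n) ` K n \<subseteq> kernel (Gs (Suc n)) (Gs n) (\<rho> n)"
  using compat by (auto simp: kernel_def)

lemma g_P'_normal: "closed_normal G T (\<gamma> (P' n))"
  by (intro closed_normal_lower_central open_normal_imp_closed_normal open_normal_P')

lemma K_normal: "closed_normal G T (K n)"
  by (rule epi.closed_normal_kernel)

text \<open>Lifts \<open>ker \<rho>_n \<le> M \<le> \<gamma>(P_{n+1})\<close> from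
  \<open>G_{n+1}\<close> to \<open>G\<close>.\<close>

lemma K_subset: "K n \<subseteq> \<gamma> (P' (Suc n)) <#> K (Suc n)"
proof (rule epi.subset_set_mult_kernel)
  show "\<pi> (Suc n) ` K n \<subseteq> \<pi> (Suc n) ` \<gamma> (P' (Suc n))"
    using image_kernel_subset tower_cond(2)[of n] unfolding gs_P M_sub_def by blast
qed (use closed_normal_subset[OF K_normal] closed_normal_subset[OF g_P'_normal] in auto)

text \<open>Lifts \<open>\<gamma>(Q_{n+1}) \<le> ker \<rho>_n\<close>, which accounts for the shift
  by two.\<close>

lemma g_P'_subset: "\<gamma> (P' (Suc (Suc n))) \<subseteq> K n"
proof
  fix x assume x: "x \<in> \<gamma> (P' (Suc (Suc n)))"
  then have xG: "x \<in> carrier G" using closed_normal_subset[OF g_P'_normal] by blast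
  have "\<pi> (Suc n) x \<in> kernel (Gs (Suc n)) (Gs n) (\<rho> n)"
    using tower_cond(3)[of n] x unfolding gs_Q by blast
  then show "x \<in> K n" using compat[OF xG, of n] xG by (simp add: kernel_def)
qed

lemma g_P'_subset_diff:
  assumes "n \<ge> 2"
  shows "\<gamma> (P' n) \<subseteq> K (n - 2)"
proof -
  have "Suc (Suc (n - 2)) = n" using assms by arith
  then show ?thesis using g_P'_subset[of "n - 2"] by (simp only:)
qed

lemma Frattini_step:
  assumes X: "closed_normal G T X" and sub: "\<gamma> (P' (Suc n)) \<subseteq> X <#> K n"
  shows "\<gamma> (P' (Suc n)) \<subseteq> X <#> K (Suc n)"
proof (rule epi.subset_set_mult_kernel)
  let ?n = "Suc n"
  let ?M = "M_sub (Gs ?n) (Ts ?n) (\<gamma>s ?n (P ?n))"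
  have "\<pi> ?n ` \<gamma> (P' ?n) \<subseteq> \<pi> ?n ` (X <#> K n)" using sub by (rule image_mono)
  also have "\<dots> \<subseteq> \<pi> ?n ` X <#>\<^bsub>Gs ?n\<^esub> \<pi> ?n ` K n"
  proof
    fix y assume "y \<in> \<pi> ?n ` (X <#> K n)"
    then obtain x k where "x \<in> X" "k \<in> K n" "y = \<pi> ?n (x \<otimes> k)" by (auto simp: set_mult_def)
    moreover have "x \<in> carrier G" "k \<in> carrier G"
      using \<open>x \<in> X\<close> \<open>k \<in> K n\<close> closed_normal_subset[OF X] by (auto simp: kernel_def)
    ultimately show "y \<in> \<pi> ?n ` X <#>\<^bsub>Gs ?n\<^esub> \<pi> ?n ` K n" by (auto simp: set_mult_def)
  qed
  also have "\<dots> \<subseteq> \<pi> ?n ` X <#>\<^bsub>Gs ?n\<^esub> ?M"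
    using image_kernel_subset[of n] tower_cond(2)[of n] by (intro mono_set_mult) blast+
  finally have "\<gamma>s ?n (P ?n) \<subseteq> \<pi> ?n ` X <#>\<^bsub>Gs ?n\<^esub> ?M"
    by (simp only: gs_P)
  then have "\<gamma>s ?n (P ?n) \<subseteq> \<pi> ?n ` X"
    by (rule epi.H.subset_set_mult_M_sub[OF epi.H.closed_normal_lower_central[OF
        epi.H.open_normal_imp_closed_normal[OF open_normal_P]] epi.closed_normal_image[OF X]])
  then show "\<pi> ?n ` \<gamma> (P' ?n) \<subseteq> \<pi> ?n ` X" by (simp only: gs_P)
qed (use closed_normal_subset[OF X] closed_normal_subset[OF g_P'_normal] in auto)

lemma obliquity_cond:
  assumes "open_normal G T N"
  shows "\<gamma> N \<subseteq> P' n \<or> \<gamma> (P' (Suc n)) \<subseteq> \<gamma> N <#> K n"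
proof -
  have N: "closed_normal G T N" using open_normal_imp_closed_normal[OF assms] .
  have gN: "\<gamma>s n (\<pi> n ` N) = \<pi> n ` \<gamma> N"
    using epi.image_lower_central[OF closed_normal_subset[OF N], of n "c + 1"] by simp
  have gNG: "\<gamma> N \<subseteq> carrier G"
    using closed_normal_subset[OF closed_normal_lower_central[OF N]] .
  consider "\<gamma>s n (\<pi> n ` N) \<subseteq> P n" | "\<gamma>s n (\<rho> n ` P (Suc n)) \<subseteq> \<gamma>s n (\<pi> n ` N)"
    using tower_cond(4)[OF epi.open_normal_image[OF assms]] by blast
  then show ?thesis
  proof cases
    case 1
    then have "\<gamma> N \<subseteq> P' n" using gNG unfolding gN P'_def by auto
    then show ?thesis ..
  next
    case 2
    then show ?thesis
      unfolding gN gs_Q using epi.subset_set_mult_kernel[OF closed_normal_subset[OF g_P'_normal] gNG] by blast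
  qed
qed

text \<open>By Fitting-freeness \<open>\<gamma>(R) = 1\<close> gives \<open>R = 1\<close>, so
  \<open>G\<close> is discrete and some \<open>K n\<close> is trivial. Then
  \<open>\<gamma>(P' (n + 2))\<close> would be trivial, although its image
  \<open>\<gamma>(Q_{n+1})\<close> in \<open>G_{n+1}\<close> is not.\<close>

lemma not_nilpotent:
  assumes "open_normal G T R"
  shows "\<gamma> R \<noteq> {\<one>}"
proof
  assume "\<gamma> R = {\<one>}"
  then have "R = {\<one>}"
    using lower_central_eq_one_imp[OF Fitting_free open_normal_imp_closed_normal[OF assms], of c] by simp
  then have "openin T {\<one>}" using assms by (simp add: open_normal_def)
  then obtain n where "K n \<subseteq> {\<one>}"
    using decseq_closed_in_open[OF decseq_kernel closedin_kernel, of "{\<one>}"] Inter_kernel by blast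
  then have "\<gamma> (P' (Suc (Suc n))) \<subseteq> {\<one>}"
    using g_P'_subset by blast
  also have "\<dots> \<subseteq> K (Suc n)" using closed_normal_one_mem[OF K_normal] by blast
  finally show False using g_P'_not_subset by blast
qed

text \<open>Condition (iv) speaks of open normal subgroups, so it is applied to
  \<open>N <#> U\<close>, where \<open>\<gamma>(N <#> U)\<close> lies in
  \<open>U <#> \<gamma>(N)\<close>. The group \<open>U\<close> is chosen to separate an alleged
  exception \<open>z\<close> from the closed product.\<close>

lemma g_P'_subset_set_mult:
  assumes N: "closed_normal G T N" and nsub: "\<not> \<gamma> N \<subseteq> P' n"
  shows "\<gamma> (P' (Suc n)) \<subseteq> \<gamma> N <#> K n"
proof
  let ?C = "\<gamma> N <#> K n"
  have gN: "closed_normal G T (\<gamma> N)" using closed_normal_lower_central[OF N] .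
  have C: "closed_normal G T ?C" using closed_normal_set_mult[OF gN K_normal] .
  fix z assume z: "z \<in> \<gamma> (P' (Suc n))"
  show "z \<in> ?C"
  proof (rule ccontr)
    assume "z \<notin> ?C"
    moreover have "z \<in> carrier G" "closedin T ?C"
      using z closed_normal_subset[OF g_P'_normal] C by (auto simp: closed_normal_def)
    ultimately obtain U where U: "open_normal G T U" "z \<notin> ?C <#> U"
      using separate_closed by metis
    have cU: "closed_normal G T U" using open_normal_imp_closed_normal[OF U(1)] .
    have sub: "U \<subseteq> carrier G" "\<gamma> N \<subseteq> carrier G" "K n \<subseteq> carrier G" "N \<subseteq> carrier G"
      using closed_normal_subset cU gN K_normal N by auto
    have UN: "open_normal G T (N <#> U)" using open_normal_set_mult[OF N U(1)] .
    have comm: "N <#> U = U <#> N" "?C <#> U = U <#> ?C"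
      using commut_normal N C cU by (auto simp: closed_normal_def normal_imp_subgroup)
    have "N \<subseteq> N <#> U"
      using set_mult_incl1[OF _ sub(4)] cU by (simp add: closed_normal_def normal_imp_subgroup)
    then have "\<gamma> N \<subseteq> \<gamma> (N <#> U)" by (rule lower_central_mono)
    then have "\<gamma> (P' (Suc n)) \<subseteq> \<gamma> (N <#> U) <#> K n"
      using obliquity_cond[OF UN, of n] nsub by blast
    also have "\<dots> \<subseteq> (U <#> \<gamma> N) <#> K n"
      unfolding comm(1) by (intro mono_set_mult lower_central_set_mult cU sub) auto
    also have "\<dots> = U <#> ?C" using set_mult_assoc[OF sub(1-3)] .
    finally show False using z U(2) comm(2) by auto
  qed
qed

text \<open>Condition (iv) and the Frattini step give \<open>K n \<le> \<gamma>(N) K (n+1)\<close>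
  for \<open>n \<ge> m + 2\<close>. Iteration yields \<open>K (m+2) \<le> \<gamma>(N) K n\<close>
  for all \<open>n\<close>, hence \<open>K (m+2) \<le> \<gamma>(N)\<close> because
  \<open>\<gamma>(N)\<close> is closed; and \<open>\<gamma>(P' n)\<close> eventually lies in
  \<open>K (m+2)\<close>.\<close>

lemma eventually_g_P'_subset:
  assumes N: "closed_normal G T N" "N \<noteq> {\<one>}"
  shows "\<exists>m. \<forall>n\<ge>m. \<gamma> (P' n) \<subseteq> \<gamma> N"
proof -
  have gN: "closed_normal G T (\<gamma> N)" "\<gamma> N \<noteq> {\<one>}"
    by (rule closed_normal_lower_central[OF N(1)], rule lower_central_neq_one[OF Fitting_free N])
  have ggN: "closed_normal G T (\<gamma> (\<gamma> N))" "\<gamma> (\<gamma> N) \<noteq> {\<one>}"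
    by (rule closed_normal_lower_central[OF gN(1)], rule lower_central_neq_one[OF Fitting_free gN])
  \<comment> \<open>The second \<open>\<gamma>\<close> is there to refute
    \<open>\<gamma>(N) \<le> P' n\<close>: only \<open>\<gamma>(P' n)\<close>, not
    \<open>P' n\<close>, is known to lie in \<open>K (n - 2)\<close>.\<close>
  obtain m where m: "\<not> \<gamma> (\<gamma> N) \<subseteq> K m"
    using ggN closed_normal_one_mem[OF ggN(1)] Inter_kernel by blast
  have nsub: "\<not> \<gamma> N \<subseteq> P' n" if "n \<ge> m + 2" for n
  proof
    assume "\<gamma> N \<subseteq> P' n"
    then have "\<gamma> (\<gamma> N) \<subseteq> \<gamma> (P' n)" by (rule lower_central_mono)
    also have "\<dots> \<subseteq> K (n - 2)"
      using that by (intro g_P'_subset_diff) simp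
    also have "\<dots> \<subseteq> K m" using that by (intro kernel_antimono) auto
    finally show False using m by simp
  qed
  have sub: "\<gamma> N \<subseteq> carrier G" using closed_normal_subset[OF gN(1)] .
  have step: "K n \<subseteq> \<gamma> N <#> K (Suc n)" if "n \<ge> m + 2" for n
  proof -
    have cl: "closed_normal G T (\<gamma> N <#> K (Suc n))"
      using closed_normal_set_mult[OF gN(1) K_normal] .
    have "\<gamma> (P' (Suc n)) \<subseteq> \<gamma> N <#> K (Suc n)"
      by (intro Frattini_step gN g_P'_subset_set_mult N nsub that)
    moreover have "K (Suc n) \<subseteq> \<gamma> N <#> K (Suc n)"
      using gN(1) closed_normal_subset[OF K_normal]
      by (intro set_mult_incl2) (simp_all add: closed_normal_def normal_imp_subgroup)
    ultimately have "\<gamma> (P' (Suc n)) <#> K (Suc n) \<subseteq> \<gamma> N <#> K (Suc n)"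
      using cl by (intro set_mult_minimal) (simp_all add: closed_normal_def normal_imp_subgroup)
    then show ?thesis using K_subset[of n] by blast
  qed
  have "K (m + 2) \<subseteq> \<gamma> N <#> K n" for n
  proof (cases "n \<ge> m + 2")
    case True
    then show ?thesis
    proof (induction n rule: dec_induct)
      case base
      show ?case
        using gN(1) closed_normal_subset[OF K_normal]
        by (intro set_mult_incl2) (simp_all add: closed_normal_def normal_imp_subgroup)
    next
      case (step n)
      have cl: "subgroup (\<gamma> N <#> K (Suc n)) G" "subgroup (K (Suc n)) G"
        using closed_normal_set_mult[OF gN(1) K_normal[of "Suc n"]] K_normal[of "Suc n"]
        by (simp_all add: closed_normal_def normal_imp_subgroup)
      have "\<gamma> N <#> K n \<subseteq> \<gamma> N <#> K (Suc n)"
        using \<open>\<And>n. n \<ge> m + 2 \<Longrightarrow> K n \<subseteq> \<gamma> N <#> K (Suc n)\<close>[OF step(1)] set_mult_incl1[OF cl(2) sub]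
        by (intro set_mult_minimal[OF cl(1)])
      then show ?case using step.IH by blast
    qed
  next
    case False
    then have "K (m + 2) \<subseteq> K n" by (intro kernel_antimono) auto
    also have "\<dots> \<subseteq> \<gamma> N <#> K n"
      using gN(1) closed_normal_subset[OF K_normal]
      by (intro set_mult_incl2) (simp_all add: closed_normal_def normal_imp_subgroup)
    finally show ?thesis .
  qed
  then have *: "K (m + 2) \<subseteq> \<gamma> N <#> K n" for n .
  have KN: "K (m + 2) \<subseteq> \<gamma> N"
  proof
    fix z assume z: "z \<in> K (m + 2)"
    show "z \<in> \<gamma> N"
    proof (rule Inter_set_mult_closed[OF decseq_kernel closedin_kernel Inter_kernel])
      show "closedin T (\<gamma> N)" using gN(1) by (simp add: closed_normal_def)
      show "z \<in> carrier G" using z closed_normal_subset[OF K_normal] by blast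
      show "z \<in> \<gamma> N <#> K n" for n using z * by blast
    qed
  qed
  \<comment> \<open>Two indices above \<open>m + 2\<close>, again because
    \<open>\<gamma>(P' n)\<close> lies in \<open>K (n - 2)\<close>.\<close>
  have "\<gamma> (P' n) \<subseteq> \<gamma> N" if "n \<ge> m + 4" for n
  proof -
    have "\<gamma> (P' n) \<subseteq> K (n - 2)"
      using that by (intro g_P'_subset_diff) simp
    also have "\<dots> \<subseteq> K (m + 2)" using that by (intro kernel_antimono) auto
    finally show ?thesis using KN by blast
  qed
  then show ?thesis by blast
qed

lemma JNNF_limit: "JNNF c G T"
  unfolding JNNF_iff
proof (intro conjI allI impI)
  show "\<gamma> R \<noteq> {\<one>}" if "open_normal G T R" for R using not_nilpotent[OF that] .
  fix N assume N: "closed_normal G T N \<and> N \<noteq> {\<one>}"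
  then obtain m where "\<And>n. n \<ge> m \<Longrightarrow> \<gamma> (P' n) \<subseteq> \<gamma> N"
    using eventually_g_P'_subset by metis
  moreover have "\<gamma> N \<subseteq> N" using N by (intro lower_central_subset closed_normal_imp_subgroup) simp
  ultimately show "\<exists>R. open_normal G T R \<and> \<gamma> R \<subseteq> N"
    using open_normal_P' by (intro exI[of _ "P' m"]) blast
qed

end

section \<open>The hereditary property of the limit\<close>

context Group.group
begin

lemma conj_set_normalized:
  assumes "U \<lhd> G" "V \<subseteq> carrier G" "\<And>u. u \<in> U \<Longrightarrow> conj_set u V = V" "g \<in> carrier G" "u \<in> U"
  shows "conj_set u (conj_set g V) = conj_set g V"
proof -
  have uG: "u \<in> carrier G" using assms(1,5) normal_imp_subgroup subgroup.subset by blast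
  have w: "g \<otimes> u \<otimes> inv g \<in> U" using normal.inv_op_closed2[OF assms(1,4,5)] .
  have "conj_set u (conj_set g V) = conj_set (g \<otimes> u \<otimes> inv g \<otimes> g) V"
    using assms(2,4) uG by (simp add: conj_set_mult m_assoc)
  also have "\<dots> = conj_set g (conj_set (g \<otimes> u \<otimes> inv g) V)"
    using assms(2,4) uG by (simp add: conj_set_mult)
  finally show ?thesis using assms(3)[OF w] by simp
qed

lemma inj_on_conj: "g \<in> carrier G \<Longrightarrow> inj_on (\<lambda>x. inv g \<otimes> x \<otimes> g) (carrier G)"
  by (auto intro!: inj_onI)

lemma conj_set_inj:
  "V \<subseteq> carrier G \<Longrightarrow> W \<subseteq> carrier G \<Longrightarrow> g \<in> carrier G \<Longrightarrow> conj_set g V = conj_set g W \<Longrightarrow> V = W"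
  unfolding conj_set_def using inj_on_image_eq_iff[OF inj_on_conj] by blast

lemma conj_set_Inter:
  assumes "S \<noteq> {}" "\<And>X. X \<in> S \<Longrightarrow> X \<subseteq> carrier G" "g \<in> carrier G"
  shows "conj_set g (\<Inter>S) = \<Inter>(conj_set g ` S)"
proof -
  obtain X where "X \<in> S" using assms(1) by blast
  have "(\<lambda>x. inv g \<otimes> x \<otimes> g) ` (\<Inter>((\<lambda>X. X) ` S)) = (\<Inter>X\<in>S. (\<lambda>x. inv g \<otimes> x \<otimes> g) ` X)"
    using assms(2) by (intro image_INT[OF inj_on_conj[OF assms(3)] _ \<open>X \<in> S\<close>]) auto
  then show ?thesis by (simp add: conj_set_def)
qed

text \<open>The conjugate by \<open>g\<close> depends only on the coset \<open>U #> g\<close>, as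
  \<open>U\<close> normalizes \<open>V\<close>.\<close>

lemma finite_conjugates:
  assumes "finite (rcosets U)" "subgroup U G" "V \<subseteq> carrier G" "\<And>u. u \<in> U \<Longrightarrow> conj_set u V = V"
  shows "finite (conjugates G V)"
proof -
  have "conj_set g V \<in> (\<lambda>C. conj_set (SOME h. h \<in> C) V) ` (rcosets U)" if g: "g \<in> carrier G" for g
  proof (rule image_eqI)
    show "U #> g \<in> rcosets U" using g by (auto simp: RCOSETS_def)
    have "(SOME h. h \<in> U #> g) \<in> U #> g"
      using rcos_self[OF g assms(2)] by (rule someI)
    then obtain u where u: "u \<in> U" "(SOME h. h \<in> U #> g) = u \<otimes> g" by (auto simp: r_coset_def)
    have "u \<in> carrier G" using u(1) assms(2) subgroup.subset by blast
    then have "conj_set (u \<otimes> g) V = conj_set g (conj_set u V)"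
      using g assms(3) by (simp add: conj_set_mult)
    then show "conj_set g V = conj_set (SOME h. h \<in> U #> g) V"
      using u assms(4) by simp
  qed
  then have "conjugates G V \<subseteq> (\<lambda>C. conj_set (SOME h. h \<in> C) V) ` (rcosets U)"
    unfolding conjugates_eq[OF assms(3)] by (intro subsetI) (elim CollectE exE conjE, simp)
  then show ?thesis by (rule finite_subset) (simp add: assms(1))
qed

text \<open>Conjugation by \<open>inv g\<close> moves the pair to \<open>V\<close> and
  \<open>conj_set (h \<otimes> inv g) V\<close>.\<close>

lemma centralize_conj_pair:
  assumes V: "V \<subseteq> carrier G" and gh: "g \<in> carrier G" "h \<in> carrier G"
    and comm: "centralize_each_other G V (conj_set (h \<otimes> inv g) V)"
  shows "centralize_each_other G (conj_set g V) (conj_set h V)"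
  unfolding centralize_each_other_def
proof (intro ballI)
  fix x y assume "x \<in> conj_set g V" "y \<in> conj_set h V"
  then obtain v w where vw: "v \<in> V" "x = inv g \<otimes> v \<otimes> g" "w \<in> V" "y = inv h \<otimes> w \<otimes> h"
    by (auto simp: conj_set_def)
  have c: "v \<in> carrier G" "w \<in> carrier G" "y \<in> carrier G" using vw V gh by auto
  have "g \<otimes> y \<otimes> inv g = inv (h \<otimes> inv g) \<otimes> w \<otimes> (h \<otimes> inv g)"
    using vw(4) c gh by (simp add: inv_mult_group m_assoc)
  then have "g \<otimes> y \<otimes> inv g \<in> conj_set (h \<otimes> inv g) V"
    using vw(3) unfolding conj_set_def by (rule image_eqI)
  then have *: "v \<otimes> (g \<otimes> y \<otimes> inv g) = (g \<otimes> y \<otimes> inv g) \<otimes> v"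
    using comm vw(1) unfolding centralize_each_other_def by blast
  have "x \<otimes> y = inv g \<otimes> (v \<otimes> (g \<otimes> y \<otimes> inv g)) \<otimes> g"
    using vw(2) c gh by (simp add: m_assoc)
  also have "\<dots> = y \<otimes> x"
    unfolding * using vw(2) c gh by (simp add: m_assoc)
  finally show "x \<otimes> y = y \<otimes> x" .
qed

end

section \<open>Centralizers and commuting conjugates\<close>

context profinite
begin

lemma closed_subgroup_conj_set:
  assumes "closed_subgroup G T V" "g \<in> carrier G"
  shows "closed_subgroup G T (conj_set g V)"
proof -
  interpret c: profinite_hom G T G T "\<lambda>x. inv g \<otimes> x \<otimes> inv (inv g)"
    using conj_hom[of "inv g"] assms(2) by simp
  show ?thesis
    using c.closed_subgroup_image[OF assms(1)] assms(2) by (simp add: conj_set_def)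
qed

text \<open>The centralizer \<open>C\<close> of \<open>U\<close> is closed and normal, and
  \<open>C \<inter> U\<close> is abelian, hence trivial. So \<open>C\<close> embeds into the finite
  group \<open>G / U\<close> and, as a finite normal subgroup of a JNN_cF group, is trivial.\<close>

lemma centralizer_open_normal_trivial:
  assumes FF: "Fitting_free G T" and J: "JNNF c G T" and U: "open_normal G T U"
    and v: "v \<in> carrier G" "\<And>u. u \<in> U \<Longrightarrow> v \<otimes> u = u \<otimes> v"
  shows "v = \<one>"
proof -
  define C where "C = {g \<in> carrier G. \<forall>u\<in>U. g \<otimes> u = u \<otimes> g}"
  have nU: "U \<lhd> G" using U by (simp add: open_normal_def)
  have UG: "U \<subseteq> carrier G" using normal_imp_subgroup[OF nU] subgroup.subset by blast
  have "C = (\<Inter>u\<in>U. {g \<in> carrier G. inv g \<otimes> inv u \<otimes> g \<otimes> u \<in> {\<one>}})"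
  proof -
    have "g \<otimes> u = u \<otimes> g \<longleftrightarrow> inv g \<otimes> inv u \<otimes> g \<otimes> u \<in> {\<one>}" if "g \<in> carrier G" "u \<in> U" for g u
      using commutator_eq_one_iff[of g u] that UG by (auto simp: commutator_def)
    moreover have "\<one> \<in> U" using subgroup.one_closed[OF normal_imp_subgroup[OF nU]] .
    ultimately show ?thesis unfolding C_def by auto
  qed
  moreover have "closedin T (\<Inter>u\<in>U. {g \<in> carrier G. inv g \<otimes> inv u \<otimes> g \<otimes> u \<in> {\<one>}})"
  proof (rule closedin_INT)
    show "U \<noteq> {}" using subgroup.one_closed[OF normal_imp_subgroup[OF nU]] by blast
    show "closedin T {g \<in> carrier G. inv g \<otimes> inv u \<otimes> g \<otimes> u \<in> {\<one>}}" if "u \<in> U" for u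
      using that UG closedin_one by (intro closedin_preimage_carrier continuous_intros) auto
  qed
  ultimately have "closedin T C" by simp
  moreover have "C \<lhd> G"
    unfolding normal_inv_iff
  proof (intro conjI ballI)
    show "subgroup C G"
    proof (rule subgroupI)
      have "\<one> \<in> C" using UG by (auto simp: C_def)
      then show "C \<noteq> {}" by blast
      show "inv a \<in> C" if "a \<in> C" for a
      proof -
        have "inv a \<otimes> u = u \<otimes> inv a" if "u \<in> U" for u
        proof -
          have c: "a \<in> carrier G" "u \<in> carrier G" "a \<otimes> u = u \<otimes> a" using \<open>a \<in> C\<close> that UG by (auto simp: C_def)
          have "inv a \<otimes> u = inv a \<otimes> (u \<otimes> a) \<otimes> inv a" using c(1,2) by (simp add: m_assoc)
          also have "\<dots> = u \<otimes> inv a" unfolding c(3)[symmetric] using c(1,2) by (simp add: m_assoc)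
          finally show ?thesis .
        qed
        then show ?thesis using that by (simp add: C_def)
      qed
      show "a \<otimes> b \<in> C" if "a \<in> C" "b \<in> C" for a b
      proof -
        have "(a \<otimes> b) \<otimes> u = u \<otimes> (a \<otimes> b)" if "u \<in> U" for u
        proof -
          have c: "a \<in> carrier G" "b \<in> carrier G" "u \<in> carrier G" "a \<otimes> u = u \<otimes> a" "b \<otimes> u = u \<otimes> b"
            using \<open>a \<in> C\<close> \<open>b \<in> C\<close> that UG by (auto simp: C_def)
          have "(a \<otimes> b) \<otimes> u = a \<otimes> (b \<otimes> u)" using c by (simp add: m_assoc)
          also have "\<dots> = (a \<otimes> u) \<otimes> b" using c(1-3) by (simp add: c(5) m_assoc)
          also have "\<dots> = u \<otimes> (a \<otimes> b)" using c(1-3) by (simp add: c(4) m_assoc)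
          finally show ?thesis .
        qed
        then show ?thesis using that by (simp add: C_def)
      qed
    qed (auto simp: C_def)
    fix x a assume x: "x \<in> carrier G" and a: "a \<in> C"
    have aG: "a \<in> carrier G" using a by (simp add: C_def)
    have "x \<otimes> a \<otimes> inv x \<otimes> u = u \<otimes> (x \<otimes> a \<otimes> inv x)" if u: "u \<in> U" for u
    proof -
      have uG: "u \<in> carrier G" using u UG by blast
      have "inv x \<otimes> u \<otimes> x \<in> U" using normal.inv_op_closed1[OF nU x u] .
      then have *: "a \<otimes> (inv x \<otimes> u \<otimes> x) = (inv x \<otimes> u \<otimes> x) \<otimes> a" using a by (simp add: C_def)
      have "x \<otimes> a \<otimes> inv x \<otimes> u = x \<otimes> (a \<otimes> (inv x \<otimes> u \<otimes> x)) \<otimes> inv x"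
        using x aG uG by (simp add: m_assoc)
      also have "\<dots> = u \<otimes> (x \<otimes> a \<otimes> inv x)"
        unfolding * using x aG uG by (simp add: m_assoc)
      finally show ?thesis .
    qed
    then show "x \<otimes> a \<otimes> inv x \<in> C" using x aG by (simp add: C_def)
  qed
  ultimately have C: "closed_normal G T C" by (simp add: closed_normal_def)
  have "C \<inter> U = {\<one>}"
  proof (rule Fitting_freeD[OF FF closed_normal_Int[OF C open_normal_imp_closed_normal[OF U]]])
    show "x \<otimes> y = y \<otimes> x" if "x \<in> C \<inter> U" "y \<in> C \<inter> U" for x y
      using that unfolding C_def by blast
  qed
  then have "finite C"
    using C by (intro finite_if_Int_open_normal_trivial[OF U]) (simp_all add: closed_normal_def normal_imp_subgroup)
  then have "C = {\<one>}" using finite_normal_trivial[OF J C] by simp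
  moreover have "v \<in> C" using v by (simp add: C_def)
  ultimately show ?thesis by simp
qed

text \<open>Wilson's construction: an intersection of conjugates that is non-trivial, but becomes trivial
  as soon as further conjugates are added, commutes with its own conjugates.\<close>

lemma ex_commuting_conjugates:
  assumes U: "open_normal G T U" and V: "closed_subgroup G T V" "V \<subseteq> U" "V \<noteq> {\<one>}"
    and norm: "\<And>u. u \<in> U \<Longrightarrow> conj_set u V = V"
  obtains W a where "closed_subgroup G T W" "W \<noteq> {\<one>}" "a \<in> carrier G" "W \<subseteq> conj_set a V"
    "finite (conjugates G W)" "pairwise (centralize_each_other G) (conjugates G W)"
proof -
  have nU: "U \<lhd> G" using U by (simp add: open_normal_def)
  have sU: "subgroup U G" using nU by (rule normal_imp_subgroup)
  have UG: "U \<subseteq> carrier G" using sU by (rule subgroup.subset)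
  have VG: "V \<subseteq> carrier G" using V UG by blast
  have finU: "finite (rcosets U)" using finite_rcosets[OF open_normal_imp_open_subgroup[OF U]] .
  define \<V> where "\<V> = conjugates G V"
  have \<V>: "\<V> = {conj_set g V | g. g \<in> carrier G}" unfolding \<V>_def by (rule conjugates_eq[OF VG])
  have fin\<V>: "finite \<V>" unfolding \<V>_def using finite_conjugates[OF finU sU VG norm] .
  have X_sub: "closed_subgroup G T X" "X \<subseteq> U" "X \<subseteq> carrier G" if X: "X \<in> \<V>" for X
  proof -
    obtain g where g: "g \<in> carrier G" "X = conj_set g V" using X unfolding \<V> by blast
    show "closed_subgroup G T X" using closed_subgroup_conj_set[OF V(1) g(1)] g(2) by simp
    show "X \<subseteq> U" using conj_set_mono[OF V(2), of g] conj_set_normal[OF nU g(1)] g(2) by simp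
    then show "X \<subseteq> carrier G" using UG by simp
  qed
  have X_norm: "conj_set u X = X" if X: "X \<in> \<V>" and u: "u \<in> U" for X u
  proof -
    obtain g where g: "g \<in> carrier G" "X = conj_set g V" using X unfolding \<V> by blast
    show ?thesis using conj_set_normalized[OF nU VG norm g(1) u] g(2) by simp
  qed
  have X_conj: "conj_set h X \<in> \<V>" if X: "X \<in> \<V>" and h: "h \<in> carrier G" for X h
  proof -
    obtain g where g: "g \<in> carrier G" "X = conj_set g V" using X unfolding \<V> by blast
    have "conj_set h X = conj_set (g \<otimes> h) V" using g h VG by (simp add: conj_set_mult)
    then show ?thesis unfolding \<V> using g(1) h by blast
  qed
  define \<F> where "\<F> = {S. S \<subseteq> \<V> \<and> S \<noteq> {} \<and> \<Inter>S \<noteq> {\<one>}}"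
  have "V \<in> \<V>" unfolding \<V> using conj_set_one[OF VG] by (metis (mono_tags, lifting) mem_Collect_eq one_closed)
  then have "{V} \<in> \<F>" using V(3) by (simp add: \<F>_def)
  moreover have "finite \<F>" unfolding \<F>_def using fin\<V> by simp
  ultimately obtain S where S: "S \<in> \<F>" "\<And>S'. S' \<in> \<F> \<Longrightarrow> S \<subseteq> S' \<Longrightarrow> S = S'"
    using finite_has_maximal2[of \<F> "{V}"] by metis
  have S': "S \<subseteq> \<V>" "S \<noteq> {}" "\<Inter>S \<noteq> {\<one>}" using S(1) by (auto simp: \<F>_def)
  define W where "W = \<Inter>S"
  have cW: "closed_subgroup G T W"
    unfolding W_def using S' X_sub by (intro closed_subgroup_Inter) auto
  have sW: "subgroup W G" using cW by (simp add: closed_subgroup_def)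
  have W_U: "W \<subseteq> U" "W \<subseteq> carrier G" unfolding W_def using S' X_sub by blast+
  have cj: "conj_set g W = \<Inter>(conj_set g ` S)" if "g \<in> carrier G" for g
    unfolding W_def
  proof (rule conj_set_Inter[OF S'(2) _ that])
    show "X \<subseteq> carrier G" if "X \<in> S" for X using that X_sub(3) S'(1) by blast
  qed
  have W_norm: "conj_set u W = W" if "u \<in> U" for u
  proof -
    have "conj_set u ` S = (\<lambda>X. X) ` S"
      using X_norm[OF _ that] S'(1) by (intro image_cong) auto
    moreover have "u \<in> carrier G" using that UG by blast
    ultimately show ?thesis using cj[of u] by (simp add: W_def)
  qed
  \<comment> \<open>Were the intersection non-trivial, maximality would absorb the conjugated family
    into \<open>S\<close>; by finiteness the two families coincide, and then \<open>g\<close>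
    normalizes \<open>W\<close>.\<close>
  have triv: "W \<inter> conj_set g W \<subseteq> {\<one>}" if g: "g \<in> carrier G" "conj_set g W \<noteq> W" for g
  proof (rule ccontr)
    assume *: "\<not> W \<inter> conj_set g W \<subseteq> {\<one>}"
    have gS: "conj_set g ` S \<subseteq> \<V>" using X_conj g(1) S'(1) by auto
    have "\<Inter>(S \<union> conj_set g ` S) = W \<inter> conj_set g W"
      using cj[OF g(1)] unfolding W_def by auto
    then have "S \<union> conj_set g ` S \<in> \<F>"
      using * S' gS unfolding \<F>_def by auto
    then have "conj_set g ` S \<subseteq> S" using S(2) by blast
    moreover have "inj_on (conj_set g) S"
      using conj_set_inj[OF _ _ g(1)] X_sub(3) S'(1) by (intro inj_onI) blast
    moreover have "finite S" using S'(1) fin\<V> finite_subset by blast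
    ultimately have "conj_set g ` S = S" using endo_inj_surj by blast
    then show False using cj[OF g(1)] g(2) by (simp add: W_def)
  qed
  \<comment> \<open>Both groups lie in \<open>U\<close>, and \<open>U\<close> normalizes both; so a
    commutator of elements of the two lies in their intersection, which is trivial.\<close>
  have comm1: "centralize_each_other G W (conj_set g W)" if g: "g \<in> carrier G" "conj_set g W \<noteq> W" for g
    unfolding centralize_each_other_def
  proof (intro ballI)
    fix x y assume x: "x \<in> W" and y: "y \<in> conj_set g W"
    have cgW: "subgroup (conj_set g W) G"
      using closed_subgroup_conj_set[OF cW g(1)] by (simp add: closed_subgroup_def)
    have "conj_set g W \<subseteq> U"
      using conj_set_mono[OF W_U(1), of g] conj_set_normal[OF nU g(1)] by simp
    then have U: "x \<in> U" "y \<in> U" using x y W_U by auto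
    have G: "x \<in> carrier G" "y \<in> carrier G" using U UG by auto
    have "inv y \<otimes> x \<otimes> y \<in> conj_set y W" using x by (auto simp: conj_set_def)
    then have "inv x \<otimes> (inv y \<otimes> x \<otimes> y) \<in> W"
      using W_norm[OF U(2)] x sW by (auto intro: subgroup.m_closed subgroup.m_inv_closed)
    then have 1: "commutator G x y \<in> W" using G by (simp add: commutator_def m_assoc)
    have "inv x \<otimes> inv y \<otimes> x \<in> conj_set x (conj_set g W)"
      using subgroup.m_inv_closed[OF cgW y] by (auto simp: conj_set_def)
    then have "inv x \<otimes> inv y \<otimes> x \<in> conj_set g W"
      using conj_set_normalized[OF nU W_U(2) W_norm g(1) U(1)] by simp
    then have "inv x \<otimes> inv y \<otimes> x \<otimes> y \<in> conj_set g W" using y cgW by (auto intro: subgroup.m_closed)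
    then have "commutator G x y \<in> W \<inter> conj_set g W" using 1 by (simp add: commutator_def)
    then have "commutator G x y = \<one>" using triv[OF g] by blast
    then show "x \<otimes> y = y \<otimes> x" using commutator_eq_one_iff G by blast
  qed
  have "pairwise (centralize_each_other G) (conjugates G W)"
    unfolding conjugates_eq[OF W_U(2)] pairwise_def
  proof (intro ballI impI)
    fix X Y assume "X \<in> {conj_set g W |g. g \<in> carrier G}" "Y \<in> {conj_set g W |g. g \<in> carrier G}" and ne: "X \<noteq> Y"
    then obtain g h where gh: "g \<in> carrier G" "h \<in> carrier G" "X = conj_set g W" "Y = conj_set h W" by blast
    have "conj_set (h \<otimes> inv g) W \<noteq> W"
    proof
      assume "conj_set (h \<otimes> inv g) W = W"
      then have "conj_set g W = conj_set g (conj_set (h \<otimes> inv g) W)" by simp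
      also have "\<dots> = conj_set h W" using gh W_U(2) by (simp add: conj_set_mult m_assoc)
      finally show False using ne gh by simp
    qed
    then have "centralize_each_other G W (conj_set (h \<otimes> inv g) W)" using comm1 gh by simp
    then show "centralize_each_other G X Y"
      unfolding gh(3,4) by (rule centralize_conj_pair[OF W_U(2) gh(1,2)])
  qed
  moreover obtain X where "X \<in> S" using S'(2) by blast
  moreover obtain a where "a \<in> carrier G" "X = conj_set a V" using \<open>X \<in> S\<close> S'(1) unfolding \<V> by blast
  moreover have "W \<noteq> {\<one>}" unfolding W_def by (rule S'(3))
  moreover have "W \<subseteq> X" unfolding W_def using \<open>X \<in> S\<close> by blast
  moreover have "finite (conjugates G W)" using finite_conjugates[OF finU sU W_U(2) W_norm] .
  ultimately show ?thesis using that[of W a] cW by simp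
qed

end

context profinite_hom
begin

lemma image_conj_set:
  "V \<subseteq> carrier G \<Longrightarrow> g \<in> carrier G \<Longrightarrow> \<pi> ` G.conj_set g V = H.conj_set (\<pi> g) (\<pi> ` V)"
  unfolding G.conj_set_def H.conj_set_def image_image by (intro image_cong) auto

end

context profinite_epi
begin

lemma conjugates_image:
  assumes "V \<subseteq> carrier G"
  shows "conjugates H (\<pi> ` V) = (\<lambda>X. \<pi> ` X) ` conjugates G V"
proof -
  have im: "\<pi> ` V \<subseteq> carrier H" using assms by auto
  have "{H.conj_set h (\<pi> ` V) |h. h \<in> carrier H} = {H.conj_set (\<pi> g) (\<pi> ` V) |g. g \<in> carrier G}"
    unfolding surj[symmetric] by blast
  also have "\<dots> = {\<pi> ` G.conj_set g V |g. g \<in> carrier G}"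
    using image_conj_set[OF assms] by (intro Collect_cong) metis
  also have "\<dots> = (\<lambda>X. \<pi> ` X) ` {G.conj_set g V |g. g \<in> carrier G}" by blast
  finally show ?thesis
    unfolding G.conjugates_eq[OF assms] H.conjugates_eq[OF im] .
qed

lemma pairwise_centralize_image:
  assumes "V \<subseteq> carrier G" "pairwise (centralize_each_other G) (conjugates G V)"
  shows "pairwise (centralize_each_other H) (conjugates H (\<pi> ` V))"
  unfolding conjugates_image[OF assms(1)] pairwise_def
proof (intro ballI impI)
  fix A B assume "A \<in> (\<lambda>X. \<pi> ` X) ` conjugates G V" "B \<in> (\<lambda>X. \<pi> ` X) ` conjugates G V" and ne: "A \<noteq> B"
  then obtain X Y where XY: "X \<in> conjugates G V" "A = \<pi> ` X" "Y \<in> conjugates G V" "B = \<pi> ` Y" by blast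
  then have "X \<noteq> Y" using ne by blast
  then have c: "centralize_each_other G X Y" using assms(2) XY unfolding pairwise_def by blast
  have sub: "X \<subseteq> carrier G" "Y \<subseteq> carrier G"
    using XY G.conj_set_carrier[OF assms(1)] unfolding G.conjugates_eq[OF assms(1)] by blast+
  show "centralize_each_other H A B"
    unfolding centralize_each_other_def XY(2,4)
  proof (intro ballI)
    fix a b assume "a \<in> \<pi> ` X" "b \<in> \<pi> ` Y"
    then obtain x y where xy: "x \<in> X" "y \<in> Y" "a = \<pi> x" "b = \<pi> y" by blast
    then have "x \<otimes>\<^bsub>G\<^esub> y = y \<otimes>\<^bsub>G\<^esub> x" using c unfolding centralize_each_other_def by blast
    then have "\<pi> (x \<otimes>\<^bsub>G\<^esub> y) = \<pi> (y \<otimes>\<^bsub>G\<^esub> x)" by (rule arg_cong)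
    then show "a \<otimes>\<^bsub>H\<^esub> b = b \<otimes>\<^bsub>H\<^esub> a" using xy sub by (simp add: subset_iff)
  qed
qed

end

section \<open>Open subgroups of the limit are JNN_cF\<close>

context nilpotent_tower
begin

text \<open>For large \<open>n\<close> condition (v) forces the image of \<open>W\<close> in
  \<open>G_n\<close> to be normal. A conjugate of an element of \<open>W\<close> therefore lies in
  \<open>W <#> K n\<close> for all \<open>n\<close>, hence in the closed set
  \<open>W\<close>.\<close>

lemma commuting_conjugates_normal:
  assumes W: "closed_subgroup G T W" "W \<noteq> {\<one>}" "finite (conjugates G W)"
    "pairwise (centralize_each_other G) (conjugates G W)"
  shows "W \<lhd> G"
proof -
  have sW: "subgroup W G" "W \<subseteq> carrier G" "closedin T W"
    using W closed_subgroup_subset by (auto simp: closed_subgroup_def)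
  let ?C = "closed_normal_closure G T W"
  have C: "closed_normal G T ?C" "W \<subseteq> ?C" using closed_normal_closure[OF sW(2)] .
  have "?C \<noteq> {\<one>}" using C(2) W(2) subgroup.one_closed[OF sW(1)] by blast
  then have gC: "closed_normal G T (\<gamma> ?C)" "\<gamma> ?C \<noteq> {\<one>}"
    by (intro closed_normal_lower_central C, intro lower_central_neq_one[OF Fitting_free C(1)])
  obtain m where m: "\<And>n. n \<ge> m \<Longrightarrow> \<gamma> (P' n) \<subseteq> \<gamma> (\<gamma> ?C)"
    using eventually_g_P'_subset[OF gC] by metis
  \<comment> \<open>From \<open>m\<close> on the inclusion in (v) holds for the normal closure of
    \<open>W\<close>; from the number of conjugates on, the bound \<open>n\<close> in (v) is
    met.\<close>
  define n0 where "n0 = max m (card (conjugates G W))"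
  have normal: "\<pi> n ` W \<lhd> Gs n" if n: "n \<ge> n0" for n
  proof (rule ccontr)
    assume "\<not> \<pi> n ` W \<lhd> Gs n"
    moreover have "closed_subgroup (Gs n) (Ts n) (\<pi> n ` W)" using epi.closed_subgroup_image[OF W(1)] .
    moreover have "finite (conjugates (Gs n) (\<pi> n ` W))"
      unfolding epi.conjugates_image[OF sW(2)] using W(3) by simp
    moreover have "card (conjugates (Gs n) (\<pi> n ` W)) \<le> n"
      unfolding epi.conjugates_image[OF sW(2)]
      using card_image_le[OF W(3), of "\<lambda>X. \<pi> n ` X"] n by (simp add: n0_def)
    moreover have "pairwise (centralize_each_other (Gs n)) (conjugates (Gs n) (\<pi> n ` W))"
      using epi.pairwise_centralize_image[OF sW(2) W(4)] .
    ultimately have "\<not> \<gamma>s n (P n) \<subseteq> \<gamma>s n (\<gamma>s n (closed_normal_closure (Gs n) (Ts n) (\<pi> n ` W)))"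
      using tower_cond(5) by metis
    moreover have "\<gamma>s n (P n) \<subseteq> \<gamma>s n (\<gamma>s n (closed_normal_closure (Gs n) (Ts n) (\<pi> n ` W)))"
    proof -
      let ?D = "closed_normal_closure (Gs n) (Ts n) (\<pi> n ` W)"
      have imW: "\<pi> n ` W \<subseteq> carrier (Gs n)" using sW(2) by auto
      have D: "closed_normal (Gs n) (Ts n) ?D" "\<pi> n ` W \<subseteq> ?D"
        using epi.H.closed_normal_closure[OF imW] .
      \<comment> \<open>By monotonicity of \<open>\<gamma>\<close> it suffices that the image of the
        normal closure lies in the normal closure of the image.\<close>
      have "?C \<subseteq> {x \<in> carrier G. \<pi> n x \<in> ?D}"
        using D sW(2) by (intro closed_normal_closure_minimal epi.closed_normal_preimage) auto
      then have CD: "\<pi> n ` ?C \<subseteq> ?D" by auto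
      have CG: "?C \<subseteq> carrier G" "\<gamma> ?C \<subseteq> carrier G" using closed_normal_subset C(1) gC(1) by auto
      have "\<gamma>s n (P n) = \<pi> n ` \<gamma> (P' n)" by (rule gs_P)
      also have "\<dots> \<subseteq> \<pi> n ` \<gamma> (\<gamma> ?C)" using m n by (intro image_mono) (simp add: n0_def)
      also have "\<dots> = \<gamma>s n (\<gamma>s n (\<pi> n ` ?C))"
        using epi.image_lower_central[OF CG(1), of n "c + 1"] epi.image_lower_central[OF CG(2), of n "c + 1"]
        by simp
      also have "\<dots> \<subseteq> \<gamma>s n (\<gamma>s n ?D)" by (intro epi.H.lower_central_mono CD)
      finally show ?thesis .
    qed
    ultimately show False by blast
  qed
  have "x \<otimes> w \<otimes> inv x \<in> W" if x: "x \<in> carrier G" and w: "w \<in> W" for x w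
  proof -
    have wG: "w \<in> carrier G" using w sW(2) by blast
    let ?z = "x \<otimes> w \<otimes> inv x"
    have large: "?z \<in> W <#> K n" if n: "n \<ge> n0" for n
    proof -
      have "\<pi> n ?z = \<pi> n x \<otimes>\<^bsub>Gs n\<^esub> \<pi> n w \<otimes>\<^bsub>Gs n\<^esub> inv\<^bsub>Gs n\<^esub> \<pi> n x" using x wG by simp
      also have "\<dots> \<in> \<pi> n ` W"
        using normal.inv_op_closed2[OF normal[OF n], of "\<pi> n x" "\<pi> n w"] x w by simp
      finally have "\<pi> n ` {?z} \<subseteq> \<pi> n ` W" by simp
      then show ?thesis using epi.subset_set_mult_kernel[of "{?z}" W n] x wG sW(2) by simp
    qed
    have "?z \<in> W <#> K n" for n
    proof (cases "n \<ge> n0")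
      case False
      then have "W <#> K n0 \<subseteq> W <#> K n" by (intro mono_set_mult kernel_antimono) auto
      then show ?thesis using large[of n0] by auto
    qed (rule large)
    then show ?thesis
      using x wG by (intro Inter_set_mult_closed[OF decseq_kernel closedin_kernel Inter_kernel sW(3)]) auto
  qed
  then show ?thesis using sW(1) by (simp add: normal_inv_iff)
qed

text \<open>A witness \<open>V\<close> against JNN_cF for \<open>H\<close> is cut down to
  \<open>V \<inter> U\<close>, with \<open>U\<close> open normal in \<open>G\<close>, so that
  \<open>U\<close> normalizes it. The commuting conjugates obtained from it give a \<open>W\<close>
  normal in \<open>G\<close>, hence \<open>\<gamma>(R) \<le> W\<close> inside a conjugate of
  \<open>V\<close>; as \<open>\<gamma>(R)\<close> is normal, it lies in \<open>V\<close>
  itself.\<close>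

lemma hereditarily_JNNF_limit: "hereditarily_JNNF c G T"
  unfolding hereditarily_JNNF_def
proof (intro allI impI)
  fix H assume H: "open_subgroup G T H"
  let ?H = "G\<lparr>carrier := H\<rparr>" and ?S = "subtopology T H"
  have cH: "closed_subgroup G T H" using open_imp_closed_subgroup[OF H] .
  have sH: "subgroup H G" "closedin T H" using cH by (auto simp: closed_subgroup_def)
  interpret H: profinite ?H ?S using profinite_subgroup[OF cH] .
  obtain U where U: "open_normal G T U" "U \<subseteq> H" using open_subgroup_contains_open_normal[OF H] by metis
  have nU: "U \<lhd> G" using U(1) by (simp add: open_normal_def)
  have sU: "subgroup U G" using nU by (rule normal_imp_subgroup)
  have lcH: "lower_central ?H ?S (c + 1) R = \<gamma> R" if "R \<subseteq> H" for R
    using lower_central_subgroup[OF cH that] .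
  show "JNNF c ?H ?S"
    unfolding H.JNNF_iff
  proof (intro conjI allI impI)
    fix R assume R: "open_normal ?H ?S R"
    then have oR: "open_subgroup G T R" "R \<subseteq> H"
      using H.open_normal_imp_open_subgroup[OF R] open_subgroup_subgroup_iff[OF H] by auto
    obtain N where N: "open_normal G T N" "N \<subseteq> R" using open_subgroup_contains_open_normal[OF oR(1)] by metis
    have "\<gamma> N \<subseteq> \<gamma> R" using N(2) by (rule lower_central_mono)
    moreover have "\<gamma> N \<noteq> {\<one>}" "\<one> \<in> \<gamma> N"
      using not_nilpotent[OF N(1)] closed_normal_one_mem[OF closed_normal_lower_central[OF open_normal_imp_closed_normal[OF N(1)]]] .
    ultimately show "lower_central ?H ?S (c + 1) R \<noteq> {\<one>\<^bsub>?H\<^esub>}"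
      unfolding lcH[OF oR(2)] by auto
  next
    fix V assume "closed_normal ?H ?S V \<and> V \<noteq> {\<one>\<^bsub>?H\<^esub>}"
    then have V: "V \<lhd> ?H" "closedin ?S V" "V \<noteq> {\<one>}" by (auto simp: closed_normal_def)
    have VH: "V \<subseteq> H" using subgroup.subset[OF normal_imp_subgroup[OF V(1)]] by simp
    have sV: "subgroup V G" "closedin T V"
      using incl_subgroup[OF sH(1) normal_imp_subgroup[OF V(1)]] V(2) sH(2) by (auto simp: closedin_subtopology_closed)
    have HG: "H \<subseteq> carrier G" using sH(1) by (rule subgroup.subset)
    have VG: "V \<subseteq> carrier G" using VH HG by blast
    have conjV: "inv h \<otimes> v \<otimes> h \<in> V" if "h \<in> H" "v \<in> V" for h v
      using normal.inv_op_closed1[OF V(1), of h v] that by (simp add: m_inv_consistent[OF sH(1)])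
    show "\<exists>R. open_normal ?H ?S R \<and> lower_central ?H ?S (c + 1) R \<subseteq> V"
    proof (rule ccontr)
      assume neg: "\<not> ?thesis"
      have no: "\<not> \<gamma> R \<subseteq> V" if R: "open_normal G T R" for R
      proof
        assume *: "\<gamma> R \<subseteq> V"
        have "open_normal ?H ?S (R \<inter> H)"
          using R normal_Int_subgroup[OF sH(1), of R] by (auto simp: open_normal_def openin_subtopology)
        moreover have "\<gamma> (R \<inter> H) \<subseteq> V" using * lower_central_mono[of "R \<inter> H" R] by blast
        ultimately show False using neg lcH[of "R \<inter> H"] by auto
      qed
      let ?V = "V \<inter> U"
      \<comment> \<open>Commutators of \<open>V\<close> and \<open>U\<close> lie in
        \<open>V \<inter> U\<close>; were it trivial, \<open>V\<close> would centralize
        \<open>U\<close>.\<close>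
      have "?V \<noteq> {\<one>}"
      proof
        assume triv: "?V = {\<one>}"
        have "v = \<one>" if v: "v \<in> V" for v
        proof (rule centralizer_open_normal_trivial[OF Fitting_free JNNF_limit U(1)])
          show vG: "v \<in> carrier G" using v VG by blast
          fix u assume u: "u \<in> U"
          have uG: "u \<in> carrier G" using u sU subgroup.subset by blast
          have "commutator G v u \<in> U" using commutator_in_normal(2)[OF nU vG uG u] .
          moreover have "commutator G v u \<in> V"
          proof -
            have "inv v \<otimes> (inv u \<otimes> v \<otimes> u) \<in> V"
              using conjV[of u v] u U(2) v sV(1) by (auto intro: subgroup.m_closed subgroup.m_inv_closed)
            then show ?thesis using vG uG by (simp add: commutator_def m_assoc)
          qed
          ultimately have "commutator G v u = \<one>" using triv by blast
          then show "v \<otimes> u = u \<otimes> v" using commutator_eq_one_iff vG uG by blast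
        qed
        then show False using V(3) subgroup.one_closed[OF sV(1)] by blast
      qed
      moreover have "closed_subgroup G T ?V"
        using sV sU open_normal_imp_closed_normal[OF U(1)] subgroups_Inter_pair
        by (simp add: closed_subgroup_def closed_normal_def closedin_Int)
      moreover have "conj_set u ?V = ?V" if u: "u \<in> U" for u
      proof -
        have uG: "u \<in> carrier G" using u sU subgroup.subset by blast
        have VUG: "?V \<subseteq> carrier G" using VG by blast
        have le: "conj_set w ?V \<subseteq> ?V" if "w \<in> U" for w
          using that U(2) conjV normal.inv_op_closed1[OF nU] VG sU subgroup.subset[OF sU]
          unfolding conj_set_def by auto
        have "?V = conj_set u (conj_set (inv u) ?V)"
          using uG VUG by (simp add: conj_set_mult conj_set_one)
        also have "\<dots> \<subseteq> conj_set u ?V"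
          using le[of "inv u"] subgroup.m_inv_closed[OF sU u] by (intro conj_set_mono) simp
        finally show ?thesis using le[OF u] by blast
      qed
      ultimately obtain W a where W: "closed_subgroup G T W" "W \<noteq> {\<one>}" "a \<in> carrier G" "W \<subseteq> conj_set a ?V"
        "finite (conjugates G W)" "pairwise (centralize_each_other G) (conjugates G W)"
        using ex_commuting_conjugates[OF U(1), of ?V] by (metis inf_le2)
      have "W \<lhd> G" using commuting_conjugates_normal[OF W(1,2,5,6)] .
      then have nW: "closed_normal G T W" using W(1) by (simp add: closed_normal_def closed_subgroup_def)
      obtain R where R: "open_normal G T R" "\<gamma> R \<subseteq> W"
        using JNNF_limit nW W(2) unfolding JNNF_iff by metis
      have gR: "\<gamma> R \<lhd> G"
        using closed_normal_lower_central[OF open_normal_imp_closed_normal[OF R(1)]] by (simp add: closed_normal_def)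
      have "\<gamma> R = conj_set (inv a) (\<gamma> R)" using conj_set_normal[OF gR, of "inv a"] W(3) by simp
      also have "\<dots> \<subseteq> conj_set (inv a) (conj_set a ?V)" using R(2) W(4) by (intro conj_set_mono) blast
      also have "\<dots> = ?V"
      proof -
        have "?V \<subseteq> carrier G" using VG by blast
        then show ?thesis using W(3) by (simp add: conj_set_mult conj_set_one)
      qed
      finally show False using no[OF R(1)] by blast
    qed
  qed
qed

end

section \<open>Construction of the tower\<close>

context profinite_epi
begin

lemma image_preimage: "B \<subseteq> carrier H \<Longrightarrow> \<pi> ` {x \<in> carrier G. \<pi> x \<in> B} = B"
  using surj by (auto simp: image_iff)

text \<open>The preimage of a maximal invariant subgroup of the image of \<open>A\<close> is maximal
  in \<open>A\<close>; the condition on the kernel provides the correspondence of subgroups.\<close>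

lemma image_M_sub_subset:
  assumes A: "closed_normal G T A" and ker: "kernel G H \<pi> \<subseteq> A"
  shows "\<pi> ` M_sub G T A \<subseteq> M_sub H S (\<pi> ` A)"
proof
  have sA: "subgroup A G" "A \<subseteq> carrier G"
    using A G.closed_normal_subset by (auto simp: closed_normal_def normal_imp_subgroup)
  fix y assume "y \<in> \<pi> ` M_sub G T A"
  then obtain x where x: "x \<in> M_sub G T A" "y = \<pi> x" by blast
  have "y \<in> B'" if B': "H.max_open_invariant (\<pi> ` A) B'" for B'
  proof -
    have poi: "proper_open_invariant H S (\<pi> ` A) B'" using B' by (simp add: H.max_open_invariant_def)
    have nB': "B' \<lhd> H" "B' \<subset> \<pi> ` A" "subgroup B' H"
      using poi by (auto simp: proper_open_invariant_def normal_imp_subgroup)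
    define B where "B = {x \<in> carrier G. \<pi> x \<in> B'}"
    have im: "\<pi> ` B = B'" unfolding B_def by (rule image_preimage[OF subgroup.subset[OF nB'(3)]])
    have nB: "B \<lhd> G" unfolding B_def by (rule normal_preimage[OF nB'(1)])
    have kB: "kernel G H \<pi> \<subseteq> B"
      using subgroup.one_closed[OF nB'(3)] by (auto simp: kernel_def B_def)
    have "B \<subseteq> carrier G" "\<pi> ` B \<subseteq> \<pi> ` A"
      using im nB'(2) by (auto simp: B_def)
    then have BA: "B \<subseteq> A"
      by (intro subset_if_image_subset[OF _ sA(1) ker])
    have "B \<subset> A" using BA im nB'(2) by blast
    moreover have "openin (subtopology T A) B"
    proof -
      obtain O' where O': "openin S O'" "B' = O' \<inter> \<pi> ` A"
        using poi by (auto simp: proper_open_invariant_def openin_subtopology)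
      have "B = {x \<in> carrier G. \<pi> x \<in> O'} \<inter> A"
        using BA sA(2) by (auto simp: B_def O'(2))
      then show ?thesis
        using openin_preimage[OF O'(1)] by (auto simp: openin_subtopology)
    qed
    ultimately have pB: "proper_open_invariant G T A B" using nB by (simp add: proper_open_invariant_def)
    have "C = B" if C: "proper_open_invariant G T A C" "B \<subseteq> C" for C
    proof -
      have sC: "C \<lhd> G" "C \<subset> A" "subgroup C G"
        using C(1) by (auto simp: proper_open_invariant_def normal_imp_subgroup)
      have kC: "kernel G H \<pi> \<subseteq> C" using kB C(2) by blast
      have "\<not> \<pi> ` A \<subseteq> \<pi> ` C"
        using subset_if_image_subset[OF sA(2) sC(3) kC] sC(2) by blast
      then have "\<pi> ` C \<subset> \<pi> ` A" using sC(2) by blast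
      moreover have "B' \<subseteq> \<pi> ` C" using C(2) im by blast
      ultimately have "proper_open_invariant H S (\<pi> ` A) (\<pi> ` C)"
        by (intro H.proper_open_invariant_mono[OF closed_normal_image[OF A] poi] normal_image sC(1))
      then have "\<pi> ` C = B'" using B' \<open>B' \<subseteq> \<pi> ` C\<close> unfolding H.max_open_invariant_def by blast
      then have "C \<subseteq> B" using subgroup.subset[OF sC(3)] by (auto simp: B_def)
      then show ?thesis using C(2) by blast
    qed
    with pB have "G.max_open_invariant A B" unfolding G.max_open_invariant_def by blast
    then have "x \<in> B" using x(1) unfolding G.M_sub_eq by blast
    then show ?thesis using x(2) by (simp add: B_def)
  qed
  moreover have "y \<in> \<pi> ` A" using x by (auto simp: G.M_sub_eq)
  ultimately show "y \<in> M_sub H S (\<pi> ` A)" unfolding H.M_sub_eq by blast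
qed

end

section \<open>Choice of the subgroups P_n\<close>

context profinite
begin

text \<open>The demands on \<open>P_{n+1}\<close> once \<open>P_n\<close> is given.
  \<open>Q n\<close> makes the kernels intersect trivially, \<open>M_sub\<close> serves (iii), the
  clause on \<open>N\<close> serves (iv) and the last one (v). There \<open>P0\<close> is a barrier:
  a violation of (v) would push \<open>\<gamma>(P_n)\<close> into it.\<close>

definition tower_step :: "nat \<Rightarrow> nat \<Rightarrow> (nat \<Rightarrow> 'a set) \<Rightarrow> 'a set \<Rightarrow> 'a set \<Rightarrow> bool" where
  "tower_step c n Q P P' \<longleftrightarrow> P' \<subseteq> P \<and> P' \<subseteq> Q n \<and>
    lower_central G T (c + 1) P' \<subseteq> M_sub G T (lower_central G T (c + 1) P) \<and>
    (\<forall>N. closed_normal G T N \<longrightarrow> N \<subseteq> P \<or> lower_central G T (c + 1) P' \<subseteq> lower_central G T (c + 1) N) \<and>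
    (\<exists>P0. open_normal G T P0 \<and> \<not> lower_central G T (c + 1) P \<subseteq> P0 \<and>
      commuting_conjugates_within n (lower_central G T (c + 1) P') P0)"

lemma ex_tower_step:
  assumes FF: "Fitting_free G T" and her: "hereditarily_JNNF c G T" and fg: "finitely_generated G T"
    and Q: "decseq Q" "\<And>n. open_normal G T (Q n)" "\<And>U. open_normal G T U \<Longrightarrow> \<exists>n::nat. Q n \<subseteq> U"
    and P: "open_normal G T P"
  shows "\<exists>P'. open_normal G T P' \<and> tower_step c n Q P P'"
proof -
  let ?g = "lower_central G T (c + 1)"
  have J: "JNNF c G T" using hereditarily_JNNF_imp_JNNF[OF her] .
  define A where "A = ?g P"
  have A: "closed_normal G T A" "A \<noteq> {\<one>}"
    using closed_normal_lower_central[OF open_normal_imp_closed_normal[OF P], of "c + 1"] J P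
    unfolding A_def JNNF_iff by simp_all
  have small: "\<exists>R. open_normal G T R \<and> ?g R \<subseteq> Z" if "closed_normal G T Z" "Z \<noteq> {\<one>}" for Z
    using J that unfolding JNNF_iff by blast
  obtain R1 where R1: "open_normal G T R1" "?g R1 \<subseteq> M_sub G T A"
    using small[OF closed_normal_M_sub[OF A(1)] M_sub_neq_one[OF FF J A]] by metis
  obtain k where k: "\<And>N. closed_normal G T N \<Longrightarrow> N \<subseteq> P \<or> ?g (Q k) \<subseteq> ?g N"
    using obliquity[OF FF J Q P] by metis
  \<comment> \<open>A non-trivial element of \<open>\<gamma>(P)\<close>, to be kept outside the
    barrier \<open>P0\<close>.\<close>
  obtain a where a: "a \<in> A" "a \<notin> {\<one>}" using A closed_normal_one_mem[OF A(1)] by blast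
  then have "a \<in> carrier G" using closed_normal_subset[OF A(1)] by blast
  then obtain P0 where P0: "open_normal G T P0" "a \<notin> P0"
    using separate_closed_normal[OF closed_normal_one _ a(2)] by metis
  obtain Z where Z: "closed_normal G T Z" "Z \<noteq> {\<one>}" "commuting_conjugates_within n Z P0"
    using commuting_conjugates_bound[OF FF her fg P0(1), of n] by metis
  obtain R2 where R2: "open_normal G T R2" "?g R2 \<subseteq> Z" using small[OF Z(1,2)] by metis
  \<comment> \<open>Every demand is inherited by smaller open normal subgroups, so the bounds are
    simply intersected.\<close>
  define P' where "P' = P \<inter> Q n \<inter> R1 \<inter> Q k \<inter> R2"
  have mono: "?g P' \<subseteq> ?g R1" "?g P' \<subseteq> ?g (Q k)" "?g P' \<subseteq> ?g R2"
    unfolding P'_def by (rule lower_central_mono; blast)+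
  have "open_normal G T P'"
    unfolding P'_def by (intro open_normal_Int P Q R1 R2)
  moreover have "tower_step c n Q P P'"
    unfolding tower_step_def
  proof (intro conjI)
    show "P' \<subseteq> P" "P' \<subseteq> Q n" unfolding P'_def by auto
    show "?g P' \<subseteq> M_sub G T (?g P)" using mono(1) R1(2) unfolding A_def by blast
    show "\<forall>N. closed_normal G T N \<longrightarrow> N \<subseteq> P \<or> ?g P' \<subseteq> ?g N"
      using k mono(2) by blast
    have "commuting_conjugates_within n (?g P') P0"
      using commuting_conjugates_within_mono[OF Z(3)] mono(3) R2(2) by blast
    moreover have "\<not> ?g P \<subseteq> P0" using a P0(2) unfolding A_def by blast
    ultimately show "\<exists>P0. open_normal G T P0 \<and> \<not> ?g P \<subseteq> P0 \<and> commuting_conjugates_within n (?g P') P0"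
      using P0(1) by blast
  qed
  ultimately show ?thesis by blast
qed

end

section \<open>The tower of quotients\<close>

locale nilpotent_filtration = profinite +
  fixes c :: nat and Q P :: "nat \<Rightarrow> 'a set"
  assumes base: "\<And>U. open_normal G T U \<Longrightarrow> \<exists>n. Q n \<subseteq> U"
    and open_normal_P: "\<And>n. open_normal G T (P n)"
    and not_nilpotent: "\<And>R. open_normal G T R \<Longrightarrow> lower_central G T (c + 1) R \<noteq> {\<one>}"
    and step: "\<And>n. tower_step c n Q (P n) (P (Suc n))"
begin

definition A :: "nat \<Rightarrow> 'a set" where
  "A n = lower_central G T (c + 1) (P n)"

text \<open>With the shift by two, \<open>\<gamma>(P_{n+1})\<close> survives in \<open>G_n\<close>
  but vanishes in \<open>G_{n-1}\<close>, as (iii) demands of \<open>\<gamma>(Q_n)\<close>.\<close>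

abbreviation N :: "nat \<Rightarrow> 'a set" where
  "N n \<equiv> A (Suc (Suc n))"

abbreviation Gs :: "nat \<Rightarrow> 'a set monoid" where
  "Gs n \<equiv> G Mod N n"

abbreviation Ts :: "nat \<Rightarrow> 'a set topology" where
  "Ts n \<equiv> quotient_topology G T (N n)"

abbreviation \<pi> :: "nat \<Rightarrow> 'a \<Rightarrow> 'a set" where
  "\<pi> n \<equiv> \<lambda>x. N n #> x"

text \<open>On cosets of \<open>N (Suc n)\<close> this is the canonical projection, with no
  representative to be chosen.\<close>

abbreviation \<rho> :: "nat \<Rightarrow> 'a set \<Rightarrow> 'a set" where
  "\<rho> n \<equiv> \<lambda>C. N n <#> C"

lemma A_normal: "closed_normal G T (A n)"
  unfolding A_def by (intro closed_normal_lower_central open_normal_imp_closed_normal open_normal_P)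

lemma A_subgroup: "subgroup (A n) G"
  using A_normal[of n] by (simp add: closed_normal_def normal_imp_subgroup)

lemma A_carrier: "A n \<subseteq> carrier G"
  using A_subgroup by (rule subgroup.subset)

lemma A_neq_one: "A n \<noteq> {\<one>}"
  unfolding A_def by (rule not_nilpotent[OF open_normal_P])

lemma A_M_sub: "A (Suc n) \<subseteq> M_sub G T (A n)"
  using step[of n] unfolding tower_step_def A_def by blast

lemma A_strict: "A (Suc n) \<subset> A n"
  using A_M_sub M_sub_strict[OF A_normal A_neq_one] by blast

lemma A_Suc: "A (Suc n) \<subseteq> A n"
  using A_strict[of n] by blast

lemma A_P: "A n \<subseteq> P n"
  unfolding A_def
  by (intro lower_central_subset closed_normal_imp_subgroup open_normal_imp_closed_normal open_normal_P)

lemma P_Suc: "P (Suc n) \<subseteq> P n" "P (Suc n) \<subseteq> Q n"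
  using step[of n] unfolding tower_step_def by blast+

lemma P_carrier: "P n \<subseteq> carrier G"
  using closed_normal_subset[OF open_normal_imp_closed_normal[OF open_normal_P]] .

lemma Inter_A: "(\<Inter>n. N n) = {\<one>}"
proof -
  have "x = \<one>" if x: "x \<in> (\<Inter>n. N n)" for x
  proof (rule ccontr)
    assume "x \<noteq> \<one>"
    moreover have "x \<in> carrier G" using x A_carrier by blast
    ultimately obtain U where U: "open_normal G T U" "x \<notin> U"
      using separate_closed_normal[OF closed_normal_one, of x] by auto
    obtain n where n: "Q n \<subseteq> U" using base[OF U(1)] by blast
    have "N n \<subseteq> Q n"
      using A_P[of "Suc (Suc n)"] P_Suc(1)[of "Suc n"] P_Suc(2)[of n] by blast
    then show False using x n U(2) by blast
  qed
  moreover have "\<one> \<in> (\<Inter>n. N n)" using closed_normal_one_mem[OF A_normal] by blast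
  ultimately show ?thesis by blast
qed

sublocale epi: profinite_epi G T "Gs n" "Ts n" "\<pi> n" for n
  by (rule profinite_epi_quotient[OF A_normal])

lemma kernel_eq: "kernel G (Gs n) (\<pi> n) = N n"
  using A_normal by (intro kernel_quotient) (simp add: closed_normal_def)

lemma compat:
  assumes "x \<in> carrier G"
  shows "\<rho> n (\<pi> (Suc n) x) = \<pi> n x"
proof -
  have "N n <#> N (Suc n) = N n"
    using set_mult_incl1[OF A_subgroup A_carrier] set_mult_minimal[OF A_subgroup order_refl A_Suc] by blast
  moreover have "\<rho> n (\<pi> (Suc n) x) = (N n <#> N (Suc n)) #> x"
    using assms A_carrier by (simp add: setmult_rcos_assoc)
  ultimately show ?thesis by simp
qed

lemma profinite_tower: "profinite_tower G T Gs Ts \<rho> \<pi>"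
proof
  show "(\<Inter>n. kernel G (Gs n) (\<pi> n)) = {\<one>}" unfolding kernel_eq by (rule Inter_A)
qed (rule compat)

lemma inverse_system: "inverse_system Gs Ts \<rho>"
  unfolding inverse_system_def
proof (intro conjI allI)
  fix n
  show "profinite_group (Gs n) (Ts n)" using epi.H.profinite_group .
  have car: "carrier (Gs m) = \<pi> m ` carrier G" for m by (simp only: epi.surj)
  have "\<rho> n \<in> hom (Gs (Suc n)) (Gs n)"
  proof (rule homI)
    fix X assume "X \<in> carrier (Gs (Suc n))"
    then obtain x where x: "x \<in> carrier G" "X = \<pi> (Suc n) x" unfolding car by blast
    show "\<rho> n X \<in> carrier (Gs n)" unfolding x(2) compat[OF x(1)] car using x(1) by blast
    fix Y assume "Y \<in> carrier (Gs (Suc n))"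
    then obtain y where y: "y \<in> carrier G" "Y = \<pi> (Suc n) y" unfolding car by blast
    have "X \<otimes>\<^bsub>Gs (Suc n)\<^esub> Y = \<pi> (Suc n) (x \<otimes> y)" using epi.hom_mult[OF x(1) y(1), of "Suc n"] x y by simp
    then have "\<rho> n (X \<otimes>\<^bsub>Gs (Suc n)\<^esub> Y) = \<pi> n (x \<otimes> y)" using compat[of "x \<otimes> y" n] x y by simp
    also have "\<dots> = \<pi> n x \<otimes>\<^bsub>Gs n\<^esub> \<pi> n y" using epi.hom_mult[OF x(1) y(1)] .
    also have "\<dots> = \<rho> n X \<otimes>\<^bsub>Gs n\<^esub> \<rho> n Y" unfolding x(2) y(2) compat[OF x(1)] compat[OF y(1)] ..
    finally show "\<rho> n (X \<otimes>\<^bsub>Gs (Suc n)\<^esub> Y) = \<rho> n X \<otimes>\<^bsub>Gs n\<^esub> \<rho> n Y" .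
  qed
  moreover have "\<rho> n ` carrier (Gs (Suc n)) = carrier (Gs n)"
    unfolding car image_image by (intro image_cong compat) simp
  ultimately show "\<rho> n \<in> epi (Gs (Suc n)) (Gs n)" by (simp add: epi_def)
  show "continuous_map (Ts (Suc n)) (Ts n) (\<rho> n)"
    unfolding continuous_map_quotient_topology_iff[OF topspace]
  proof
    show "\<rho> n \<in> carrier (Gs (Suc n)) \<rightarrow> topspace (Ts n)"
      using \<open>\<rho> n \<in> hom (Gs (Suc n)) (Gs n)\<close> epi.H.topspace[of n] by (simp add: hom_def)
    show "continuous_map T (Ts n) (\<lambda>x. \<rho> n (\<pi> (Suc n) x))"
      by (rule continuous_map_eq[OF epi.cont]) (simp add: compat)
  qed
qed

abbreviation \<gamma>s :: "nat \<Rightarrow> 'a set set \<Rightarrow> 'a set set" where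
  "\<gamma>s n X \<equiv> lower_central (Gs n) (Ts n) (c + 1) X"

abbreviation Ps :: "nat \<Rightarrow> 'a set set" where
  "Ps n \<equiv> \<pi> n ` P n"

lemma \<gamma>s_Ps: "\<gamma>s n (Ps n) = \<pi> n ` A n"
  using epi.image_lower_central[OF P_carrier[of n], of n "c + 1"] by (simp add: A_def)

lemma Qs: "\<rho> n ` Ps (Suc n) = \<pi> n ` P (Suc n)"
  unfolding image_image using P_carrier by (intro image_cong compat) auto

lemma \<gamma>s_Qs: "\<gamma>s n (\<rho> n ` Ps (Suc n)) = \<pi> n ` A (Suc n)"
  unfolding Qs using epi.image_lower_central[OF P_carrier[of "Suc n"], of n "c + 1"] by (simp add: A_def)

lemma N_subset: "N n \<subseteq> A (Suc n)" "N n \<subseteq> A n"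
  using A_Suc[of n] A_Suc[of "Suc n"] by auto

text \<open>Equality would lift to \<open>P n \<le> P (Suc n)\<close>, since the kernel lies in
  \<open>P (Suc n)\<close>, and contradict the strict decrease of \<open>A\<close>.\<close>

lemma Qs_psubset: "\<rho> n ` Ps (Suc n) \<subset> Ps n"
proof -
  have sP: "subgroup (P (Suc n)) G"
    using open_normal_P[of "Suc n"] by (simp add: open_normal_def normal_imp_subgroup)
  have "\<not> Ps n \<subseteq> \<pi> n ` P (Suc n)"
  proof
    assume "Ps n \<subseteq> \<pi> n ` P (Suc n)"
    moreover have "kernel G (Gs n) (\<pi> n) \<subseteq> P (Suc n)"
      unfolding kernel_eq using N_subset(1)[of n] A_P[of "Suc n"] by blast
    ultimately have "P n \<subseteq> P (Suc n)"
      using epi.subset_if_image_subset[OF P_carrier sP] by blast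
    then have "A n \<subseteq> A (Suc n)" unfolding A_def by (rule lower_central_mono)
    then show False using A_strict by blast
  qed
  then show ?thesis unfolding Qs using image_mono[OF P_Suc(1)[of n], of "\<pi> n"] by blast
qed

lemma image_A_neq_one:
  assumes "m < Suc (Suc n)"
  shows "{\<one>\<^bsub>Gs n\<^esub>} \<subset> \<pi> n ` A m"
proof -
  have "decseq A" using A_Suc by (intro decseq_SucI)
  then have "A (Suc n) \<subseteq> A m" using assms by (intro decseqD[of A]) simp_all
  then have "\<not> A m \<subseteq> N n" using A_strict[of "Suc n"] by blast
  then have "\<not> \<pi> n ` A m \<subseteq> {\<one>\<^bsub>Gs n\<^esub>}"
    by (simp only: epi.image_subset_one_iff[OF A_carrier] kernel_eq not_False_eq_True)
  moreover have "\<one>\<^bsub>Gs n\<^esub> \<in> \<pi> n ` A m"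
    using subgroup.one_closed[OF epi.subgroup_img_is_subgroup[OF A_subgroup]] .
  ultimately show ?thesis by blast
qed

lemma image_A_M_sub: "\<pi> n ` A (Suc n) \<subseteq> M_sub (Gs n) (Ts n) (\<pi> n ` A n)"
  using epi.image_M_sub_subset[OF A_normal, of n n] kernel_eq[of n] N_subset(2)[of n] A_M_sub[of n] by blast

lemma M_sub_psubset: "M_sub (Gs n) (Ts n) (\<pi> n ` A n) \<subset> \<pi> n ` A n"
  using image_A_neq_one[of n n] by (intro epi.H.M_sub_strict epi.closed_normal_image A_normal) auto

text \<open>By \<open>\<gamma>s_Qs\<close> this group is \<open>\<gamma>(Q_{n+1})\<close>, so the
  inequality between the kernel and \<open>\<gamma>(Q_n)\<close> in (iii) is an equality in this
  tower.\<close>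

lemma kernel_\<rho>: "kernel (Gs (Suc n)) (Gs n) (\<rho> n) = \<pi> (Suc n) ` A (Suc (Suc n))"
proof -
  have iff: "\<rho> n (\<pi> (Suc n) x) = \<one>\<^bsub>Gs n\<^esub> \<longleftrightarrow> x \<in> N n" if "x \<in> carrier G" for x
    unfolding compat[OF that] using kernel_eq[of n] that by (auto simp: kernel_def)
  have "kernel (Gs (Suc n)) (Gs n) (\<rho> n) = {X \<in> \<pi> (Suc n) ` carrier G. \<rho> n X = \<one>\<^bsub>Gs n\<^esub>}"
    unfolding kernel_def epi.surj by blast
  also have "\<dots> = \<pi> (Suc n) ` {x \<in> carrier G. \<rho> n (\<pi> (Suc n) x) = \<one>\<^bsub>Gs n\<^esub>}" by blast
  also have "{x \<in> carrier G. \<rho> n (\<pi> (Suc n) x) = \<one>\<^bsub>Gs n\<^esub>} = N n"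
    using iff A_carrier by blast
  finally show ?thesis .
qed

text \<open>A violation \<open>V\<close> of (v) is lifted to its preimage \<open>W\<close>, whose
  conjugates commute modulo \<open>N n\<close>. Confinement puts \<open>W\<close> into the barrier
  \<open>P0\<close>, hence the normal closure of \<open>V\<close> into the image of
  \<open>P0\<close>, and the assumed inclusion yields \<open>A n \<le> P0 N n\<close>. As
  \<open>N n \<le> M(A n)\<close>, this gives \<open>A n \<le> P0\<close>, which was
  excluded.\<close>

lemma no_commuting_conjugates:
  assumes V: "closed_subgroup (Gs n) (Ts n) V" and nV: "\<not> V \<lhd> Gs n"
    and fin: "finite (conjugates (Gs n) V)" and card: "card (conjugates (Gs n) V) \<le> n"
    and pw: "pairwise (centralize_each_other (Gs n)) (conjugates (Gs n) V)"
    and sub: "\<gamma>s n (Ps n) \<subseteq> \<gamma>s n (\<gamma>s n (closed_normal_closure (Gs n) (Ts n) V))"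
  shows False
proof -
  define W where "W = {x \<in> carrier G. \<pi> n x \<in> V}"
  have VG: "V \<subseteq> carrier (Gs n)" using epi.H.closed_subgroup_subset[OF V] .
  have sV: "subgroup V (Gs n)" using V by (simp add: closed_subgroup_def)
  have im: "\<pi> n ` W = V" unfolding W_def by (rule epi.image_preimage[OF VG])
  have W: "closed_subgroup G T W" unfolding W_def by (rule epi.closed_subgroup_preimage[OF V])
  have WG: "W \<subseteq> carrier G" "subgroup W G" using W closed_subgroup_subset by (auto simp: closed_subgroup_def)
  have kW: "N n \<subseteq> W"
  proof
    fix x assume "x \<in> N n"
    then have "x \<in> kernel G (Gs n) (\<pi> n)" by (simp only: kernel_eq)
    then have "x \<in> carrier G" "\<pi> n x = \<one>\<^bsub>Gs n\<^esub>" unfolding kernel_def by blast+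
    then show "x \<in> W"
      unfolding W_def using subgroup.one_closed[OF sV] by (simp only: mem_Collect_eq)
  qed
  have nW: "\<not> W \<lhd> G" using epi.normal_image[of W n] im nV by metis
  have cW: "closed_subgroup G T (conj_set g W)" "N n \<subseteq> conj_set g W" if "g \<in> carrier G" for g
    using closed_subgroup_conj_set[OF W that] conj_set_mono[OF kW, of g]
      conj_set_normal[of "N n" g] that A_normal[of "Suc (Suc n)"] by (auto simp: closed_normal_def)
  \<comment> \<open>All conjugates of \<open>W\<close> contain the kernel, so taking images
    identifies none of them and the bound \<open>n\<close> carries over.\<close>
  have inj: "X = Y" if XY: "X \<in> conjugates G W" "Y \<in> conjugates G W" "\<pi> n ` X = \<pi> n ` Y" for X Y
  proof -
    have "closed_subgroup G T X" "closed_subgroup G T Y" "N n \<subseteq> X" "N n \<subseteq> Y"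
      using XY(1,2) cW unfolding conjugates_eq[OF WG(1)] by blast+
    then show ?thesis
      using epi.subset_if_image_subset[of X Y n] epi.subset_if_image_subset[of Y X n] XY(3)
        closed_subgroup_subset[of X] closed_subgroup_subset[of Y] kernel_eq[of n]
      by (simp add: closed_subgroup_def)
  qed
  have cim: "conjugates (Gs n) V = (\<lambda>X. \<pi> n ` X) ` conjugates G W"
    using epi.conjugates_image[OF WG(1), of n] unfolding im .
  have "inj_on (\<lambda>X. \<pi> n ` X) (conjugates G W)" using inj by (intro inj_onI)
  then have fcW: "finite (conjugates G W)" "card (conjugates G W) \<le> n"
    using fin card unfolding cim by (auto dest: finite_imageD simp: card_image)
  obtain P0 where P0: "open_normal G T P0" "\<not> A n \<subseteq> P0"
    "commuting_conjugates_within n (A (Suc n)) P0"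
    using step[of n] unfolding tower_step_def A_def[symmetric] by metis
  \<comment> \<open>Confinement is used with \<open>K = N n = A (n + 2)\<close> and
    \<open>Z = A (Suc n)\<close>, which \<open>K\<close> does not contain because the
    \<open>A\<close> decrease strictly.\<close>
  have "W \<subseteq> P0"
  proof (rule P0(3)[unfolded commuting_conjugates_within_def, THEN spec, THEN mp, THEN spec, THEN mp, of "N n" W]; (intro conjI)?)
    show "closed_subgroup G T (N n)" "closed_subgroup G T W" "\<not> W \<lhd> G"
      "finite (conjugates G W)" "card (conjugates G W) \<le> n"
      using closed_normal_imp_subgroup[OF A_normal] W nW fcW by simp_all
    show "\<not> A (Suc n) \<subseteq> N n" using A_strict[of "Suc n"] by blast
    show "\<forall>g x y. g \<in> carrier G \<and> conj_set g W \<noteq> W \<and> x \<in> W \<and> y \<in> conj_set g W \<longrightarrow> commutator G x y \<in> N n"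
    proof (intro allI impI, elim conjE)
      fix g x y assume g: "g \<in> carrier G" "conj_set g W \<noteq> W" and xy: "x \<in> W" "y \<in> conj_set g W"
      have G: "x \<in> carrier G" "y \<in> carrier G" using xy WG(1) conj_set_carrier[OF WG(1) g(1)] by auto
      have "conj_set g W \<in> conjugates G W" using g(1) unfolding conjugates_eq[OF WG(1)] by blast
      moreover have "W \<in> conjugates G W"
        using conj_set_one[OF WG(1)] unfolding conjugates_eq[OF WG(1)] by (metis (mono_tags, lifting) mem_Collect_eq one_closed)
      ultimately have im_conj: "\<pi> n ` W \<noteq> \<pi> n ` conj_set g W" "\<pi> n ` W \<in> conjugates (Gs n) V"
        "\<pi> n ` conj_set g W \<in> conjugates (Gs n) V"
        using inj g(2) unfolding cim by blast+
      have "centralize_each_other (Gs n) (\<pi> n ` W) (\<pi> n ` conj_set g W)"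
        by (rule pairwiseD[OF pw im_conj(2,3,1)])
      note bspec[OF bspec[OF this[unfolded centralize_each_other_def] imageI[OF xy(1)]] imageI[OF xy(2)]]
      then have "\<pi> n x \<otimes>\<^bsub>Gs n\<^esub> \<pi> n y = \<pi> n y \<otimes>\<^bsub>Gs n\<^esub> \<pi> n x" .
      then have "commutator (Gs n) (\<pi> n x) (\<pi> n y) = \<one>\<^bsub>Gs n\<^esub>"
        by (subst epi.H.commutator_eq_one_iff) (use G in auto)
      then have "commutator G x y \<in> kernel G (Gs n) (\<pi> n)"
        using epi.image_commutator[OF G, of n] G by (simp add: kernel_def)
      then show "commutator G x y \<in> N n" by (simp only: kernel_eq)
    qed
  qed
  then have "V \<subseteq> \<pi> n ` P0" using im by blast
  then have "closed_normal_closure (Gs n) (Ts n) V \<subseteq> \<pi> n ` P0" (is "?C \<subseteq> _")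
    by (intro epi.H.closed_normal_closure_minimal epi.closed_normal_image open_normal_imp_closed_normal P0(1))
  moreover have "\<gamma>s n (\<gamma>s n ?C) \<subseteq> ?C"
  proof -
    have C: "closed_subgroup (Gs n) (Ts n) ?C"
      using epi.H.closed_normal_closure(1)[OF VG] by (rule epi.H.closed_normal_imp_subgroup)
    show ?thesis
      using epi.H.lower_central_subset[OF C, of "c + 1"]
        epi.H.lower_central_subset[OF epi.H.closed_subgroup_lower_central[OF C, of "c + 1"], of "c + 1"] by blast
  qed
  ultimately have "\<pi> n ` A n \<subseteq> \<pi> n ` P0" using sub unfolding \<gamma>s_Ps by blast
  then have "A n \<subseteq> P0 <#> kernel G (Gs n) (\<pi> n)"
    by (rule epi.subset_set_mult_kernel[OF A_carrier closed_normal_subset[OF open_normal_imp_closed_normal[OF P0(1)]]])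
  also have "\<dots> = P0 <#> N n" by (simp only: kernel_eq)
  also have "\<dots> \<subseteq> P0 <#> M_sub G T (A n)"
    using N_subset(1)[of n] A_M_sub[of n] by (intro mono_set_mult) auto
  finally have "A n \<subseteq> P0"
    by (rule subset_set_mult_M_sub[OF A_normal open_normal_imp_closed_normal[OF P0(1)]])
  then show False using P0(2) by simp
qed

lemma tower_conditions: "tower_conditions c Gs Ts \<rho> Ps"
  unfolding tower_conditions_def Let_def
proof (intro allI conjI)
  fix n
  show "virtually_nilpotent c (Gs n) (Ts n)"
    unfolding epi.virtually_nilpotent_iff
    using open_normal_P[of "Suc (Suc n)"] kernel_eq[of n] by (intro exI[of _ "P (Suc (Suc n))"]) (simp add: A_def)
  show "\<rho> n ` Ps (Suc n) \<subset> Ps n" by (rule Qs_psubset)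
  show "M_sub (Gs n) (Ts n) (\<gamma>s n (Ps n)) \<subset> \<gamma>s n (Ps n)"
    unfolding \<gamma>s_Ps by (rule M_sub_psubset)
  show "case n of 0 \<Rightarrow> \<gamma>s n (\<rho> n ` Ps (Suc n)) \<subseteq> M_sub (Gs n) (Ts n) (\<gamma>s n (Ps n))
    | Suc m \<Rightarrow> kernel (Gs n) (Gs m) (\<rho> m) \<subseteq> M_sub (Gs n) (Ts n) (\<gamma>s n (Ps n)) \<and>
        \<gamma>s n (\<rho> n ` Ps (Suc n)) \<subseteq> kernel (Gs n) (Gs m) (\<rho> m)"
  proof (cases n)
    case 0
    then show ?thesis unfolding \<gamma>s_Ps \<gamma>s_Qs using image_A_M_sub[of 0] by simp
  next
    case (Suc m)
    then show ?thesis
      unfolding \<gamma>s_Ps \<gamma>s_Qs using image_A_M_sub[of "Suc m"] kernel_\<rho>[of m] by simp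
  qed
  show "{\<one>\<^bsub>Gs n\<^esub>} \<subset> \<gamma>s n (\<rho> n ` Ps (Suc n))"
    unfolding \<gamma>s_Qs by (rule image_A_neq_one) simp
  show "open_normal (Gs n) (Ts n) M \<longrightarrow> \<gamma>s n M \<subseteq> Ps n \<or> \<gamma>s n (\<rho> n ` Ps (Suc n)) \<subseteq> \<gamma>s n M" for M
  proof
    assume M: "open_normal (Gs n) (Ts n) M"
    define L where "L = {x \<in> carrier G. \<pi> n x \<in> M}"
    have cM: "closed_subgroup (Gs n) (Ts n) M"
      using epi.H.closed_normal_imp_subgroup[OF epi.H.open_normal_imp_closed_normal[OF M]] .
    have im: "\<pi> n ` L = M" unfolding L_def by (rule epi.image_preimage[OF epi.H.closed_subgroup_subset[OF cM]])
    have L: "closed_normal G T L"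
      unfolding L_def by (intro open_normal_imp_closed_normal epi.open_normal_preimage M)
    have gM: "\<gamma>s n M = \<pi> n ` lower_central G T (c + 1) L"
      using epi.image_lower_central[OF closed_normal_subset[OF L], of n "c + 1"] im by simp
    have "L \<subseteq> P n \<or> A (Suc n) \<subseteq> lower_central G T (c + 1) L"
      using step[of n] L unfolding tower_step_def A_def by blast
    then show "\<gamma>s n M \<subseteq> Ps n \<or> \<gamma>s n (\<rho> n ` Ps (Suc n)) \<subseteq> \<gamma>s n M"
    proof
      assume "L \<subseteq> P n"
      then have "M \<subseteq> Ps n" using im by blast
      then show ?thesis using epi.H.lower_central_subset[OF cM, of "c + 1"] by blast
    next
      assume "A (Suc n) \<subseteq> lower_central G T (c + 1) L"
      then show ?thesis unfolding \<gamma>s_Qs gM by blast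
    qed
  qed
  show "\<not> (\<exists>V. closed_subgroup (Gs n) (Ts n) V \<and> \<not> V \<lhd> Gs n \<and> finite (conjugates (Gs n) V) \<and>
      card (conjugates (Gs n) V) \<le> n \<and> pairwise (centralize_each_other (Gs n)) (conjugates (Gs n) V) \<and>
      \<gamma>s n (Ps n) \<subseteq> \<gamma>s n (\<gamma>s n (closed_normal_closure (Gs n) (Ts n) V)))"
    using no_commuting_conjugates by meson
qed

end

lemma (in profinite) ex_nilpotent_tower:
  assumes FF: "Fitting_free G T" and her: "hereditarily_JNNF c G T" and fg: "finitely_generated G T"
  shows "\<exists>(Gs :: nat \<Rightarrow> 'a set monoid) Ts \<rho> P.
    inverse_system Gs Ts \<rho> \<and> is_inverse_limit G T Gs Ts \<rho> \<and>
    (\<forall>n. open_normal (Gs n) (Ts n) (P n)) \<and> tower_conditions c Gs Ts \<rho> P"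
proof -
  obtain Q :: "nat \<Rightarrow> 'a set" where Q: "decseq Q" "\<And>n. open_normal G T (Q n)"
    "\<And>U. open_normal G T U \<Longrightarrow> \<exists>n. Q n \<subseteq> U"
    using finitely_generated_base[OF fg] by metis
  have "\<exists>P. \<forall>n. open_normal G T (P n) \<and> tower_step c n Q (P n) (P (Suc n))"
  proof (rule dependent_nat_choice)
    show "\<exists>P. open_normal G T P" using open_normal_carrier by blast
    show "\<exists>P'. open_normal G T P' \<and> tower_step c n Q P P'" if "open_normal G T P" for P n
      using ex_tower_step[OF FF her fg Q that] .
  qed
  then obtain P where P: "\<And>n. open_normal G T (P n)" "\<And>n. tower_step c n Q (P n) (P (Suc n))"
    by metis
  have "lower_central G T (c + 1) R \<noteq> {\<one>}" if "open_normal G T R" for R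
    using hereditarily_JNNF_imp_JNNF[OF her] that unfolding JNNF_iff by blast
  then interpret F: nilpotent_filtration G T c Q P
    using Q P by unfold_locales
  have "is_inverse_limit G T F.Gs F.Ts F.\<rho>"
    using profinite_tower.is_inverse_limit[OF F.profinite_tower F.inverse_system] .
  moreover have "open_normal (F.Gs n) (F.Ts n) (F.Ps n)" for n
    using F.epi.open_normal_image[OF P(1)] .
  ultimately show ?thesis
    using F.inverse_system F.tower_conditions
    by (intro exI[of _ F.Gs] exI[of _ F.Ts] exI[of _ F.\<rho>] exI[of _ F.Ps] conjI allI)
qed

theorem theorem4p7:
  fixes G :: "('a, 'k) monoid_scheme" and T :: "'a topology" and c :: nat
  assumes "profinite_group G T" and "Fitting_free G T"
  shows
    "(finitely_generated G T \<and> hereditarily_JNNF c G T \<longrightarrow>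
       (\<exists>(Gs :: nat \<Rightarrow> 'a set monoid) Ts \<rho> P.
          inverse_system Gs Ts \<rho> \<and> is_inverse_limit G T Gs Ts \<rho> \<and>
          (\<forall>n. open_normal (Gs n) (Ts n) (P n)) \<and>
          tower_conditions c Gs Ts \<rho> P)) \<and>
     (\<forall>(Gs :: nat \<Rightarrow> ('b, 'm) monoid_scheme) Ts \<rho> P (d :: nat).
        d \<ge> 1 \<and> inverse_system Gs Ts \<rho> \<and>
        (\<forall>n. generator_group d (Gs n) (Ts n)) \<and>
        is_inverse_limit G T Gs Ts \<rho> \<and>
        (\<forall>n. open_normal (Gs n) (Ts n) (P n)) \<and>
        tower_conditions c Gs Ts \<rho> P \<longrightarrow>
        hereditarily_JNNF c G T)"
proof (intro conjI impI allI; elim conjE)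
  interpret profinite G T using assms(1) by (simp add: profinite_iff)
  show "\<exists>(Gs :: nat \<Rightarrow> 'a set monoid) Ts \<rho> P.
          inverse_system Gs Ts \<rho> \<and> is_inverse_limit G T Gs Ts \<rho> \<and>
          (\<forall>n. open_normal (Gs n) (Ts n) (P n)) \<and> tower_conditions c Gs Ts \<rho> P"
    if "finitely_generated G T" "hereditarily_JNNF c G T"
    using ex_nilpotent_tower[OF assms(2) that(2,1)] .
  show "hereditarily_JNNF c G T"
    if lim: "inverse_system Gs Ts \<rho>" "is_inverse_limit G T Gs Ts \<rho>"
      and P: "\<forall>n. open_normal (Gs n) (Ts n) (P n)" "tower_conditions c Gs Ts \<rho> P"
    for Gs :: "nat \<Rightarrow> ('b, 'm) monoid_scheme" and Ts \<rho> P
  proof -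
    obtain \<pi> where "profinite_tower G T Gs Ts \<rho> \<pi>" using inverse_limit_imp_tower[OF lim] by metis
    then have "nilpotent_tower G T Gs Ts \<rho> \<pi> P c"
      using P assms(2) by (simp add: nilpotent_tower_def nilpotent_tower_axioms_def)
    then show ?thesis by (rule nilpotent_tower.hereditarily_JNNF_limit)
  qed
qed

end
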